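(* Let $q>1$, $0<p\le q<\infty$, $\alpha>p-1$ and $\beta>q$, and let $\mu$ be a positive Borel measure on $[0,1)$ satisfying condition $(W_{p,\alpha})$. (i) If $\mathcal{H}_{\mu,\beta}$ is a bounded operator from $\mathcal{D}^p_\alpha$ into $\mathcal{D}^q_{\beta-1}$, then $\mu$ is a $\left(\frac{\alpha+2}{p}+\frac{\beta+1}{q'}-1\right)$-Carleson measure. (ii) If $\mu$ is a $\left(\max\{\alpha+2-p,\beta+1\}\left(\frac1p+\frac1{q'}\right)\right)$-Carleson measure, then $\mathcal{H}_{\mu,\beta}$ is a bounded operator from $\mathcal{D}^p_\alpha$ into $\mathcal{D}^q_{\beta-1}$.
   Context: $\mathbb{D}$ is the open unit disc, $dA=\frac1\pi dx\,dy$. For $0<p<\infty$, $\alpha>-1$, $A^p_\alpha$ is the space of analytic $f$ on $\mathbb{D}$ with $\|f\|_{A^p_\alpha}=\left((\alpha+1)\int_{\mathbb{D}}|f|^p(1-|z|^2)^\alpha dA\right)^{1/p}<\infty$, and the Dirichlet-type space $\mathcal{D}^p_\alpha$ consists of analytic $f$ with $f'\in A^p_\alpha$, normed by $\|f\|_{\mathcal{D}^p_\alpha}=|f(0)|+\|f'\|_{A^p_\alpha}$. $q'$ is defined by $1/q+1/q'=1$. For a positive Borel measure $\mu$ on $[0,1)$ and $\beta>0$, $\mu_{n,k,\beta}=\frac{\Gamma(n+\beta)}{n!\Gamma(\beta)}\int_{[0,1)}t^{n+k}d\mu(t)$ and for $f(z)=\sum_k a_kz^k$ analytic, $\mathcal{H}_{\mu,\beta}(f)(z)=\sum_n\left(\sum_k\mu_{n,k,\beta}a_k\right)z^n$.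 Boundedness from $X$ into $Y$ means $\mathcal{H}_{\mu,\beta}(f)$ is defined and lies in $Y$ for all $f\in X$ with $\|\mathcal{H}_{\mu,\beta}(f)\|_Y\le C\|f\|_X$. For $s>0$, $\mu$ is an $s$-Carleson measure if $\mu([t,1))\le C(1-t)^s$ for all $0\le t<1$. Condition $(W_{p,\alpha})$: if $0<p\le1$, $\mu$ is a $\frac{\alpha+2}{p}$-Carleson measure; if $1\le p\le 2$, $\mu$ is a $\frac{\alpha+2-(p-1)^2}{p}$-Carleson measure; if $2\le p<\infty$, $\mu$ is a $\frac{\alpha+1}{p}$-Carleson measure. *)

theory Defs
  imports "HOL-Analysis.Analysis"
begin

text \<open>Weighted Bergman quasinorm raised to the p-th power, with dA = (1/pi) dx dy:
  (alpha+1) * integral over the unit disc of |f|^p (1-|z|^2)^alpha dA.\<close>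
definition bergman_int :: "real \<Rightarrow> real \<Rightarrow> (complex \<Rightarrow> complex) \<Rightarrow> ennreal" where
  "bergman_int p \<alpha> f =
     ennreal (\<alpha> + 1) *
     (\<integral>\<^sup>+ z \<in> ball 0 1. ennreal (norm (f z) powr p * (1 - (norm z)\<^sup>2) powr \<alpha> / pi) \<partial>lborel)"

definition in_bergman :: "real \<Rightarrow> real \<Rightarrow> (complex \<Rightarrow> complex) \<Rightarrow> bool" where
  "in_bergman p \<alpha> f \<longleftrightarrow> f holomorphic_on ball 0 1 \<and> bergman_int p \<alpha> f < \<infinity>"

definition bergman_norm :: "real \<Rightarrow> real \<Rightarrow> (complex \<Rightarrow> complex) \<Rightarrow> real" where
  "bergman_norm p \<alpha> f = (enn2real (bergman_int p \<alpha> f)) powr (1 / p)"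

definition in_dirichlet :: "real \<Rightarrow> real \<Rightarrow> (complex \<Rightarrow> complex) \<Rightarrow> bool" where
  "in_dirichlet p \<alpha> f \<longleftrightarrow> f holomorphic_on ball 0 1 \<and> in_bergman p \<alpha> (deriv f)"

definition dirichlet_norm :: "real \<Rightarrow> real \<Rightarrow> (complex \<Rightarrow> complex) \<Rightarrow> real" where
  "dirichlet_norm p \<alpha> f = norm (f 0) + bergman_norm p \<alpha> (deriv f)"

definition taylor_coeff :: "(complex \<Rightarrow> complex) \<Rightarrow> nat \<Rightarrow> complex" where
  "taylor_coeff f k = (deriv ^^ k) f 0 / fact k"

text \<open>mu_{n,k,beta}; mu is a measure on the reals concentrated on [0,1).\<close>
definition mu_coeff :: "real measure \<Rightarrow> real \<Rightarrow> nat \<Rightarrow> nat \<Rightarrow> real" where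
  "mu_coeff \<mu> \<beta> n k =
     Gamma (real n + \<beta>) / (fact n * Gamma \<beta>) * (\<integral>t\<in>{0..<1}. t ^ (n + k) \<partial>\<mu>)"

definition H_coeff :: "real measure \<Rightarrow> real \<Rightarrow> (complex \<Rightarrow> complex) \<Rightarrow> nat \<Rightarrow> complex" where
  "H_coeff \<mu> \<beta> f n = (\<Sum>k. complex_of_real (mu_coeff \<mu> \<beta> n k) * taylor_coeff f k)"

definition H_defined :: "real measure \<Rightarrow> real \<Rightarrow> (complex \<Rightarrow> complex) \<Rightarrow> bool" where
  "H_defined \<mu> \<beta> f \<longleftrightarrow>
     (\<forall>n. summable (\<lambda>k. complex_of_real (mu_coeff \<mu> \<beta> n k) * taylor_coeff f k)) \<and>
     (\<forall>z \<in> ball 0 1. summable (\<lambda>n. H_coeff \<mu> \<beta> f n * z ^ n))"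

definition H_op :: "real measure \<Rightarrow> real \<Rightarrow> (complex \<Rightarrow> complex) \<Rightarrow> complex \<Rightarrow> complex" where
  "H_op \<mu> \<beta> f z = (\<Sum>n. H_coeff \<mu> \<beta> f n * z ^ n)"

definition H_bounded_DD ::
  "real measure \<Rightarrow> real \<Rightarrow> real \<Rightarrow> real \<Rightarrow> real \<Rightarrow> real \<Rightarrow> bool" where
  "H_bounded_DD \<mu> \<beta> p \<alpha> q \<gamma> \<longleftrightarrow>
     (\<exists>C. \<forall>f. in_dirichlet p \<alpha> f \<longrightarrow>
        H_defined \<mu> \<beta> f \<and> in_dirichlet q \<gamma> (H_op \<mu> \<beta> f) \<and>
        dirichlet_norm q \<gamma> (H_op \<mu> \<beta> f) \<le> C * dirichlet_norm p \<alpha> f)"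

definition carleson :: "real \<Rightarrow> real measure \<Rightarrow> bool" where
  "carleson s \<mu> \<longleftrightarrow> (\<exists>C. \<forall>t. 0 \<le> t \<and> t < 1 \<longrightarrow>
      emeasure \<mu> {t..<1} \<le> ennreal (C * (1 - t) powr s))"

definition cond_W :: "real \<Rightarrow> real \<Rightarrow> real measure \<Rightarrow> bool" where
  "cond_W p \<alpha> \<mu> \<longleftrightarrow>
     (p \<le> 1 \<longrightarrow> carleson ((\<alpha> + 2) / p) \<mu>) \<and>
     (1 \<le> p \<and> p \<le> 2 \<longrightarrow> carleson ((\<alpha> + 2 - (p - 1)\<^sup>2) / p) \<mu>) \<and>
     (2 \<le> p \<longrightarrow> carleson ((\<alpha> + 1) / p) \<mu>)"

definition conj_exp :: "real \<Rightarrow> real" where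
  "conj_exp q = q / (q - 1)"

end

theory Submission
  imports Defs "HOL-Complex_Analysis.Complex_Analysis"
begin

text \<open>For (i), the functions \<open>(1 - bz) powr - (\<alpha> + 2) / p\<close> have norm \<open>O(1 / (1 - b))\<close> and nonnegative
  Taylor coefficients, so the derivative of their image at \<open>b\<close> dominates \<open>\<mu>([b, 1))\<close> times a power
  of \<open>1 - b\<close>, while it is controlled by the growth of Bergman functions.

  For (ii), put \<open>\<sigma> = (\<alpha> + 2) / p - 1\<close>. The hypothesis implies the weaker one that \<open>\<mu>\<close> is a
  \<open>(\<sigma> + (\<beta> + 1) / q')\<close>-Carleson measure, and this already suffices. The derivative of the image
  is \<open>\<beta> \<integral> t f(t) (1 - tz) powr - (\<beta> + 1) d\<mu>(t)\<close>; bounding \<open>f(t)\<close> by \<open>|f(0)| + \<integral>\<^sub>0\<^sup>t |f'|\<close> turns it into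
  an integral operator acting on the radial restriction of \<open>|f'|\<close>, which a Schur test bounds. The
  remaining one-dimensional integral of \<open>|f'|\<close> to the power \<open>q \<ge> p\<close> is handled by the pointwise
  growth and by Fubini from a local submean value estimate for \<open>|f'|\<close> to the power \<open>p\<close>.\<close>

section \<open>Integrals against measures with power decay\<close>

text \<open>The weaker exponent that suffices for (ii) is exactly the one that (i) yields, so under
  the common hypotheses that Carleson condition characterises boundedness. The obstacle in (ii) is
  that the operator is given by series in the Taylor coefficients \<open>a k\<close> of
  \<open>f\<close>, not by an integral. Exchanging the sum over \<open>k\<close> with the integral
  requires integrating the sum of \<open>|a k| * t ^ k\<close>. Bessel's inequality with
  Cauchy-Schwarz bounds that sum by \<open>(1 - t) powr - (\<sigma> + 1/2)\<close>, half a power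
  worse than \<open>f(t)\<close> itself. An exponent above \<open>\<sigma> + 1/2\<close> is
  therefore needed merely to define the operator. The integrals share one pattern because
  \<open>|1 - tz|\<close> is bounded below, up to a constant, by \<open>(1 - t) + |1 - z|\<close>:
  only distances to the point 1 matter. Each measure involved has mass of order
  \<open>r powr s\<close> within distance \<open>r\<close> of 1, with \<open>s\<close> the Carleson
  exponent for \<open>\<mu>\<close>, \<open>\<beta> + 1\<close> for the weighted area and 1 for
  length.\<close>

lemma powr_le_powr_abs:
  fixes k v e :: real
  assumes "k > 0" "1/k \<le> v" "v \<le> k"
  shows "v powr e \<le> k powr \<bar>e\<bar>"
proof (cases "e \<ge> 0")
  case True
  have "v > 0" using assms by (smt (verit) divide_pos_pos)
  then show ?thesis using True assms by (simp add: powr_mono2)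
next
  case False
  then have "v powr e \<le> (1/k) powr e"
    using assms by (intro powr_mono2') auto
  also have "\<dots> = k powr \<bar>e\<bar>"
    using False assms by (simp add: powr_divide powr_minus field_simps)
  finally show ?thesis .
qed

lemma ex_dyadic:
  fixes x :: real
  assumes "x \<ge> 1"
  shows "\<exists>n. 2 ^ n \<le> x \<and> x < 2 ^ Suc n"
proof -
  obtain m where m: "x < 2 ^ m" using real_arch_pow[of 2 x] by auto
  define n where "n = (LEAST n. x < 2 ^ Suc n)"
  have ex: "x < 2 ^ Suc m" using m by (simp, smt (verit) zero_less_power)
  have 1: "x < 2 ^ Suc n" unfolding n_def using ex by (rule LeastI)
  have 2: "2 ^ n \<le> x"
  proof (cases n)
    case 0 then show ?thesis using assms by simp
  next
    case (Suc k)
    then have "\<not> x < 2 ^ Suc k" unfolding n_def by (metis lessI not_less_Least n_def)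
    then show ?thesis using Suc by simp
  qed
  show ?thesis using 1 2 by blast
qed

text \<open>An abstract Carleson condition relative to a gauge \<open>h\<close>, so that the same
  estimates serve for \<open>1 - t\<close> on \<open>[0, 1)\<close>, for \<open>|1 - z|\<close> and
  \<open>1 - |z|^2\<close> in the disc and for \<open>1 - u\<close> on a segment. The constant is a
  parameter because \<open>wdisc_decay\<close> applies it with a constant proportional to the size
  of a box.\<close>

definition decay :: "'a measure \<Rightarrow> ('a \<Rightarrow> real) \<Rightarrow> real \<Rightarrow> real \<Rightarrow> bool" where
  "decay M h C s \<longleftrightarrow> h \<in> borel_measurable M \<and> (\<forall>x\<in>space M. 0 < h x) \<and> 0 \<le> C \<and>
     (\<forall>r>0. emeasure M {x\<in>space M. h x \<le> r} \<le> ennreal (C * r powr s))"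

text \<open>The shell with upper end \<open>r0 * \<rho> ^ n\<close> contributes at most a constant
  times the \<open>(s + e)\<close>-th power of that end, so the shells form a geometric series.
  Leaving the ratio open covers both directions: \<open>\<rho> = 1/2\<close> for
  \<open>s + e > 0\<close>, shrinking towards \<open>h = 0\<close>, and \<open>\<rho> = 2\<close>
  for \<open>s + e < 0\<close>, moving away from it.\<close>

lemma decay_dyadic:
  assumes dec: "decay M h C s" and r0: "r0 > 0" and \<rho>: "\<rho> > 0" "\<rho> powr (s + e) < 1"
    and cov: "\<And>x. x \<in> space M \<Longrightarrow> x \<in> S \<Longrightarrow> \<exists>n. r0 * \<rho> ^ n / 2 \<le> h x \<and> h x \<le> r0 * \<rho> ^ n"
  shows "(\<integral>\<^sup>+x. ennreal (h x powr e) * indicator S x \<partial>M)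
           \<le> ennreal (C * 2 powr \<bar>e\<bar> * r0 powr (s + e) / (1 - \<rho> powr (s + e)))"
proof -
  have [measurable]: "h \<in> borel_measurable M" and C: "C \<ge> 0"
    and em: "\<And>r. r > 0 \<Longrightarrow> emeasure M {x\<in>space M. h x \<le> r} \<le> ennreal (C * r powr s)"
    and hpos: "\<And>x. x \<in> space M \<Longrightarrow> 0 < h x"
    using dec by (auto simp: decay_def)
  define r where "r n = r0 * \<rho> ^ n" for n
  have rpos: "r n > 0" for n using r0 \<rho> by (simp add: r_def)
  define A where "A n = {x\<in>space M. h x \<le> r n}" for n
  have [measurable]: "A n \<in> sets M" for n unfolding A_def by measurable
  have pw: "ennreal (h x powr e) * indicator S x
      \<le> (\<Sum>n. ennreal (2 powr \<bar>e\<bar> * r n powr e) * indicator (A n) x)" if x: "x \<in> space M" for x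
  proof (cases "x \<in> S")
    case True
    then obtain n where n: "r n / 2 \<le> h x" "h x \<le> r n" using cov x unfolding r_def by blast
    have "h x powr e = (h x / r n) powr e * r n powr e"
      using hpos[OF x] rpos[of n] by (simp add: powr_divide)
    also have "\<dots> \<le> 2 powr \<bar>e\<bar> * r n powr e"
      using n rpos[of n] by (intro mult_right_mono powr_le_powr_abs) (auto simp: field_simps)
    finally have "ennreal (h x powr e) * indicator S x \<le> ennreal (2 powr \<bar>e\<bar> * r n powr e) * indicator (A n) x"
      using n x True by (simp add: A_def ennreal_leI)
    also have "\<dots> = (\<Sum>n\<in>{n}. ennreal (2 powr \<bar>e\<bar> * r n powr e) * indicator (A n) x)"
      by (simp only: sum.insert finite.emptyI empty_iff not_False_eq_True sum.empty add_0_right)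
    also have "\<dots> \<le> (\<Sum>n. ennreal (2 powr \<bar>e\<bar> * r n powr e) * indicator (A n) x)"
      by (intro sum_le_suminf) auto
    finally show ?thesis .
  qed auto
  have "(\<integral>\<^sup>+x. ennreal (h x powr e) * indicator S x \<partial>M)
      \<le> (\<integral>\<^sup>+x. (\<Sum>n. ennreal (2 powr \<bar>e\<bar> * r n powr e) * indicator (A n) x) \<partial>M)"
    by (intro nn_integral_mono pw)
  also have "\<dots> = (\<Sum>n. \<integral>\<^sup>+x. ennreal (2 powr \<bar>e\<bar> * r n powr e) * indicator (A n) x \<partial>M)"
    by (intro nn_integral_suminf) auto
  also have "\<dots> = (\<Sum>n. ennreal (2 powr \<bar>e\<bar> * r n powr e) * emeasure M (A n))"
    by (simp add: nn_integral_cmult_indicator)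
  also have "\<dots> \<le> (\<Sum>n. ennreal (C * 2 powr \<bar>e\<bar> * r0 powr (s + e) * (\<rho> powr (s + e)) ^ n))"
  proof (rule suminf_le)
    fix n
    have "ennreal (2 powr \<bar>e\<bar> * r n powr e) * emeasure M (A n)
        \<le> ennreal (2 powr \<bar>e\<bar> * r n powr e) * ennreal (C * r n powr s)"
      unfolding A_def by (intro mult_left_mono em rpos) simp
    also have "\<dots> = ennreal (C * 2 powr \<bar>e\<bar> * r n powr (s + e))"
      using C by (simp add: ennreal_mult'[symmetric] powr_add mult_ac)
    also have "r n powr (s + e) = r0 powr (s + e) * (\<rho> powr (s + e)) ^ n"
      using r0 \<rho> by (simp add: r_def powr_mult powr_power powr_realpow[symmetric] powr_powr mult_ac)
    finally show "ennreal (2 powr \<bar>e\<bar> * r n powr e) * emeasure M (A n)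
      \<le> ennreal (C * 2 powr \<bar>e\<bar> * r0 powr (s + e) * (\<rho> powr (s + e)) ^ n)"
      by (simp add: mult_ac)
  qed auto
  also have "\<dots> = ennreal (C * 2 powr \<bar>e\<bar> * r0 powr (s + e) / (1 - \<rho> powr (s + e)))"
  proof (rule suminf_ennreal_eq)
    show "(\<lambda>n. C * 2 powr \<bar>e\<bar> * r0 powr (s + e) * (\<rho> powr (s + e)) ^ n) sums
        (C * 2 powr \<bar>e\<bar> * r0 powr (s + e) / (1 - \<rho> powr (s + e)))"
      using sums_mult[OF geometric_sums[of "\<rho> powr (s + e)"], of "C * 2 powr \<bar>e\<bar> * r0 powr (s + e)"] \<rho>
      by simp
  qed (use C in auto)
  finally show ?thesis .
qed

lemma decay_integral_le:
  assumes dec: "decay M h C s" and u: "u > 0" and y: "y < s"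
  shows "(\<integral>\<^sup>+x. ennreal (h x powr - y) * indicator {x. h x \<le> u} x \<partial>M)
           \<le> ennreal (C * (2 powr \<bar>y\<bar> / (1 - (1/2) powr (s - y))) * u powr (s - y))"
proof -
  have "(1/2::real) powr (s - y) < (1/2) powr 0"
    using y by (intro powr_less_mono') auto
  then have lt: "(1/2::real) powr (s - y) < 1" by simp
  have cov: "\<exists>n. u * (1/2) ^ n / 2 \<le> h x \<and> h x \<le> u * (1/2) ^ n"
    if "x \<in> space M" "x \<in> {x. h x \<le> u}" for x
  proof -
    have h: "h x > 0" using dec that by (auto simp: decay_def)
    have "1 \<le> u / h x" using h that by simp
    then obtain n where "2 ^ n \<le> u / h x" "u / h x < 2 ^ Suc n"
      using ex_dyadic by blast
    then show ?thesis using h by (intro exI[of _ n]) (simp add: field_simps)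
  qed
  show ?thesis
    using decay_dyadic[OF dec u, of "1/2" "-y" "{x. h x \<le> u}"] cov lt by (simp add: mult_ac)
qed

lemma decay_integral_ge:
  assumes dec: "decay M h C s" and u: "u > 0" and e: "s < e"
  shows "(\<integral>\<^sup>+x. ennreal (h x powr - e) * indicator {x. u \<le> h x} x \<partial>M)
           \<le> ennreal (C * (2 powr \<bar>e\<bar> * 2 powr (s - e) / (1 - 2 powr (s - e))) * u powr (s - e))"
proof -
  have "(2::real) powr (s - e) < 2 powr 0"
    using e by (intro powr_less_mono) auto
  then have lt: "2 powr (s - e) < (1::real)" by simp
  \<comment> \<open>A shell reaches from half of its upper end to that end, so the first one has to
    end at \<open>2 * u\<close> in order to begin at \<open>u\<close>.\<close>
  have cov: "\<exists>n. 2 * u * 2 ^ n / 2 \<le> h x \<and> h x \<le> 2 * u * 2 ^ n"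
    if "x \<in> space M" "x \<in> {x. u \<le> h x}" for x
  proof -
    have h: "h x > 0" using dec that by (auto simp: decay_def)
    have "1 \<le> h x / u" using u that by simp
    then obtain n where "2 ^ n \<le> h x / u" "h x / u < 2 ^ Suc n"
      using ex_dyadic by blast
    then show ?thesis using h u by (intro exI[of _ n]) (simp add: field_simps)
  qed
  show ?thesis
    using decay_dyadic[OF dec, of "2 * u" "2" "-e" "{x. u \<le> h x}"] cov lt u by (simp add: mult_ac powr_mult)
qed

text \<open>Split at \<open>h = \<delta>\<close>. Below, the second factor is at most
  \<open>\<delta> powr - B\<close>, and \<open>y < s\<close> makes the power of \<open>h\<close>
  integrable. Above, it is at most \<open>h powr - B\<close>, and \<open>s < y + B\<close> makes the
  tail converge. Both halves scale as \<open>\<delta> powr (s - y - B)\<close>. This is the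
  Forelli-Rudin type estimate behind the test functions and the Schur test.\<close>

lemma decay_kernel:
  assumes dec: "decay M h C s" and y: "y < s" and B: "s < y + B" "0 \<le> B"
  obtains D where "D \<ge> 0" "\<And>\<delta>. \<delta> > 0 \<Longrightarrow>
    (\<integral>\<^sup>+x. ennreal (h x powr - y * (\<delta> + h x) powr - B) \<partial>M) \<le> ennreal (D * \<delta> powr (s - y - B))"
proof -
  have [measurable]: "h \<in> borel_measurable M" and C: "C \<ge> 0" using dec by (auto simp: decay_def)
  define D1 where "D1 = C * (2 powr \<bar>y\<bar> / (1 - (1/2) powr (s - y)))"
  define D2 where "D2 = C * (2 powr \<bar>y+B\<bar> * 2 powr (s - (y+B)) / (1 - 2 powr (s - (y+B))))"
  have "(1/2::real) powr (s - y) < (1/2) powr 0"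
    using y by (intro powr_less_mono') auto
  then have D1: "D1 \<ge> 0" using C by (simp add: D1_def)
  have "(2::real) powr (s - (y+B)) < 2 powr 0"
    using B by (intro powr_less_mono) auto
  then have D2: "D2 \<ge> 0" using C by (simp add: D2_def)
  show ?thesis
  proof (rule that[of "D1 + D2"])
    show "D1 + D2 \<ge> 0" using D1 D2 by simp
    fix \<delta> :: real assume \<delta>: "\<delta> > 0"
    have pw: "ennreal (h x powr - y * (\<delta> + h x) powr - B) \<le>
       ennreal (\<delta> powr - B) * (ennreal (h x powr - y) * indicator {x. h x \<le> \<delta>} x)
       + ennreal (h x powr - (y + B)) * indicator {x. \<delta> \<le> h x} x" if "x \<in> space M" for x
    proof (cases "h x \<le> \<delta>")
      case True
      have h: "h x > 0" using dec that by (auto simp: decay_def)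
      have "(\<delta> + h x) powr - B \<le> \<delta> powr - B"
        using \<delta> h B by (intro powr_mono2') auto
      then have "h x powr - y * (\<delta> + h x) powr - B \<le> h x powr - y * \<delta> powr - B"
        by (intro mult_left_mono) auto
      then have "ennreal (h x powr - y * (\<delta> + h x) powr - B) \<le> ennreal (\<delta> powr - B * h x powr - y)"
        by (intro ennreal_leI) (simp add: mult_ac)
      then show ?thesis using True by (simp add: ennreal_mult' add_increasing2)
    next
      case False
      have h: "h x > 0" using dec that by (auto simp: decay_def)
      have "(\<delta> + h x) powr - B \<le> h x powr - B"
        using \<delta> h B by (intro powr_mono2') auto
      then have "h x powr - y * (\<delta> + h x) powr - B \<le> h x powr - y * h x powr - B"
        by (intro mult_left_mono) auto
      also have "\<dots> = h x powr - (y + B)" by (simp add: powr_add[symmetric])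
      finally have "ennreal (h x powr - y * (\<delta> + h x) powr - B) \<le> ennreal (h x powr - (y + B))"
        by (rule ennreal_leI)
      then show ?thesis using False by simp
    qed
    have "(\<integral>\<^sup>+x. ennreal (h x powr - y * (\<delta> + h x) powr - B) \<partial>M)
      \<le> (\<integral>\<^sup>+x. ennreal (\<delta> powr - B) * (ennreal (h x powr - y) * indicator {x. h x \<le> \<delta>} x)
       + ennreal (h x powr - (y + B)) * indicator {x. \<delta> \<le> h x} x \<partial>M)"
      by (intro nn_integral_mono pw)
    also have "\<dots> = ennreal (\<delta> powr - B) * (\<integral>\<^sup>+x. ennreal (h x powr - y) * indicator {x. h x \<le> \<delta>} x \<partial>M)
       + (\<integral>\<^sup>+x. ennreal (h x powr - (y + B)) * indicator {x. \<delta> \<le> h x} x \<partial>M)"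
      by (subst nn_integral_add) (auto simp: nn_integral_cmult)
    also have "\<dots> \<le> ennreal (\<delta> powr - B) * ennreal (D1 * \<delta> powr (s - y)) + ennreal (D2 * \<delta> powr (s - (y + B)))"
      unfolding D1_def D2_def
      by (intro add_mono mult_left_mono decay_integral_le[OF dec \<delta>] decay_integral_ge[OF dec \<delta>]) (use y B in auto)
    also have "\<dots> = ennreal ((D1 + D2) * \<delta> powr (s - y - B))"
      using D1 D2 \<delta> by (simp add: ennreal_mult'[symmetric] ennreal_plus[symmetric] powr_diff powr_minus powr_add field_simps del: ennreal_plus)
    finally show "(\<integral>\<^sup>+x. ennreal (h x powr - y * (\<delta> + h x) powr - B) \<partial>M) \<le> ennreal ((D1 + D2) * \<delta> powr (s - y - B))" .
  qed
qed

text \<open>Hoelder's inequality raised to the power \<open>q\<close>. It is phrased with real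
  bounds \<open>X\<close> and \<open>J\<close>, so that no extended real number is raised to a real
  power.\<close>

lemma nn_integral_Holder:
  fixes u v :: "'a \<Rightarrow> real"
  assumes [measurable]: "u \<in> borel_measurable M" "v \<in> borel_measurable M"
    and nn: "\<And>x. x \<in> space M \<Longrightarrow> u x \<ge> 0" "\<And>x. x \<in> space M \<Longrightarrow> v x \<ge> 0" and q: "q > 1"
    and J: "J \<ge> 0" "(\<integral>\<^sup>+x. ennreal (v x powr (q / (q - 1))) \<partial>M) \<le> ennreal J"
    and x0: "X \<ge> 0" "ennreal X \<le> (\<integral>\<^sup>+x. ennreal (u x * v x) \<partial>M)"
  shows "ennreal (X powr q) \<le> ennreal (J powr (q - 1)) * (\<integral>\<^sup>+x. ennreal (u x powr q) \<partial>M)"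
proof -
  define q' where "q' = q / (q - 1)"
  have q': "q' > 1" "1 / q + 1 / q' = 1" using q by (auto simp: q'_def field_simps)
  define I where "I = (\<integral>\<^sup>+x. ennreal (u x powr q) \<partial>M)"
  have zero: ?thesis if "AE x in M. u x * v x = 0"
  proof -
    have "(\<integral>\<^sup>+x. ennreal (u x * v x) \<partial>M) = 0"
      by (subst nn_integral_0_iff_AE) (use that in auto)
    then have "X = 0" using x0 by (simp add: ennreal_eq_0_iff)
    then show ?thesis by simp
  qed
  show ?thesis
  proof (cases "J = 0")
    case True
    then have "(\<integral>\<^sup>+x. ennreal (v x powr q') \<partial>M) = 0" using J by (simp add: q'_def)
    then have "AE x in M. ennreal (v x powr q') = 0" by (subst (asm) nn_integral_0_iff_AE) auto
    then have "AE x in M. u x * v x = 0" by eventually_elim (auto simp: ennreal_eq_0_iff)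
    then show ?thesis by (rule zero)
  next
    case Jn: False
    then have Jp: "J > 0" using J by simp
    show ?thesis
    proof (cases "I = \<infinity>")
      case True
      have "ennreal (J powr (q - 1)) * I = \<infinity>"
        using Jp True by (simp add: ennreal_mult_eq_top_iff)
      then show ?thesis unfolding I_def by simp
    next
      case False
      then obtain i where i: "I = ennreal i" "i \<ge> 0" by (cases I) auto
      show ?thesis
      proof (cases "i = 0")
        case True
        then have "(\<integral>\<^sup>+x. ennreal (u x powr q) \<partial>M) = 0" using i by (simp add: I_def)
        then have "AE x in M. ennreal (u x powr q) = 0"
          by (subst (asm) nn_integral_0_iff_AE) auto
        then have "AE x in M. u x * v x = 0" by eventually_elim (auto simp: ennreal_eq_0_iff)
        then show ?thesis by (rule zero)
      next
        case False
        then have ip: "i > 0" using i by simp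
        \<comment> \<open>\<open>a\<close> is the \<open>q\<close>-norm of \<open>u\<close> and
          \<open>b\<close> the bound that \<open>J\<close> gives for the \<open>q'\<close>-norm of
          \<open>v\<close>. After division by them, Young's inequality integrates to at most
          \<open>1/q + 1/q' = 1\<close>.\<close>
        define a b where "a = i powr (1/q)" and "b = J powr (1/q')"
        have ab: "a > 0" "b > 0" using ip Jp by (auto simp: a_def b_def)
        have aq: "a powr q = i" "b powr q' = J" using ip Jp q q' by (auto simp: a_def b_def powr_powr)
        have pw: "ennreal (u x * v x) \<le> ennreal (a * b / (q * i)) * ennreal (u x powr q) + ennreal (a * b / (q' * J)) * ennreal (v x powr q')"
          if "x \<in> space M" for x
        proof -
          have "(u x / a) * (v x / b) \<le> (u x / a) powr q / q + (v x / b) powr q' / q'"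
            using q q' ab nn[OF that] by (intro Youngs_inequality) auto
          also have "\<dots> = u x powr q / (q * i) + v x powr q' / (q' * J)"
            using ab nn[OF that] aq by (simp add: powr_divide mult_ac)
          finally have "u x * v x \<le> a * b * (u x powr q / (q * i) + v x powr q' / (q' * J))"
            using ab by (simp add: field_simps)
          then have "u x * v x \<le> (a * b / (q * i)) * (u x powr q) + (a * b / (q' * J)) * (v x powr q')"
            by (simp add: distrib_left)
          then show ?thesis
            using ab ip Jp q q' by (simp add: ennreal_mult'[symmetric] ennreal_plus[symmetric] ennreal_leI del: ennreal_plus)
        qed
        have "ennreal X \<le> (\<integral>\<^sup>+x. ennreal (a * b / (q * i)) * ennreal (u x powr q) + ennreal (a * b / (q' * J)) * ennreal (v x powr q') \<partial>M)"
          using x0(2) by (rule order_trans) (intro nn_integral_mono pw)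
        also have "\<dots> = ennreal (a * b / (q * i)) * I + ennreal (a * b / (q' * J)) * (\<integral>\<^sup>+x. ennreal (v x powr q') \<partial>M)"
          unfolding I_def by (subst nn_integral_add) (auto simp: nn_integral_cmult)
        also have "\<dots> \<le> ennreal (a * b / (q * i)) * ennreal i + ennreal (a * b / (q' * J)) * ennreal J"
          unfolding i(1) using J(2) by (intro add_mono mult_left_mono) (auto simp: q'_def)
        also have "\<dots> = ennreal (a * b / q + a * b / q')"
          using ab ip Jp q q' by (simp add: ennreal_mult'[symmetric] ennreal_plus[symmetric] del: ennreal_plus)
        also have "a * b / q + a * b / q' = a * b" using q'(2) by (metis distrib_left mult.right_neutral times_divide_eq_right)
        finally have "X \<le> a * b" using ab by (simp add: ennreal_le_iff)
        then have "X powr q \<le> (a * b) powr q" using x0 q by (intro powr_mono2) auto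
        also have "\<dots> = i * (J powr (1/q' * q))" using ab aq by (simp add: powr_mult b_def powr_powr)
        also have "1/q' * q = q - 1" using q by (simp add: q'_def)
        finally show ?thesis unfolding I_def[symmetric] i(1)
          using ip by (simp add: ennreal_mult'[symmetric] ennreal_leI mult_ac)
      qed
    qed
  qed
qed

section \<open>The weighted area measure of the disc\<close>

text \<open>The factor \<open>\<alpha> + 1\<close> of the Bergman norm is left out. Shrinking the
  space to the disc, instead of multiplying by an indicator, makes every function that is continuous
  on the disc measurable.\<close>

definition wdisc :: "real \<Rightarrow> complex measure" where
  "wdisc \<alpha> = density (restrict_space lborel (ball 0 1)) (\<lambda>z. ennreal ((1 - (norm z)\<^sup>2) powr \<alpha> / pi))"

lemma space_wdisc [simp]: "space (wdisc \<alpha>) = ball 0 1"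
  by (simp add: wdisc_def space_restrict_space)

lemma sets_wdisc [measurable_cong]: "sets (wdisc \<alpha>) = sets (restrict_space borel (ball 0 1))"
  by (simp add: wdisc_def cong: sets_restrict_space_cong)

lemma measurable_wdisc:
  "continuous_on (ball 0 1) f \<Longrightarrow> f \<in> borel_measurable (wdisc \<alpha>)"
  using borel_measurable_continuous_on_restrict[of "ball 0 1" f]
  by (simp cong: measurable_cong_sets add: sets_wdisc)

lemma nn_integral_wdisc:
  assumes [measurable]: "f \<in> borel_measurable (restrict_space borel (ball 0 1))"
  shows "(\<integral>\<^sup>+z. f z \<partial>wdisc \<alpha>) =
     (\<integral>\<^sup>+z. ennreal ((1 - (norm z)\<^sup>2) powr \<alpha> / pi) * f z * indicator (ball 0 1) z \<partial>lborel)"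
proof -
  have [measurable]: "(\<lambda>z. ennreal ((1 - (norm z)\<^sup>2) powr \<alpha> / pi)) \<in> borel_measurable (restrict_space lborel (ball (0::complex) 1))"
    by (rule measurable_restrict_space1) measurable
  have [measurable]: "f \<in> borel_measurable (restrict_space lborel (ball 0 1))"
    using assms by (simp cong: measurable_cong_sets sets_restrict_space_cong)
  have "(\<integral>\<^sup>+z. f z \<partial>wdisc \<alpha>) = (\<integral>\<^sup>+z. ennreal ((1 - (norm z)\<^sup>2) powr \<alpha> / pi) * f z \<partial>restrict_space lborel (ball 0 1))"
    unfolding wdisc_def by (rule nn_integral_density) fact+
  then show ?thesis by (simp add: nn_integral_restrict_space)
qed

lemma bergman_int_eq:
  assumes f: "continuous_on (ball 0 1) f"
  shows "bergman_int p \<alpha> f = ennreal (\<alpha> + 1) * (\<integral>\<^sup>+z. ennreal (norm (f z) powr p) \<partial>wdisc \<alpha>)"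
proof -
  have [measurable]: "f \<in> borel_measurable (restrict_space borel (ball 0 1))"
    by (rule borel_measurable_continuous_on_restrict[OF f])
  show ?thesis unfolding bergman_int_def
    by (subst nn_integral_wdisc) (auto simp: ennreal_mult'[symmetric] mult_ac intro!: nn_integral_cong arg_cong2[where f="(*)"])
qed

lemma emeasure_ball_complex:
  "r \<ge> 0 \<Longrightarrow> emeasure lborel (ball (c::complex) r) = ennreal (pi * r\<^sup>2)"
  by (simp add: emeasure_ball unit_ball_vol_2)

lemma area_annulus:
  assumes "\<rho> > 0"
  shows "emeasure lborel {z\<in>ball (0::complex) 1. 1 - (norm z)\<^sup>2 \<le> \<rho>} \<le> ennreal (pi * \<rho>)"
proof (cases "\<rho> < 1")
  case False
  have "emeasure lborel {z\<in>ball (0::complex) 1. 1 - (norm z)\<^sup>2 \<le> \<rho>} \<le> emeasure lborel (ball (0::complex) 1)"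
    by (intro emeasure_mono) auto
  also have "\<dots> \<le> ennreal (pi * \<rho>)" using False by (simp add: emeasure_ball_complex ennreal_leI)
  finally show ?thesis .
next
  case True
  have "{z\<in>ball (0::complex) 1. 1 - (norm z)\<^sup>2 \<le> \<rho>} = ball 0 1 - ball 0 (sqrt (1 - \<rho>))"
  proof -
    have "1 - n\<^sup>2 \<le> \<rho> \<longleftrightarrow> sqrt (1 - \<rho>) \<le> n" if "n \<ge> 0" for n :: real
      using real_sqrt_le_iff[of "1 - \<rho>" "n\<^sup>2"] that by auto
    then show ?thesis by (auto simp: not_less)
  qed
  also have "emeasure lborel \<dots> = ennreal (pi * 1\<^sup>2) - ennreal (pi * (sqrt (1 - \<rho>))\<^sup>2)"
  proof -
    have "ball 0 (sqrt (1 - \<rho>)) \<subseteq> ball (0::complex) 1" using assms by (intro subset_ball) simp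
    then show ?thesis
      using True assms by (subst emeasure_Diff) (simp_all add: emeasure_ball_complex)
  qed
  also have "\<dots> = ennreal (pi * \<rho>)"
    using True assms by (simp add: ennreal_minus algebra_simps)
  finally show ?thesis by simp
qed

text \<open>For \<open>\<rho> < r < 1/4\<close> the set is covered by \<open>O(r / \<rho>)\<close> balls of radius \<open>5\<rho>\<close> centred on the circle.\<close>

lemma area_box:
  assumes r: "r > 0" and \<rho>: "\<rho> > 0"
  shows "emeasure lborel {z\<in>ball (0::complex) 1. norm (1 - z) \<le> r \<and> 1 - (norm z)\<^sup>2 \<le> \<rho>} \<le> ennreal (175 * pi * r * \<rho>)"
    (is "emeasure lborel ?S \<le> _")
proof -
  \<comment> \<open>If \<open>\<rho> \<ge> r\<close>, the set sits in a ball of radius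
    \<open>2 * r\<close>, whose area is of order \<open>r * r\<close>. If
    \<open>r \<ge> 1/4\<close>, the whole annulus is small enough. Only the remaining case needs the
    covering.\<close>
  consider "\<rho> \<ge> r" | "r \<ge> 1/4" | "\<rho> < r" "r < 1/4" by linarith
  then show ?thesis
  proof cases
    case 1
    have "emeasure lborel ?S \<le> emeasure lborel (ball (1::complex) (2 * r))"
      by (intro emeasure_mono) (use r in \<open>auto simp: dist_norm\<close>)
    also have "\<dots> = ennreal (pi * (2 * r)\<^sup>2)" using r by (simp add: emeasure_ball_complex)
    also have "\<dots> \<le> ennreal (175 * pi * r * \<rho>)"
      using 1 r by (intro ennreal_leI) (simp add: power2_eq_square mult_mono)
    finally show ?thesis .
  next
    case 2
    have "emeasure lborel ?S \<le> emeasure lborel {z\<in>ball (0::complex) 1. 1 - (norm z)\<^sup>2 \<le> \<rho>}"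
      by (intro emeasure_mono) auto
    also have "\<dots> \<le> ennreal (pi * \<rho>)" by (rule area_annulus[OF \<rho>])
    also have "\<dots> \<le> ennreal (175 * pi * r * \<rho>)"
      using 2 \<rho> by (intro ennreal_leI) simp
    finally show ?thesis .
  next
    case 3
    define N :: int where "N = \<lceil>r / \<rho>\<rceil> + 1"
    have N: "of_int N \<le> r / \<rho> + 2" "of_int N \<ge> r / \<rho> + 1" unfolding N_def by linarith+
    have rr: "r / \<rho> > 1" using 3 \<rho> by simp
    define c where "c k = Complex (sqrt (1 - (of_int k * \<rho>)\<^sup>2)) (of_int k * \<rho>)" for k :: int
    have cov: "?S \<subseteq> (\<Union>k\<in>{-N..N}. ball (c k) (5 * \<rho>))"
    proof
      fix z assume z: "z \<in> ?S"
      define x y where "x = Re z" and "y = Im z"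
      have zz: "z = Complex x y" by (simp add: x_def y_def)
      have nz: "(norm z)\<^sup>2 = x\<^sup>2 + y\<^sup>2" by (simp add: cmod_power2 x_def y_def)
      have y: "\<bar>y\<bar> \<le> r" using z abs_Im_le_cmod[of "1 - z"] by (simp add: y_def)
      have "\<bar>1 - x\<bar> \<le> r" using z abs_Re_le_cmod[of "1 - z"] by (simp add: x_def)
      then have x: "x \<ge> 3/4" using 3 by linarith
      have n1: "(norm z)\<^sup>2 < 1" using z by (simp add: power_less_one_iff)
      have n2: "1 - (norm z)\<^sup>2 \<le> \<rho>" using z by simp
      define k where "k = \<lfloor>y / \<rho>\<rfloor>"
      define t where "t = of_int k * \<rho>"
      have "of_int k \<le> y / \<rho>" "y / \<rho> < of_int k + 1" unfolding k_def by linarith+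
      then have t: "t \<le> y" "y < t + \<rho>" using \<rho> by (auto simp: t_def field_simps)
      have "y / \<rho> \<le> r / \<rho>" "- (r / \<rho>) \<le> y / \<rho>" using y \<rho> by (auto simp: field_simps)
      then have "of_int k \<le> (of_int N :: real)" "- of_int N \<le> (of_int k :: real)"
        using N \<open>of_int k \<le> y / \<rho>\<close> \<open>y / \<rho> < of_int k + 1\<close> by linarith+
      then have k: "k \<in> {-N..N}" unfolding atLeastAtMost_iff by linarith
      have at: "\<bar>t\<bar> \<le> 1/2" using t y 3 by linarith
      then have t2: "t\<^sup>2 \<le> 1/4" using power_mono[OF at, of 2] by (simp add: power2_eq_square)
      define x' where "x' = sqrt (1 - t\<^sup>2)"
      have x'2: "x'\<^sup>2 = 1 - t\<^sup>2" using t2 by (simp add: x'_def)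
      have x'0: "x' \<ge> 0" using t2 by (simp add: x'_def)
      have "\<bar>y\<^sup>2 - t\<^sup>2\<bar> = \<bar>y - t\<bar> * \<bar>y + t\<bar>" by (simp add: abs_mult[symmetric] power2_eq_square algebra_simps)
      also have "\<dots> \<le> \<rho> * 1" using t y at 3 by (intro mult_mono) auto
      finally have "\<bar>y\<^sup>2 - t\<^sup>2\<bar> \<le> \<rho>" by simp
      then have "\<bar>x\<^sup>2 - x'\<^sup>2\<bar> \<le> 2 * \<rho>" using n1 n2 nz x'2 by linarith
      moreover have "\<bar>x\<^sup>2 - x'\<^sup>2\<bar> = \<bar>x - x'\<bar> * (x + x')"
      proof -
        have "x\<^sup>2 - x'\<^sup>2 = (x - x') * (x + x')" by (simp add: power2_eq_square algebra_simps)
        then show ?thesis using x x'0 by (simp add: abs_mult)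
      qed
      \<comment> \<open>Since \<open>r < 1/4\<close>, the set stays in \<open>x \<ge> 3/4\<close>.
        There a difference of squares of at most \<open>2 * \<rho>\<close> forces a difference of at
        most \<open>8/3 * \<rho>\<close>, hence the \<open>3 * \<rho>\<close> below; together with
        the vertical error \<open>\<rho>\<close> this fits into radius
        \<open>5 * \<rho>\<close>.\<close>
      moreover have "\<bar>x - x'\<bar> * (3/4) \<le> \<bar>x - x'\<bar> * (x + x')" using x x'0 by (intro mult_left_mono) auto
      ultimately have "\<bar>x - x'\<bar> * (3/4) \<le> 2 * \<rho>" by (metis order_trans)
      then have dx: "\<bar>x - x'\<bar> \<le> 3 * \<rho>" using \<rho> by (simp add: field_simps)
      have "dist (c k) z \<le> \<bar>x' - x\<bar> + \<bar>t - y\<bar>"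
        using cmod_le[of "c k - z"] by (simp add: dist_norm c_def x'_def t_def x_def y_def)
      also have "\<dots> < 5 * \<rho>" using dx t by linarith
      finally show "z \<in> (\<Union>k\<in>{-N..N}. ball (c k) (5 * \<rho>))" using k by auto
    qed
    have "emeasure lborel ?S \<le> emeasure lborel (\<Union>k\<in>{-N..N}. ball (c k) (5 * \<rho>))"
      by (intro emeasure_mono cov) auto
    also have "\<dots> \<le> (\<Sum>k\<in>{-N..N}. emeasure lborel (ball (c k) (5 * \<rho>)))"
      by (intro emeasure_subadditive_finite) auto
    also have "\<dots> = of_nat (card {-N..N}) * ennreal (pi * (5 * \<rho>)\<^sup>2)"
      using \<rho> by (simp add: emeasure_ball_complex)
    also have "\<dots> = ennreal ((2 * of_int N + 1) * (pi * (5 * \<rho>)\<^sup>2))"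
      using N rr by (simp add: ennreal_mult ennreal_of_nat_eq_real_of_nat)
    also have "\<dots> \<le> ennreal (175 * pi * r * \<rho>)"
    proof (rule ennreal_leI)
      \<comment> \<open>\<open>2 * N + 1 \<le> 2 * r / \<rho> + 5 \<le> 7 * r / \<rho>\<close>
        because \<open>r / \<rho> > 1\<close>. With the factor 25 from the radius
        \<open>5 * \<rho>\<close> this is the origin of 175.\<close>
      have "(2 * of_int N + 1) * (pi * (5 * \<rho>)\<^sup>2) \<le> (7 * (r / \<rho>)) * (pi * (5 * \<rho>)\<^sup>2)"
        using N rr by (intro mult_right_mono) auto
      also have "\<dots> = 175 * pi * r * \<rho>" using \<rho> by (simp add: power2_eq_square)
      finally show "(2 * of_int N + 1) * (pi * (5 * \<rho>)\<^sup>2) \<le> 175 * pi * r * \<rho>" .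
    qed
    finally show ?thesis .
  qed
qed

text \<open>The decay estimates are used at two levels. Inside the box
  \<open>|1 - z| \<le> r\<close>, plain area decays linearly in \<open>1 - |z|^2\<close> with a
  constant of order \<open>r\<close>, by \<open>area_box\<close>. Integrating the weight over that
  box then gives \<open>r * r powr (\<alpha> + 1)\<close>. The condition
  \<open>\<alpha> > -1\<close> is the integrability of the weight against linear decay.\<close>

lemma wdisc_decay:
  assumes \<alpha>: "\<alpha> > -1"
  obtains C where "decay (wdisc \<alpha>) (\<lambda>z. norm (1 - z)) C (\<alpha> + 2)"
proof -
  define c where "c = 2 powr \<bar>-\<alpha>\<bar> / (1 - (1/2) powr (1 - (-\<alpha>)))"
  have "(1/2::real) powr (1 + \<alpha>) < (1/2) powr 0"
    using \<alpha> by (intro powr_less_mono') auto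
  then have c: "c \<ge> 0" by (simp add: c_def)
  define C where "C = 175 * c * 2 powr (1 + \<alpha>)"
  have C: "C \<ge> 0" using c by (simp add: C_def)
  have "decay (wdisc \<alpha>) (\<lambda>z. norm (1 - z)) C (\<alpha> + 2)"
    unfolding decay_def
  proof (intro conjI ballI allI impI)
    show m: "(\<lambda>z. norm (1 - z)) \<in> borel_measurable (wdisc \<alpha>)"
      by (intro measurable_wdisc continuous_intros)
    show "0 < norm (1 - z)" if "z \<in> space (wdisc \<alpha>)" for z using that by auto
    show "C \<ge> 0" by (rule C)
    fix r :: real assume r: "r > 0"
    define S where "S = {z\<in>ball (0::complex) 1. norm (1 - z) \<le> r}"
    have S[measurable]: "S \<in> sets borel" unfolding S_def by measurable
    define M where "M = restrict_space lborel S"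
    have dec: "decay M (\<lambda>z. 1 - (norm z)\<^sup>2) (175 * pi * r) 1"
      unfolding decay_def
    proof (intro conjI ballI allI impI)
      show "(\<lambda>z. 1 - (norm z)\<^sup>2) \<in> borel_measurable M" unfolding M_def
        by (rule measurable_restrict_space1) measurable
      show "0 < 1 - (norm z)\<^sup>2" if "z \<in> space M" for z
        using that by (auto simp: M_def space_restrict_space S_def power_less_one_iff)
      show "0 \<le> 175 * pi * r" using r by simp
      fix \<rho> :: real assume \<rho>: "\<rho> > 0"
      have "{z \<in> space M. 1 - (norm z)\<^sup>2 \<le> \<rho>} = {z\<in>ball (0::complex) 1. norm (1 - z) \<le> r \<and> 1 - (norm z)\<^sup>2 \<le> \<rho>}"
        by (auto simp: M_def space_restrict_space S_def)
      then show "emeasure M {z \<in> space M. 1 - (norm z)\<^sup>2 \<le> \<rho>} \<le> ennreal (175 * pi * r * \<rho> powr 1)"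
        using area_box[OF r \<rho>] \<rho> by (simp add: M_def emeasure_restrict_space S_def Collect_mono)
    qed
    have le: "1 - (norm z)\<^sup>2 \<le> 2 * r" if "z \<in> S" for z
    proof -
      have "1 - norm z \<le> norm (1 - z)" using norm_triangle_ineq2[of 1 z] by simp
      moreover have "1 - (norm z)\<^sup>2 = (1 - norm z) * (1 + norm z)" by (simp add: power2_eq_square algebra_simps)
      moreover have "\<dots> \<le> (1 - norm z) * 2" using that by (intro mult_left_mono) (auto simp: S_def)
      ultimately show ?thesis using that by (auto simp: S_def)
    qed
    have Ss: "S \<in> sets (restrict_space borel (ball 0 1))"
      unfolding sets_restrict_space by (rule image_eqI[of _ _ S]) (auto simp: S_def intro: S[unfolded S_def])
    have "emeasure (wdisc \<alpha>) {z \<in> space (wdisc \<alpha>). norm (1 - z) \<le> r} = emeasure (wdisc \<alpha>) S"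
      by (simp add: S_def)
    also have "\<dots> = (\<integral>\<^sup>+z. indicator S z \<partial>wdisc \<alpha>)"
      using Ss by (simp add: sets_wdisc)
    also have "\<dots> = (\<integral>\<^sup>+z. ennreal ((1 - (norm z)\<^sup>2) powr \<alpha> / pi) * indicator S z * indicator (ball 0 1) z \<partial>lborel)"
      by (subst nn_integral_wdisc) (use Ss in auto)
    also have "\<dots> = (\<integral>\<^sup>+z. ennreal ((1 - (norm z)\<^sup>2) powr \<alpha> / pi) * indicator S z \<partial>lborel)"
      by (intro nn_integral_cong) (auto simp: S_def indicator_def)
    also have "\<dots> = (\<integral>\<^sup>+z. ennreal ((1 - (norm z)\<^sup>2) powr \<alpha> / pi) \<partial>M)"
      unfolding M_def by (subst nn_integral_restrict_space) auto
    \<comment> \<open>The weight is written as a negative power of the inner gauge, and the inserted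
      indicator equals 1 on the box by \<open>le\<close>; this is the form in which
      \<open>decay_integral_le\<close> applies with \<open>u = 2 * r\<close>.\<close>
    also have "\<dots> = (\<integral>\<^sup>+z. ennreal (1/pi) * (ennreal ((1 - (norm z)\<^sup>2) powr - (-\<alpha>)) * indicator {z. 1 - (norm z)\<^sup>2 \<le> 2 * r} z) \<partial>M)"
      using le by (intro nn_integral_cong) (auto simp: M_def space_restrict_space ennreal_mult'[symmetric])
    also have "\<dots> = ennreal (1/pi) * (\<integral>\<^sup>+z. (ennreal ((1 - (norm z)\<^sup>2) powr - (-\<alpha>)) * indicator {z. 1 - (norm z)\<^sup>2 \<le> 2 * r} z) \<partial>M)"
    proof (rule nn_integral_cmult)
      have [measurable]: "(\<lambda>z. 1 - (norm z)\<^sup>2) \<in> borel_measurable M" using dec by (simp add: decay_def)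
      show "(\<lambda>z. ennreal ((1 - (norm z)\<^sup>2) powr - (-\<alpha>)) * indicator {z. 1 - (norm z)\<^sup>2 \<le> 2 * r} z) \<in> borel_measurable M"
        by measurable
    qed
    also have "\<dots> \<le> ennreal (1/pi) * ennreal (175 * pi * r * c * (2 * r) powr (1 - (-\<alpha>)))"
      unfolding c_def using r \<alpha> by (intro mult_left_mono decay_integral_le[OF dec]) auto
    also have "\<dots> = ennreal (C * r powr (\<alpha> + 2))"
    proof -
      have "r * (2 * r) powr (1 + \<alpha>) = 2 powr (1 + \<alpha>) * r powr (\<alpha> + 2)"
        using r by (simp add: powr_mult powr_add power2_eq_square)
      then show ?thesis using r c by (simp add: ennreal_mult'[symmetric] C_def mult_ac)
    qed
    finally show "emeasure (wdisc \<alpha>) {z \<in> space (wdisc \<alpha>). norm (1 - z) \<le> r} \<le> ennreal (C * r powr (\<alpha> + 2))" .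
  qed
  then show ?thesis by (rule that)
qed

lemma finite_measure_wdisc:
  assumes \<alpha>: "\<alpha> > -1"
  shows "finite_measure (wdisc \<alpha>)"
proof -
  obtain C where C: "decay (wdisc \<alpha>) (\<lambda>z. norm (1 - z)) C (\<alpha> + 2)" using wdisc_decay[OF \<alpha>] .
  have "norm (1 - z) \<le> 2" if "z \<in> ball 0 1" for z :: complex
    using norm_triangle_ineq4[of 1 z] that by simp
  then have "space (wdisc \<alpha>) = {z \<in> space (wdisc \<alpha>). norm (1 - z) \<le> 2}" by auto
  also have "emeasure (wdisc \<alpha>) \<dots> \<le> ennreal (C * 2 powr (\<alpha> + 2))"
    using C unfolding decay_def by simp
  finally have "emeasure (wdisc \<alpha>) (space (wdisc \<alpha>)) < \<infinity>"
    using ennreal_less_top le_less_trans by fastforce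
  then show ?thesis by (intro finite_measureI) auto
qed

section \<open>Pointwise and radial estimates in Bergman spaces\<close>

text \<open>Let \<open>z0\<close> maximise \<open>(d - |z - a|) powr (2 / p) * |g z|\<close>. Cauchy's estimate keeps \<open>|g|\<close> above half its
  value at \<open>z0\<close> on a disc whose radius is a fixed fraction of \<open>d - |z0 - a|\<close>; this covers all
  \<open>p > 0\<close> without subharmonicity.\<close>

lemma subaverage:
  fixes p :: real
  assumes p: "p > 0"
  obtains K where "K \<ge> 0" "\<And>g a d. d > 0 \<Longrightarrow> g holomorphic_on ball a d \<Longrightarrow> continuous_on (cball a d) g \<Longrightarrow>
     ennreal (norm (g a) powr p * d\<^sup>2) \<le> ennreal K * (\<integral>\<^sup>+z. ennreal (norm (g z) powr p) * indicator (ball a d) z \<partial>lborel)"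
proof -
  define L :: real where "L = 2 powr (2/p)"
  have L1: "L \<ge> 1" using p by (simp add: L_def ge_one_powr_ge_zero)
  \<comment> \<open>On the ball of radius \<open>e/2\<close> about the maximiser \<open>|g|\<close>
    is at most \<open>L * G\<close>, so by Cauchy's estimate on radius \<open>e/4\<close> its
    derivative is at most \<open>4 * L * G / e\<close>. Over a distance \<open>c * e\<close> the
    value then changes by at most \<open>G / 2\<close>.\<close>
  define c where "c = 1 / (8 * L)"
  have c: "c > 0" "c \<le> 1/8" using L1 by (auto simp: c_def field_simps)
  define K where "K = 2 powr p / (pi * c\<^sup>2)"
  have K: "K \<ge> 0" by (simp add: K_def)
  have main: "ennreal (norm (g a) powr p * d\<^sup>2) \<le> ennreal K * (\<integral>\<^sup>+z. ennreal (norm (g z) powr p) * indicator (ball a d) z \<partial>lborel)"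
    if d: "d > 0" and hol: "g holomorphic_on ball a d" and cont: "continuous_on (cball a d) g" for g :: "complex \<Rightarrow> complex" and a d
  proof -
    \<comment> \<open>The exponent \<open>2 / p\<close> makes the \<open>p\<close>-th power of
      \<open>\<psi>\<close> carry the square of the distance to the boundary, which matches the area
      of a ball of comparable radius.\<close>
    define \<psi> where "\<psi> z = (d - norm (z - a)) powr (2/p) * norm (g z)" for z
    have "continuous_on (cball a d) \<psi>" unfolding \<psi>_def
      by (intro continuous_intros cont continuous_on_powr') (use p in \<open>auto simp: dist_norm norm_minus_commute\<close>)
    then obtain z0 where z0: "z0 \<in> cball a d" and max: "\<And>z. z \<in> cball a d \<Longrightarrow> \<psi> z \<le> \<psi> z0"
      using continuous_attains_sup[of "cball a d" \<psi>] d by auto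
    have \<psi>a: "\<psi> a = d powr (2/p) * norm (g a)" by (simp add: \<psi>_def)
    have le: "\<psi> a \<le> \<psi> z0" using max d by simp
    define e where "e = d - norm (z0 - a)"
    define G where "G = norm (g z0)"
    have \<psi>0: "\<psi> z0 = e powr (2/p) * G" by (simp add: \<psi>_def e_def G_def)
    have e0: "e \<ge> 0" using z0 by (simp add: e_def dist_norm norm_minus_commute)
    have "norm (g a) powr p * d\<^sup>2 = \<psi> a powr p"
      using d p by (simp add: \<psi>a powr_mult powr_powr)
    also have "\<dots> \<le> \<psi> z0 powr p" using le p by (intro powr_mono2) (auto simp: \<psi>_def)
    also have "\<dots> = G powr p * e\<^sup>2"
      using e0 p by (simp add: \<psi>0 powr_mult powr_powr G_def)
    finally have 1: "norm (g a) powr p * d\<^sup>2 \<le> G powr p * e\<^sup>2" .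
    show ?thesis
    proof (cases "e = 0 \<or> G = 0")
      case True
      then have "norm (g a) powr p * d\<^sup>2 \<le> 0" using 1 p by auto
      then have "ennreal (norm (g a) powr p * d\<^sup>2) = 0" by (rule ennreal_neg)
      then show ?thesis by (simp only: zero_le)
    next
      case False
      then have e: "e > 0" and G: "G > 0" using e0 by (auto simp: G_def)
      have sub: "ball z0 e \<subseteq> ball a d"
      proof
        fix w assume "w \<in> ball z0 e"
        then show "w \<in> ball a d" using dist_triangle[of a w z0] by (simp add: e_def dist_norm norm_minus_commute)
      qed
      have bound: "norm (g w) \<le> L * G" if w: "w \<in> cball z0 (e/2)" for w
      proof -
        have ge: "d - norm (w - a) \<ge> e/2"
          using norm_triangle_ineq[of "w - z0" "z0 - a"] w by (simp add: e_def dist_norm norm_minus_commute)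
        then have wd: "w \<in> cball a d" using e by (simp add: dist_norm norm_minus_commute)
        have "(e/2) powr (2/p) * norm (g w) \<le> \<psi> w" unfolding \<psi>_def
          using ge e p by (intro mult_right_mono powr_mono2) auto
        also have "\<dots> \<le> e powr (2/p) * G" using max[OF wd] \<psi>0 by simp
        finally show ?thesis using e p by (simp add: powr_divide L_def field_simps)
      qed
      have der: "norm (deriv g w) \<le> 4 * L * G / e" if w: "w \<in> ball z0 (e/4)" for w
      proof -
        have sub2: "cball w (e/4) \<subseteq> cball z0 (e/2)"
        proof
          fix x assume "x \<in> cball w (e/4)"
          then show "x \<in> cball z0 (e/2)" using w dist_triangle[of z0 x w] by simp
        qed
        also have "\<dots> \<subseteq> ball z0 e" using e by auto
        finally have sub3: "cball w (e/4) \<subseteq> ball a d" using sub by blast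
        have hw: "g holomorphic_on cball w (e/4)" using hol sub3 by (rule holomorphic_on_subset)
        have "norm ((deriv ^^ 1) g w) \<le> fact 1 * (L * G) / (e/4) ^ 1"
        proof (rule Cauchy_inequality)
          show "g holomorphic_on ball w (e/4)" using hw by (rule holomorphic_on_subset) auto
          show "continuous_on (cball w (e/4)) g" using hw by (rule holomorphic_on_imp_continuous_on)
          show "norm (g x) \<le> L * G" if "norm (w - x) = e/4" for x
            using that sub2 by (intro bound) (auto simp: dist_norm)
        qed (use e in auto)
        then show ?thesis by (simp add: mult_ac)
      qed
      have low: "norm (g w) \<ge> G / 2" if w: "w \<in> ball z0 (c * e)" for w
      proof -
        have ce: "c * e \<le> e/4" using c e by simp
        have "norm (g w - g z0) \<le> (4 * L * G / e) * norm (w - z0)"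
        proof (rule field_differentiable_bound[of "ball z0 (e/4)" _ "deriv g"])
          fix x assume x: "x \<in> ball z0 (e/4)"
          have "g field_differentiable at x" using hol
          proof (rule holomorphic_on_imp_differentiable_at)
            have "x \<in> ball z0 e" using x e by simp
            then show "x \<in> ball a d" using sub by blast
          qed auto
          then show "(g has_field_derivative deriv g x) (at x within ball z0 (e/4))"
            using field_differentiable_derivI DERIV_subset has_field_derivative_at_within by blast
          show "norm (deriv g x) \<le> 4 * L * G / e" by (rule der[OF x])
        next
          have "dist z0 w < c * e" using w by simp
          then have "dist z0 w < e/4" using ce by (rule less_le_trans)
          then show "w \<in> ball z0 (e/4)" by simp
        qed (use e in auto)
        also have "\<dots> \<le> (4 * L * G / e) * (c * e)"
          using w L1 G e by (intro mult_left_mono) (auto simp: dist_norm norm_minus_commute)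
        also have "\<dots> = G / 2" using L1 e by (simp add: c_def)
        finally show ?thesis using norm_triangle_ineq2[of "g z0" "g w"] by (simp add: G_def norm_minus_commute)
      qed
      have sub4: "ball z0 (c * e) \<subseteq> ball a d"
      proof -
        have "c * e \<le> e" using c e by simp
        then show ?thesis using sub subset_ball[of "c * e" e z0] by blast
      qed
      have "ennreal ((G/2) powr p * (pi * (c * e)\<^sup>2)) = (\<integral>\<^sup>+z. ennreal ((G/2) powr p) * indicator (ball z0 (c * e)) z \<partial>lborel)"
        using c e by (subst nn_integral_cmult_indicator) (auto simp: emeasure_ball_complex ennreal_mult)
      also have "\<dots> \<le> (\<integral>\<^sup>+z. ennreal (norm (g z) powr p) * indicator (ball a d) z \<partial>lborel)"
      proof (intro nn_integral_mono)
        fix z :: complex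
        show "ennreal ((G/2) powr p) * indicator (ball z0 (c * e)) z \<le> ennreal (norm (g z) powr p) * indicator (ball a d) z"
        proof (cases "z \<in> ball z0 (c * e)")
          case True
          then have "(G/2) powr p \<le> norm (g z) powr p" using low G p by (intro powr_mono2) auto
          moreover have "z \<in> ball a d" using True sub4 by blast
          ultimately show ?thesis using True by (simp add: ennreal_leI)
        qed simp
      qed
      finally have 2: "ennreal ((G/2) powr p * (pi * (c * e)\<^sup>2)) \<le> (\<integral>\<^sup>+z. ennreal (norm (g z) powr p) * indicator (ball a d) z \<partial>lborel)" .
      have "ennreal (norm (g a) powr p * d\<^sup>2) \<le> ennreal (G powr p * e\<^sup>2)" using 1 by (rule ennreal_leI)
      also have "G powr p * e\<^sup>2 = K * ((G/2) powr p * (pi * (c * e)\<^sup>2))"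
        using c G by (simp add: K_def powr_divide power_mult_distrib)
      also have "ennreal \<dots> = ennreal K * ennreal ((G/2) powr p * (pi * (c * e)\<^sup>2))"
        using K by (simp add: ennreal_mult')
      also have "\<dots> \<le> ennreal K * (\<integral>\<^sup>+z. ennreal (norm (g z) powr p) * indicator (ball a d) z \<partial>lborel)"
        by (intro mult_left_mono 2) simp
      finally show ?thesis .
    qed
  qed
  show ?thesis by (rule that[OF K main])
qed

lemma near_ball_comparable:
  fixes a z :: complex
  assumes a: "norm a < 1" and z: "z \<in> ball a ((1 - norm a) / 2)"
  shows "(1 - norm a) / 2 \<le> 1 - (norm z)\<^sup>2" "1 - (norm z)\<^sup>2 \<le> 3 * (1 - norm a)" "norm z < 1"
proof -
  have 1: "norm z \<le> norm a + norm (z - a)" "norm a \<le> norm z + norm (z - a)"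
    using norm_triangle_ineq[of a "z - a"] norm_triangle_ineq[of z "a - z"] by (auto simp: norm_minus_commute)
  have 2: "2 * norm (z - a) < 1 - norm a" using z by (simp add: dist_norm norm_minus_commute)
  show n: "norm z < 1" using 1 2 a by linarith
  have "2 * (1 - norm z) \<ge> 1 - norm a" using 1 2 by argo
  moreover have "2 * (1 - norm z) \<le> 3 * (1 - norm a)" using 1 2 by argo
  moreover have sq: "1 - (norm z)\<^sup>2 = (1 - norm z) * (1 + norm z)" by (simp add: power2_eq_square algebra_simps)
  moreover have "(1 - norm z) * 1 \<le> (1 - norm z) * (1 + norm z)" using n by (intro mult_left_mono) auto
  moreover have "(1 - norm z) * (1 + norm z) \<le> (1 - norm z) * 2" using n by (intro mult_left_mono) auto
  ultimately show "(1 - norm a) / 2 \<le> 1 - (norm z)\<^sup>2" "1 - (norm z)\<^sup>2 \<le> 3 * (1 - norm a)"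
    by argo+
qed

text \<open>On a ball whose radius is half the distance to the unit circle, the weight is constant
  up to a factor, so the unweighted estimate transfers. The integral is kept over the small ball
  because \<open>bergman_radial\<close> depends on this localisation.\<close>

lemma wdisc_subaverage:
  fixes p \<alpha> :: real
  assumes p: "p > 0"
  obtains K where "K \<ge> 0" "\<And>g a. g holomorphic_on ball 0 1 \<Longrightarrow> norm a < 1 \<Longrightarrow>
     ennreal (norm (g a) powr p * (1 - norm a) powr (\<alpha> + 2)) \<le>
     ennreal K * (\<integral>\<^sup>+z. ennreal (norm (g z) powr p) * indicator (ball a ((1 - norm a) / 2)) z \<partial>wdisc \<alpha>)"
proof -
  obtain K0 where K0: "K0 \<ge> 0" and sub: "\<And>g a d. d > 0 \<Longrightarrow> g holomorphic_on ball a d \<Longrightarrow> continuous_on (cball a d) g \<Longrightarrow>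
     ennreal (norm (g a) powr p * d\<^sup>2) \<le> ennreal K0 * (\<integral>\<^sup>+z. ennreal (norm (g z) powr p) * indicator (ball a d) z \<partial>lborel)"
    using subaverage[OF p] by blast
  define K where "K = 4 * K0 * (pi * 3 powr \<bar>\<alpha>\<bar>)"
  have K: "K \<ge> 0" using K0 by (simp add: K_def)
  show ?thesis
  proof (rule that[OF K])
    fix g :: "complex \<Rightarrow> complex" and a :: complex assume hol: "g holomorphic_on ball 0 1" and a: "norm a < 1"
    define D where "D = 1 - norm a"
    have D: "D > 0" using a by (simp add: D_def)
    have incl: "cball a (D/2) \<subseteq> ball 0 1"
    proof
      fix z assume "z \<in> cball a (D/2)"
      then show "z \<in> ball 0 1" using norm_triangle_ineq[of a "z - a"] D by (simp add: dist_norm D_def norm_minus_commute)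
    qed
    have hol': "g holomorphic_on cball a (D/2)" using hol incl by (rule holomorphic_on_subset)
    have [measurable]: "g \<in> borel_measurable (restrict_space borel (ball 0 1))"
      by (intro borel_measurable_continuous_on_restrict holomorphic_on_imp_continuous_on hol)
    have [measurable]: "indicator (ball a (D/2)) \<in> borel_measurable (restrict_space borel (ball (0::complex) 1))"
      by (rule measurable_restrict_space1) (simp add: borel_measurable_indicator)
    let ?I = "\<integral>\<^sup>+z. ennreal (norm (g z) powr p) * indicator (ball a (D/2)) z \<partial>wdisc \<alpha>"
    have gm: "(\<lambda>z. ennreal (norm (g z) powr p) * indicator (ball a (D/2)) z) \<in> borel_measurable (restrict_space borel (ball 0 1))"
      by measurable
    have le: "D powr \<alpha> \<le> 3 powr \<bar>\<alpha>\<bar> * (1 - (norm z)\<^sup>2) powr \<alpha>" if "z \<in> ball a (D/2)" for z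
    proof -
      have z: "D / 2 \<le> 1 - (norm z)\<^sup>2" "1 - (norm z)\<^sup>2 \<le> 3 * D"
        using near_ball_comparable[OF a] that by (auto simp: D_def)
      have "(D / (1 - (norm z)\<^sup>2)) powr \<alpha> \<le> 3 powr \<bar>\<alpha>\<bar>"
        using z D by (intro powr_le_powr_abs) (auto simp: field_simps)
      then show ?thesis using z D by (simp add: powr_divide field_simps)
    qed
    have "ennreal (norm (g a) powr p * D powr (\<alpha> + 2)) = ennreal (4 * D powr \<alpha>) * ennreal (norm (g a) powr p * (D/2)\<^sup>2)"
      using D by (simp add: ennreal_mult'[symmetric] powr_add power_divide mult_ac)
    also have "\<dots> \<le> ennreal (4 * D powr \<alpha>) * (ennreal K0 * (\<integral>\<^sup>+z. ennreal (norm (g z) powr p) * indicator (ball a (D/2)) z \<partial>lborel))"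
      using hol' D by (intro mult_left_mono sub holomorphic_on_imp_continuous_on) (auto intro: holomorphic_on_subset)
    also have "\<dots> = (\<integral>\<^sup>+z. ennreal (4 * D powr \<alpha> * K0) * (ennreal (norm (g z) powr p) * indicator (ball a (D/2)) z) \<partial>lborel)"
    proof (subst nn_integral_cmult)
      \<comment> \<open>\<open>g\<close> is known to be measurable on the disc only. Multiplying by
        the indicator of the disc extends by zero to the plane, and this factor changes nothing
        because the small ball lies inside the disc.\<close>
      have "(\<lambda>z. ennreal (norm (g z) powr p) * indicator (ball a (D/2)) z * indicator (ball 0 1) z) \<in> borel_measurable borel"
        using gm by (subst (asm) borel_measurable_restrict_space_iff_ennreal) auto
      also have "(\<lambda>z. ennreal (norm (g z) powr p) * indicator (ball a (D/2)) z * indicator (ball 0 1) z) = (\<lambda>z. ennreal (norm (g z) powr p) * indicator (ball a (D/2)) z)"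
      proof
        fix z
        have "z \<in> ball a (D/2) \<Longrightarrow> z \<in> ball 0 1" using incl ball_subset_cball[of a "D/2"] by blast
        then show "ennreal (norm (g z) powr p) * indicator (ball a (D/2)) z * indicator (ball 0 1) z = ennreal (norm (g z) powr p) * indicator (ball a (D/2)) z"
          by (cases "z \<in> ball a (D/2)") auto
      qed
      finally show "(\<lambda>z. ennreal (norm (g z) powr p) * indicator (ball a (D/2)) z) \<in> borel_measurable lborel" by simp
    qed (use K0 in \<open>simp add: ennreal_mult mult_ac\<close>)
    also have "\<dots> \<le> (\<integral>\<^sup>+z. ennreal K * (ennreal ((1 - (norm z)\<^sup>2) powr \<alpha> / pi) * (ennreal (norm (g z) powr p) * indicator (ball a (D/2)) z) * indicator (ball 0 1) z) \<partial>lborel)"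
    proof (intro nn_integral_mono)
      fix z :: complex
      show "ennreal (4 * D powr \<alpha> * K0) * (ennreal (norm (g z) powr p) * indicator (ball a (D/2)) z)
        \<le> ennreal K * (ennreal ((1 - (norm z)\<^sup>2) powr \<alpha> / pi) * (ennreal (norm (g z) powr p) * indicator (ball a (D/2)) z) * indicator (ball 0 1) z)"
      proof (cases "z \<in> ball a (D/2)")
        case True
        then have z1: "z \<in> ball 0 1" using incl ball_subset_cball[of a "D/2"] by blast
        have "4 * D powr \<alpha> * K0 \<le> 4 * (3 powr \<bar>\<alpha>\<bar> * (1 - (norm z)\<^sup>2) powr \<alpha>) * K0"
          using le[OF True] K0 by (intro mult_right_mono mult_left_mono) auto
        also have "\<dots> = K * ((1 - (norm z)\<^sup>2) powr \<alpha> / pi)" by (simp add: K_def)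
        finally have "4 * D powr \<alpha> * K0 * norm (g z) powr p \<le> K * ((1 - (norm z)\<^sup>2) powr \<alpha> / pi) * norm (g z) powr p"
          by (rule mult_right_mono) simp
        then show ?thesis using True z1 K K0 by (simp add: ennreal_mult'[symmetric] ennreal_leI mult.assoc)
      qed simp
    qed
    also have "\<dots> = ennreal K * ?I"
    proof (subst nn_integral_wdisc[OF gm], rule nn_integral_cmult)
      show "(\<lambda>z. ennreal ((1 - (norm z)\<^sup>2) powr \<alpha> / pi) * (ennreal (norm (g z) powr p) * indicator (ball a (D/2)) z) * indicator (ball 0 1) z) \<in> borel_measurable lborel"
      proof -
        have "(\<lambda>z. ennreal ((1 - (norm z)\<^sup>2) powr \<alpha> / pi)) \<in> borel_measurable (restrict_space borel (ball (0::complex) 1))"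
          by (rule measurable_restrict_space1) measurable
        from borel_measurable_times_ennreal[OF this gm] show ?thesis
          by (subst (asm) borel_measurable_restrict_space_iff_ennreal) auto
      qed
    qed
    finally show "ennreal (norm (g a) powr p * (1 - norm a) powr (\<alpha> + 2)) \<le>
     ennreal K * (\<integral>\<^sup>+z. ennreal (norm (g z) powr p) * indicator (ball a ((1 - norm a) / 2)) z \<partial>wdisc \<alpha>)"
      by (simp add: D_def)
  qed
qed

lemma nn_integral_bergman:
  assumes g: "in_bergman p \<alpha> g" and p: "p > 0" and \<alpha>: "\<alpha> > -1"
  shows "(\<integral>\<^sup>+z. ennreal (norm (g z) powr p) \<partial>wdisc \<alpha>) = ennreal (bergman_norm p \<alpha> g powr p / (\<alpha> + 1))"
proof -
  have hol: "g holomorphic_on ball 0 1" and fin: "bergman_int p \<alpha> g < \<infinity>" using g by (auto simp: in_bergman_def)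
  define I where "I = (\<integral>\<^sup>+z. ennreal (norm (g z) powr p) \<partial>wdisc \<alpha>)"
  have eq: "bergman_int p \<alpha> g = ennreal (\<alpha> + 1) * I"
    unfolding I_def by (intro bergman_int_eq holomorphic_on_imp_continuous_on hol)
  have "I < \<infinity>"
    using fin \<alpha> unfolding eq by (auto simp: ennreal_mult_less_top)
  then obtain i where i: "I = ennreal i" "i \<ge> 0" by (cases I) auto
  have "bergman_int p \<alpha> g = ennreal ((\<alpha> + 1) * i)" using eq i \<alpha> by (simp add: ennreal_mult)
  then have "bergman_norm p \<alpha> g powr p = (\<alpha> + 1) * i" unfolding bergman_norm_def
    using p \<alpha> i by (simp add: powr_powr)
  then show ?thesis using i \<alpha> by (simp add: I_def[symmetric])
qed

lemma bergman_norm_nonneg: "bergman_norm p \<alpha> g \<ge> 0"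
  by (simp add: bergman_norm_def)

text \<open>The local average is enlarged to the integral over the whole disc; the factor
  \<open>(1 - |z|) powr (\<alpha> + 2)\<close> left by the ball and the weight determines the
  exponent.\<close>

lemma bergman_growth:
  assumes p: "p > 0" and \<alpha>: "\<alpha> > -1"
  obtains K where "K \<ge> 0" "\<And>g z. in_bergman p \<alpha> g \<Longrightarrow> norm z < 1 \<Longrightarrow>
     norm (g z) \<le> K * bergman_norm p \<alpha> g * (1 - norm z) powr - ((\<alpha> + 2) / p)"
proof -
  obtain K0 where K0: "K0 \<ge> 0" and sub: "\<And>g a. g holomorphic_on ball 0 1 \<Longrightarrow> norm a < 1 \<Longrightarrow>
     ennreal (norm (g a) powr p * (1 - norm a) powr (\<alpha> + 2)) \<le>
     ennreal K0 * (\<integral>\<^sup>+z. ennreal (norm (g z) powr p) * indicator (ball a ((1 - norm a) / 2)) z \<partial>wdisc \<alpha>)"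
    using wdisc_subaverage[OF p] by blast
  define K where "K = (K0 / (\<alpha> + 1)) powr (1/p)"
  show ?thesis
  proof (rule that[of K])
    show "K \<ge> 0" by (simp add: K_def)
    fix g z assume g: "in_bergman p \<alpha> g" and z: "norm (z::complex) < 1"
    define N where "N = bergman_norm p \<alpha> g"
    have N: "N \<ge> 0" by (simp add: N_def bergman_norm_nonneg)
    have hol: "g holomorphic_on ball 0 1" using g by (simp add: in_bergman_def)
    have "ennreal (norm (g z) powr p * (1 - norm z) powr (\<alpha> + 2)) \<le>
      ennreal K0 * (\<integral>\<^sup>+w. ennreal (norm (g w) powr p) * indicator (ball z ((1 - norm z) / 2)) w \<partial>wdisc \<alpha>)"
      by (rule sub[OF hol z])
    also have "\<dots> \<le> ennreal K0 * (\<integral>\<^sup>+w. ennreal (norm (g w) powr p) \<partial>wdisc \<alpha>)"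
      by (intro mult_left_mono nn_integral_mono) (auto simp: indicator_def)
    also have "\<dots> = ennreal (K0 / (\<alpha> + 1) * N powr p)"
      using K0 \<alpha> by (simp add: nn_integral_bergman[OF g p \<alpha>] ennreal_mult'[symmetric] N_def)
    finally have "norm (g z) powr p * (1 - norm z) powr (\<alpha> + 2) \<le> K0 / (\<alpha> + 1) * N powr p"
      using K0 \<alpha> by (simp add: ennreal_le_iff)
    then have "norm (g z) powr p \<le> K0 / (\<alpha> + 1) * N powr p * (1 - norm z) powr - (\<alpha> + 2)"
    proof -
      have "(1 - norm z) powr - (\<alpha> + 2) * (norm (g z) powr p * (1 - norm z) powr (\<alpha> + 2))
        \<le> (1 - norm z) powr - (\<alpha> + 2) * (K0 / (\<alpha> + 1) * N powr p)"
        using \<open>_ \<le> K0 / (\<alpha> + 1) * N powr p\<close> by (rule mult_left_mono) simp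
      moreover have "(1 - norm z) powr - (\<alpha> + 2) * (1 - norm z) powr (\<alpha> + 2) = 1"
        using z by (subst powr_add[symmetric]) simp
      ultimately show ?thesis by (simp add: mult_ac)
    qed
    then have "(norm (g z) powr p) powr (1/p) \<le> (K0 / (\<alpha> + 1) * N powr p * (1 - norm z) powr - (\<alpha> + 2)) powr (1/p)"
      using p by (intro powr_mono2) auto
    also have "\<dots> = K * N * (1 - norm z) powr - ((\<alpha> + 2) / p)"
    proof -
      have e: "- (\<alpha> + 2) * (1 / p) = - ((\<alpha> + 2) / p)" by (simp add: minus_divide_left)
      have "(K0 / (\<alpha> + 1) * N powr p * (1 - norm z) powr - (\<alpha> + 2)) powr (1/p)
        = (K0 / (\<alpha> + 1)) powr (1/p) * (N powr p) powr (1/p) * ((1 - norm z) powr - (\<alpha> + 2)) powr (1/p)"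
        using K0 \<alpha> by (simp only: powr_mult)
      also have "(N powr p) powr (1/p) = N" using p N by (simp add: powr_powr)
      also have "((1 - norm z) powr - (\<alpha> + 2)) powr (1/p) = (1 - norm z) powr - ((\<alpha> + 2) / p)"
        unfolding powr_powr e ..
      finally show ?thesis by (simp only: K_def)
    qed
    also have "(norm (g z) powr p) powr (1/p) = norm (g z)" using p by (simp add: powr_powr)
    finally show "norm (g z) \<le> K * bergman_norm p \<alpha> g * (1 - norm z) powr - ((\<alpha> + 2) / p)"
      by (simp add: N_def)
  qed
qed

text \<open>A Carleson embedding for length measure on a radius. Divide the local average at
  \<open>u\<close> by \<open>1 - u\<close> and integrate over \<open>u\<close>. By Tonelli each
  point \<open>z\<close> is then counted with the weight of those \<open>u\<close> whose ball
  contains \<open>z\<close>, and this weight is bounded uniformly in \<open>z\<close>.\<close>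

lemma bergman_radial:
  assumes p: "p > 0" and \<alpha>: "\<alpha> > -1"
  obtains K where "K \<ge> 0" "\<And>g. in_bergman p \<alpha> g \<Longrightarrow>
     (\<integral>\<^sup>+u. ennreal (norm (g (of_real u)) powr p * (1 - u) powr (\<alpha> + 1)) * indicator {0..<1} u \<partial>lborel)
       \<le> ennreal (K * bergman_norm p \<alpha> g powr p)"
proof -
  obtain K0 where K0: "K0 \<ge> 0" and sub: "\<And>g a. g holomorphic_on ball 0 1 \<Longrightarrow> norm a < 1 \<Longrightarrow>
     ennreal (norm (g a) powr p * (1 - norm a) powr (\<alpha> + 2)) \<le>
     ennreal K0 * (\<integral>\<^sup>+z. ennreal (norm (g z) powr p) * indicator (ball a ((1 - norm a) / 2)) z \<partial>wdisc \<alpha>)"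
    using wdisc_subaverage[OF p] by blast
  define K where "K = 6 * K0 / (\<alpha> + 1)"
  have K: "K \<ge> 0" using K0 \<alpha> by (simp add: K_def)
  interpret W: finite_measure "wdisc \<alpha>" by (rule finite_measure_wdisc[OF \<alpha>])
  interpret P: pair_sigma_finite lborel "wdisc \<alpha>" by standard
  show ?thesis
  proof (rule that[OF K])
    fix g assume g: "in_bergman p \<alpha> g"
    have hol: "g holomorphic_on ball 0 1" using g by (simp add: in_bergman_def)
    have [measurable]: "g \<in> borel_measurable (wdisc \<alpha>)"
      by (intro measurable_wdisc holomorphic_on_imp_continuous_on hol)
    have [measurable]: "(\<lambda>z. z) \<in> borel_measurable (wdisc \<alpha>)"
      by (intro measurable_wdisc continuous_intros)
    define F where "F u z = ennreal (norm (g z) powr p) * (ennreal (1 / (1 - u)) *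
      (if 0 \<le> u \<and> u < 1 \<and> norm (of_real u - z) < (1 - u) / 2 then 1 else 0))" for u and z :: complex
    have Fm: "case_prod F \<in> borel_measurable (lborel \<Otimes>\<^sub>M wdisc \<alpha>)"
      unfolding F_def by measurable
    have "(\<integral>\<^sup>+u. ennreal (norm (g (of_real u)) powr p * (1 - u) powr (\<alpha> + 1)) * indicator {0..<1} u \<partial>lborel)
      \<le> (\<integral>\<^sup>+u. ennreal K0 * (\<integral>\<^sup>+z. F u z \<partial>wdisc \<alpha>) \<partial>lborel)"
    proof (intro nn_integral_mono)
      fix u :: real
      show "ennreal (norm (g (of_real u)) powr p * (1 - u) powr (\<alpha> + 1)) * indicator {0..<1} u
        \<le> ennreal K0 * (\<integral>\<^sup>+z. F u z \<partial>wdisc \<alpha>)"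
      proof (cases "u \<in> {0..<1}")
        case True
        then have u: "0 \<le> u" "u < 1" by auto
        have "ennreal (norm (g (of_real u)) powr p * (1 - u) powr (\<alpha> + 1))
          = ennreal (1 / (1 - u)) * ennreal (norm (g (of_real u)) powr p * (1 - norm (complex_of_real u)) powr (\<alpha> + 2))"
        proof -
          have "(1 - u) powr (\<alpha> + 2) = (1 - u) powr (\<alpha> + 1) * (1 - u) powr 1"
            by (subst powr_add[symmetric]) (simp add: add_ac)
          then have "(1 - u) powr (\<alpha> + 1) = 1 / (1 - u) * (1 - u) powr (\<alpha> + 2)" using u by simp
          then show ?thesis using u by (subst ennreal_mult'[symmetric]) (auto simp: mult_ac)
        qed
        also have "\<dots> \<le> ennreal (1 / (1 - u)) * (ennreal K0 * (\<integral>\<^sup>+z. ennreal (norm (g z) powr p) *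
            indicator (ball (of_real u) ((1 - norm (complex_of_real u)) / 2)) z \<partial>wdisc \<alpha>))"
          using u by (intro mult_left_mono sub[OF hol]) auto
        also have "\<dots> = ennreal K0 * (ennreal (1 / (1 - u)) * (\<integral>\<^sup>+z. ennreal (norm (g z) powr p) *
            indicator (ball (of_real u) ((1 - norm (complex_of_real u)) / 2)) z \<partial>wdisc \<alpha>))"
          by (simp add: mult_ac)
        also have "ennreal (1 / (1 - u)) * (\<integral>\<^sup>+z. ennreal (norm (g z) powr p) *
            indicator (ball (of_real u) ((1 - norm (complex_of_real u)) / 2)) z \<partial>wdisc \<alpha>)
           = (\<integral>\<^sup>+z. F u z \<partial>wdisc \<alpha>)"
          by (subst nn_integral_cmult[symmetric]) (use u in \<open>auto simp: F_def dist_norm indicator_def mult_ac intro!: nn_integral_cong\<close>)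
        finally show ?thesis using True by simp
      qed simp
    qed
    also have "\<dots> = ennreal K0 * (\<integral>\<^sup>+u. (\<integral>\<^sup>+z. F u z \<partial>wdisc \<alpha>) \<partial>lborel)"
      by (intro nn_integral_cmult W.borel_measurable_nn_integral) (use Fm in simp)
    also have "(\<integral>\<^sup>+u. (\<integral>\<^sup>+z. F u z \<partial>wdisc \<alpha>) \<partial>lborel) = (\<integral>\<^sup>+z. (\<integral>\<^sup>+u. F u z \<partial>lborel) \<partial>wdisc \<alpha>)"
      using P.Fubini'[OF Fm] by simp
    also have "\<dots> \<le> (\<integral>\<^sup>+z. ennreal 6 * ennreal (norm (g z) powr p) \<partial>wdisc \<alpha>)"
    proof (intro nn_integral_mono)
      fix z assume "z \<in> space (wdisc \<alpha>)"
      then have z: "norm z < 1" by simp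
      define x where "x = 1 - (norm z)\<^sup>2"
      have x: "x > 0" using z by (simp add: x_def power_less_one_iff)
      \<comment> \<open>If the ball about \<open>u\<close> contains \<open>z\<close>, then
        \<open>1 - u \<le> 2 * x\<close> and \<open>1 / (1 - u) \<le> 3 / x\<close>. An interval of
        length \<open>2 * x\<close> with height \<open>3 / x\<close> gives the constant 6.\<close>
      have "(\<integral>\<^sup>+u. F u z \<partial>lborel) \<le> (\<integral>\<^sup>+u. ennreal (norm (g z) powr p) * (ennreal (3 / x) * indicator {1 - 2 * x..1} u) \<partial>lborel)"
      proof (intro nn_integral_mono)
        fix u :: real
        show "F u z \<le> ennreal (norm (g z) powr p) * (ennreal (3 / x) * indicator {1 - 2 * x..1} u)"
        proof (cases "0 \<le> u \<and> u < 1 \<and> norm (of_real u - z) < (1 - u) / 2")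
          case True
          then have "(1 - u) / 2 \<le> x" "x \<le> 3 * (1 - u)"
            using near_ball_comparable[of "of_real u" z] by (auto simp: dist_norm x_def)
          moreover from this have "1 / (1 - u) \<le> 3 / x" using True x by (simp add: field_simps)
          ultimately show ?thesis using True unfolding F_def by (auto intro!: mult_left_mono ennreal_leI)
        next
          case False
          then have "F u z = 0" unfolding F_def by (simp only: if_False mult_zero_right)
          then show ?thesis by simp
        qed
      qed
      also have "\<dots> = ennreal (norm (g z) powr p) * (ennreal (3 / x) * ennreal (2 * x))"
        using x by (subst nn_integral_cmult; simp add: nn_integral_cmult_indicator)
      also have "\<dots> = ennreal 6 * ennreal (norm (g z) powr p)"
        using x by (simp add: ennreal_mult'[symmetric] mult_ac)
      finally show "(\<integral>\<^sup>+u. F u z \<partial>lborel) \<le> ennreal 6 * ennreal (norm (g z) powr p)" .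
    qed
    also have "\<dots> = ennreal 6 * ennreal (bergman_norm p \<alpha> g powr p / (\<alpha> + 1))"
      by (subst nn_integral_cmult) (auto simp: nn_integral_bergman[OF g p \<alpha>])
    also have "ennreal K0 * \<dots> = ennreal (K * bergman_norm p \<alpha> g powr p)"
      using K0 \<alpha> by (subst ennreal_mult'[symmetric], simp)+ (simp add: K_def mult_ac)
    finally show "(\<integral>\<^sup>+u. ennreal (norm (g (of_real u)) powr p * (1 - u) powr (\<alpha> + 1)) * indicator {0..<1} u \<partial>lborel)
       \<le> ennreal (K * bergman_norm p \<alpha> g powr p)" by (simp add: mult_left_mono)
  qed
qed

section \<open>Taylor coefficients and growth in Dirichlet-type spaces\<close>

text \<open>The coefficient of \<open>w ^ n\<close> in \<open>(1 - w) powr - c\<close>. For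
  \<open>c = \<beta>\<close> it is the Gamma quotient in \<open>mu_coeff\<close>; the Pochhammer
  form makes its sign and its recursion immediate.\<close>

definition bin_coeff :: "real \<Rightarrow> nat \<Rightarrow> real" where
  "bin_coeff c n = pochhammer c n / fact n"

lemma bin_coeff_nonneg: "c \<ge> 0 \<Longrightarrow> bin_coeff c n \<ge> 0"
proof -
  assume "c \<ge> 0"
  then have "pochhammer c n \<ge> 0" by (auto simp: pochhammer_prod intro!: prod_nonneg)
  then show ?thesis by (simp add: bin_coeff_def)
qed

lemma Gamma_ratio_eq_bin_coeff:
  assumes "\<beta> > 0"
  shows "Gamma (real n + \<beta>) / (fact n * Gamma \<beta>) = bin_coeff \<beta> n"
proof -
  have "\<beta> \<notin> \<int>\<^sub>\<le>\<^sub>0" using assms by auto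
  then show ?thesis by (simp add: bin_coeff_def pochhammer_Gamma add.commute)
qed

text \<open>Coefficientwise, this says that \<open>(1 - w) powr - c\<close> has derivative
  \<open>c * (1 - w) powr - (c + 1)\<close>. It is how the kernel exponent
  \<open>\<beta> + 1\<close> arises from differentiating the image.\<close>

lemma bin_coeff_Suc:
  "real (Suc n) * bin_coeff c (Suc n) = c * bin_coeff (c + 1) n"
proof -
  have "real (Suc n) * (pochhammer c (Suc n) / fact (Suc n)) = pochhammer c (Suc n) / fact n"
    by (simp only: fact_Suc of_nat_mult) (simp del: of_nat_Suc pochhammer_Suc)
  then show ?thesis by (simp only: bin_coeff_def pochhammer_rec) simp
qed

lemma bin_coeff_sums:
  assumes "norm (w::complex) < 1"
  shows "(\<lambda>n. of_real (bin_coeff c n) * w ^ n) sums (1 - w) powr (- of_real c)"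
proof -
  have eq: "(- of_real c gchoose n) * (- w) ^ n = of_real (bin_coeff c n) * w ^ n" for n
  proof -
    have "(- of_real c gchoose n) * (- w) ^ n = ((-1) ^ n * (-1) ^ n) * (pochhammer (of_real c) n / fact n * w ^ n)"
      unfolding gbinomial_pochhammer power_minus[of w] by simp
    then show ?thesis by (simp add: bin_coeff_def pochhammer_of_real minus_one_mult_self)
  qed
  show ?thesis using gen_binomial_complex[of "- w" "- of_real c"] assms by (simp add: eq)
qed

lemma bin_coeff_sums_real:
  assumes "\<bar>x\<bar> < (1::real)"
  shows "(\<lambda>n. bin_coeff c n * x ^ n) sums (1 - x) powr (- c)"
proof -
  have eq: "(- c gchoose n) * (- x) ^ n = bin_coeff c n * x ^ n" for n
  proof -
    have "(- c gchoose n) * (- x) ^ n = ((-1) ^ n * (-1) ^ n) * (pochhammer c n / fact n * x ^ n)"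
      unfolding gbinomial_pochhammer power_minus[of x] by simp
    then show ?thesis by (simp add: bin_coeff_def minus_one_mult_self)
  qed
  show ?thesis using gen_binomial_real[of "- x" "- c"] assms by (simp add: eq)
qed

section \<open>Taylor coefficients as Fourier coefficients, and their absolute sums\<close>

lemma taylor_coeff_eqI:
  assumes "\<And>z. norm z < 1 \<Longrightarrow> (\<lambda>n. c n * z ^ n) sums f z"
  shows "taylor_coeff f k = c k"
proof -
  have "f has_fps_expansion Abs_fps c"
  proof (rule has_fps_expansionI)
    have "eventually (\<lambda>z::complex. z \<in> ball 0 1) (nhds 0)"
      by (rule eventually_nhds_in_open) auto
    then show "eventually (\<lambda>u. (\<lambda>n. fps_nth (Abs_fps c) n * u ^ n) sums f u) (nhds 0)"
      by eventually_elim (use assms in simp)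
  qed
  from fps_nth_fps_expansion[OF this, of k] show ?thesis by (simp add: taylor_coeff_def)
qed

lemma taylor_coeff_sums:
  assumes "f holomorphic_on ball 0 1" "norm z < 1"
  shows "(\<lambda>n. taylor_coeff f n * z ^ n) sums f z"
  using holomorphic_power_series[OF assms(1), of z] assms(2) by (simp add: taylor_coeff_def)

text \<open>Cauchy's formula for the \<open>k\<close>-th derivative with \<open>1 / z\<close>
  replaced by \<open>cnj z / r\<^sup>2\<close> on the circle. The result is an inner product of
  \<open>f\<close> with a monomial, as Bessel's inequality needs; as \<open>circlepath\<close> runs
  over \<open>{0..1}\<close>, no factor \<open>2 * pi\<close> remains.\<close>

lemma circle_coeff_integral:
  assumes hol: "f holomorphic_on ball 0 1" and r: "0 < r" "r < 1"
  shows "((\<lambda>x. f (circlepath 0 r x) * cnj (circlepath 0 r x) ^ k) has_integral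
     (of_real (r ^ (2 * k)) * taylor_coeff f k)) {0..1}"
proof -
  have "((\<lambda>u. f u / (u - 0) ^ Suc k) has_contour_integral ((2 * pi * \<i>) / fact k * (deriv ^^ k) f 0)) (circlepath 0 r)"
    using r by (intro Cauchy_has_contour_integral_higher_derivative_circlepath
        holomorphic_on_imp_continuous_on holomorphic_on_subset[OF hol]) auto
  then have "((\<lambda>x. f (circlepath 0 r x) / circlepath 0 r x ^ Suc k * vector_derivative (circlepath 0 r) (at x within {0..1}))
     has_integral (2 * pi * \<i> * taylor_coeff f k)) {0..1}"
    by (simp add: has_contour_integral_def taylor_coeff_def)
  then have "((\<lambda>x. (of_real (r ^ (2 * k)) / (2 * pi * \<i>)) * (f (circlepath 0 r x) / circlepath 0 r x ^ Suc k * vector_derivative (circlepath 0 r) (at x within {0..1})))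
     has_integral ((of_real (r ^ (2 * k)) / (2 * pi * \<i>)) * (2 * pi * \<i> * taylor_coeff f k))) {0..1}"
    by (rule has_integral_mult_right)
  also have "(of_real (r ^ (2 * k)) / (2 * pi * \<i>)) * (2 * pi * \<i> * taylor_coeff f k) = of_real (r ^ (2 * k)) * taylor_coeff f k"
    by (simp add: field_simps)
  finally show ?thesis
  proof (rule has_integral_eq[rotated])
    fix x :: real assume x: "x \<in> {0..1}"
    define e where "e = circlepath 0 r x"
    have e: "e = of_real r * exp (2 * of_real pi * \<i> * of_real x)" by (simp add: e_def circlepath)
    have vd: "vector_derivative (circlepath 0 r) (at x within {0..1}) = 2 * pi * \<i> * e"
      using x by (simp add: vector_derivative_circlepath01 e)
    have "norm e = r" using r by (simp add: e norm_mult)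
    then have ec: "e * cnj e = of_real (r\<^sup>2)" by (metis complex_norm_square)
    have e0: "e \<noteq> 0" using r by (simp add: e)
    have rk: "of_real (r ^ (2 * k)) = (e * cnj e) ^ k" unfolding ec by (simp add: power_mult)
    show "(of_real (r ^ (2 * k)) / (2 * pi * \<i>)) * (f (circlepath 0 r x) / circlepath 0 r x ^ Suc k * vector_derivative (circlepath 0 r) (at x within {0..1}))
      = f (circlepath 0 r x) * cnj (circlepath 0 r x) ^ k"
    proof -
      have gen: "(R * E) / c * (F / (e * R) * (c * e)) = F * E" if "c \<noteq> 0" "R \<noteq> 0" for c F E R :: complex
        using that e0 by (simp add: field_simps)
      show ?thesis
        unfolding vd e_def[symmetric] rk power_mult_distrib power_Suc
        by (rule gen) (use e0 in auto)
    qed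
  qed
qed

text \<open>Expand the mean of \<open>|f - P|^2\<close> over the circle, where \<open>P\<close> is
  the Taylor polynomial of degree \<open>N\<close>. Both the pairing of \<open>f\<close> with
  \<open>P\<close> and that of \<open>P\<close> with itself equal the left-hand sum
  \<open>S\<close>, so nonnegativity reads \<open>M\<^sup>2 - 2 * S + S \<ge> 0\<close>.\<close>

lemma Bessel_taylor_coeff:
  assumes hol: "f holomorphic_on ball 0 1" and r: "0 < r" "r < 1"
    and M: "\<And>z. norm z = r \<Longrightarrow> norm (f z) \<le> M"
  shows "(\<Sum>k\<le>N. (norm (taylor_coeff f k))\<^sup>2 * r ^ (2 * k)) \<le> M\<^sup>2"
proof -
  define P where "P z = (\<Sum>k\<le>N. taylor_coeff f k * z ^ k)" for z
  define S where "S = (\<Sum>k\<le>N. (norm (taylor_coeff f k))\<^sup>2 * r ^ (2 * k))"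
  define e where "e = circlepath 0 r"
  have holP: "P holomorphic_on ball 0 1" unfolding P_def by (intro holomorphic_intros)
  have tP: "taylor_coeff P k = (if k \<le> N then taylor_coeff f k else 0)" for k
  proof (rule taylor_coeff_eqI)
    fix z :: complex
    have "(\<lambda>n. if n \<in> {..N} then taylor_coeff f n * z ^ n else 0) sums (\<Sum>k\<in>{..N}. taylor_coeff f k * z ^ k)"
      by (rule sums_If_finite_set) simp
    then show "(\<lambda>n. (if n \<le> N then taylor_coeff f n else 0) * z ^ n) sums P z"
      unfolding P_def by (rule sums_cong[THEN iffD1, rotated]) auto
  qed
  \<comment> \<open>Stated for a general \<open>h\<close> so that it can be used for
    \<open>f\<close> and for \<open>P\<close>, whose coefficients agree up to
    \<open>N\<close>.\<close>
  have I: "((\<lambda>x. h (e x) * cnj (P (e x))) has_integral of_real S) {0..1}"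
    if h: "h holomorphic_on ball 0 1" and eq: "\<And>k. k \<le> N \<Longrightarrow> taylor_coeff h k = taylor_coeff f k" for h
  proof -
    have "((\<lambda>x. \<Sum>k\<le>N. cnj (taylor_coeff f k) * (h (e x) * cnj (e x) ^ k)) has_integral
       (\<Sum>k\<le>N. cnj (taylor_coeff f k) * (of_real (r ^ (2 * k)) * taylor_coeff h k))) {0..1}"
      unfolding e_def
      by (intro has_integral_sum has_integral_mult_right circle_coeff_integral[OF h r]) auto
    also have "(\<Sum>k\<le>N. cnj (taylor_coeff f k) * (of_real (r ^ (2 * k)) * taylor_coeff h k)) = of_real S"
      unfolding S_def of_real_sum
    proof (rule sum.cong)
      fix k assume "k \<in> {..N}"
      then have "cnj (taylor_coeff f k) * (of_real (r ^ (2 * k)) * taylor_coeff h k) = of_real (r ^ (2 * k)) * (taylor_coeff f k * cnj (taylor_coeff f k))"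
        by (simp add: eq mult_ac)
      also have "taylor_coeff f k * cnj (taylor_coeff f k) = of_real ((norm (taylor_coeff f k))\<^sup>2)"
        by (rule complex_norm_square[symmetric])
      finally show "cnj (taylor_coeff f k) * (of_real (r ^ (2 * k)) * taylor_coeff h k) = of_real ((norm (taylor_coeff f k))\<^sup>2 * r ^ (2 * k))"
        by simp
    qed simp
    also have "(\<lambda>x. \<Sum>k\<le>N. cnj (taylor_coeff f k) * (h (e x) * cnj (e x) ^ k)) = (\<lambda>x. h (e x) * cnj (P (e x)))"
      by (simp add: P_def sum_distrib_left mult_ac)
    finally show ?thesis .
  qed
  have I1: "((\<lambda>x. Re (f (e x) * cnj (P (e x)))) has_integral S) {0..1}"
    using has_integral_Re[OF I[OF hol]] by simp
  have I2: "((\<lambda>x. Re (P (e x) * cnj (P (e x)))) has_integral S) {0..1}"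
    using has_integral_Re[OF I[OF holP]] tP by simp
  have I0: "((\<lambda>x::real. M\<^sup>2) has_integral M\<^sup>2) {0..1}"
    using has_integral_const_real[of "M\<^sup>2" 0 1] by simp
  have "((\<lambda>x. M\<^sup>2 - 2 * Re (f (e x) * cnj (P (e x))) + Re (P (e x) * cnj (P (e x)))) has_integral (M\<^sup>2 - 2 * S + S)) {0..1}"
    by (intro has_integral_add has_integral_diff has_integral_mult_right I0 I1 I2)
  then have "0 \<le> M\<^sup>2 - 2 * S + S"
  proof (rule has_integral_nonneg)
    fix x :: real assume "x \<in> {0..1}"
    have "norm (e x) = r" using r by (simp add: e_def circlepath norm_mult)
    then have "norm (f (e x)) \<le> M" by (rule M)
    then have 1: "(norm (f (e x)))\<^sup>2 \<le> M\<^sup>2" by (intro power_mono) auto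
    have "0 \<le> (norm (f (e x) - P (e x)))\<^sup>2" by simp
    also have "\<dots> = (norm (f (e x)))\<^sup>2 - 2 * Re (f (e x) * cnj (P (e x))) + Re (P (e x) * cnj (P (e x)))"
      unfolding cmod_power2 by (simp add: power2_eq_square algebra_simps)
    finally show "0 \<le> M\<^sup>2 - 2 * Re (f (e x) * cnj (P (e x))) + Re (P (e x) * cnj (P (e x)))" using 1 by linarith
  qed
  then show ?thesis by (simp add: S_def)
qed

text \<open>Write \<open>t ^ k \<le> r ^ k * r ^ k\<close> and apply Cauchy-Schwarz. Bessel's
  inequality bounds the coefficient part by the maximum on radius \<open>r\<close>, of order
  \<open>(1 - t) powr - a\<close>; the geometric series contributes the square root of
  \<open>2 / (1 - t)\<close>. This is the origin of the extra \<open>1/2\<close> in the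
  exponent.\<close>

lemma taylor_coeff_abs_sum:
  assumes hol: "f holomorphic_on ball 0 1" and Q: "Q \<ge> 0" and a: "a \<ge> 0"
    and gr: "\<And>z. norm z < 1 \<Longrightarrow> norm (f z) \<le> Q * (1 - norm z) powr - a"
    and t: "0 \<le> t" "t < 1"
  shows "summable (\<lambda>k. norm (taylor_coeff f k) * t ^ k)"
    and "(\<Sum>k. norm (taylor_coeff f k) * t ^ k) \<le> Q * 4 powr a * sqrt 2 * (1 - t) powr - (a + 1/2)"
proof -
  \<comment> \<open>\<open>r\<^sup>2\<close> is the midpoint of \<open>t\<close> and 1. It dominates
    \<open>t\<close>, while \<open>1 - r\<^sup>2\<close> and \<open>1 - r\<close> remain comparable
    to \<open>1 - t\<close>.\<close>
  define r where "r = sqrt ((1 + t) / 2)"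
  have r2: "r\<^sup>2 = (1 + t) / 2" using t by (simp add: r_def)
  have r0: "r > 0" using t by (simp add: r_def)
  have "r\<^sup>2 < 1" using r2 t by simp
  then have r1: "r < 1" using r0 by (simp add: power_less_one_iff)
  have rt: "t \<le> r\<^sup>2" using r2 t by simp
  have "1 - r\<^sup>2 = (1 - r) * (1 + r)" by (simp add: power2_eq_square algebra_simps)
  also have "\<dots> \<le> (1 - r) * 2" using r0 r1 by (intro mult_left_mono) auto
  finally have r1t: "(1 - t) / 4 \<le> 1 - r" unfolding r2 by argo
  define M where "M = Q * ((1 - t) / 4) powr - a"
  have M0: "M \<ge> 0" using Q by (simp add: M_def)
  have fM: "norm (f z) \<le> M" if "norm z = r" for z
  proof -
    have "norm (f z) \<le> Q * (1 - r) powr - a" using gr[of z] that r1 by simp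
    also have "\<dots> \<le> M" unfolding M_def using r1t t a Q by (intro mult_left_mono powr_mono2') auto
    finally show ?thesis .
  qed
  have part: "(\<Sum>k\<le>N. norm (taylor_coeff f k) * t ^ k) \<le> M * sqrt (2 / (1 - t))" for N
  proof -
    have "(\<Sum>k\<le>N. norm (taylor_coeff f k) * t ^ k) \<le> (\<Sum>k\<le>N. (norm (taylor_coeff f k) * r ^ k) * r ^ k)"
    proof (intro sum_mono)
      fix k
      have "t ^ k \<le> (r\<^sup>2) ^ k" using rt t by (intro power_mono) auto
      also have "\<dots> = r ^ k * r ^ k" by (simp add: power2_eq_square power_mult_distrib)
      finally show "norm (taylor_coeff f k) * t ^ k \<le> (norm (taylor_coeff f k) * r ^ k) * r ^ k"
        by (simp add: mult.assoc mult_left_mono)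
    qed
    also have "\<dots> \<le> sqrt ((\<Sum>k\<le>N. (norm (taylor_coeff f k) * r ^ k)\<^sup>2) * (\<Sum>k\<le>N. (r ^ k)\<^sup>2))"
      by (intro real_le_rsqrt Cauchy_Schwarz_ineq_sum)
    also have "\<dots> \<le> sqrt (M\<^sup>2 * (2 / (1 - t)))"
    proof (intro real_sqrt_le_mono mult_mono)
      show "(\<Sum>k\<le>N. (norm (taylor_coeff f k) * r ^ k)\<^sup>2) \<le> M\<^sup>2"
        using Bessel_taylor_coeff[OF hol r0 r1 fM, of N] by (simp add: power_mult_distrib power_mult[symmetric] mult.commute)
      have "(\<Sum>k\<le>N. (r ^ k)\<^sup>2) = (\<Sum>k\<le>N. (r\<^sup>2) ^ k)" by (simp add: power_mult[symmetric] mult.commute)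
      also have "\<dots> \<le> (\<Sum>k. (r\<^sup>2) ^ k)"
        using \<open>r\<^sup>2 < 1\<close> by (intro sum_le_suminf summable_geometric) auto
      also have "\<dots> = 2 / (1 - t)" using \<open>r\<^sup>2 < 1\<close> t by (subst suminf_geometric) (auto simp: r2 field_simps)
      finally show "(\<Sum>k\<le>N. (r ^ k)\<^sup>2) \<le> 2 / (1 - t)" .
    qed (auto intro: sum_nonneg)
    also have "\<dots> = M * sqrt (2 / (1 - t))" using M0 by (simp only: real_sqrt_mult real_sqrt_abs abs_of_nonneg)
    finally show ?thesis .
  qed
  show summ: "summable (\<lambda>k. norm (taylor_coeff f k) * t ^ k)"
    by (rule bounded_imp_summable[OF _ part]) (use t in auto)
  have "(\<Sum>k. norm (taylor_coeff f k) * t ^ k) \<le> M * sqrt (2 / (1 - t))"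
  proof (rule suminf_le_const[OF summ])
    fix n show "(\<Sum>k<n. norm (taylor_coeff f k) * t ^ k) \<le> M * sqrt (2 / (1 - t))"
      by (rule order_trans[OF sum_mono2 part[of n]]) (use t in auto)
  qed
  also have "\<dots> = Q * 4 powr a * sqrt 2 * (1 - t) powr - (a + 1/2)"
  proof -
    have "((1 - t) / 4) powr - a = (1 - t) powr - a * 4 powr a"
      by (simp add: powr_divide powr_minus divide_simps)
    moreover have "sqrt (2 / (1 - t)) = sqrt 2 * (1 - t) powr - (1/2)"
      using t by (simp add: real_sqrt_divide powr_minus powr_half_sqrt divide_simps)
    moreover have "(1 - t) powr - (a + 1/2) = (1 - t) powr - a * (1 - t) powr - (1/2)"
      by (simp add: powr_add[symmetric])
    ultimately show ?thesis by (simp add: M_def mult_ac)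
  qed
  finally show "(\<Sum>k. norm (taylor_coeff f k) * t ^ k) \<le> Q * 4 powr a * sqrt 2 * (1 - t) powr - (a + 1/2)" .
qed

section \<open>Growth of functions from growth and radial integrals of their derivatives\<close>

lemma dirichlet_norm_nonneg: "dirichlet_norm p \<alpha> f \<ge> 0"
  by (simp add: dirichlet_norm_def bergman_norm_nonneg)

text \<open>Integrate the growth of the derivative along the segment from 0 to \<open>z\<close>. As
  the exponent exceeds 1, integration lowers it by one and leaves a genuine power, which also
  absorbs the constant \<open>f 0\<close>.\<close>

lemma dirichlet_growth:
  assumes p: "p > 0" and \<alpha>: "\<alpha> > -1" and \<sigma>: "(\<alpha> + 2) / p > 1"
  obtains K where "K \<ge> 0" "\<And>f z. in_dirichlet p \<alpha> f \<Longrightarrow> norm z < 1 \<Longrightarrow>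
     norm (f z) \<le> K * dirichlet_norm p \<alpha> f * (1 - norm z) powr - ((\<alpha> + 2) / p - 1)"
proof -
  obtain K1 where K1: "K1 \<ge> 0" and gr: "\<And>g z. in_bergman p \<alpha> g \<Longrightarrow> norm z < 1 \<Longrightarrow>
     norm (g z) \<le> K1 * bergman_norm p \<alpha> g * (1 - norm z) powr - ((\<alpha> + 2) / p)"
    using bergman_growth[OF p \<alpha>] by blast
  define \<sigma> where "\<sigma> = (\<alpha> + 2) / p - 1"
  have s: "\<sigma> > 0" using \<sigma> by (simp add: \<sigma>_def)
  define K where "K = 1 + K1 / \<sigma>"
  have K: "K \<ge> 0" using K1 s by (simp add: K_def)
  show ?thesis
  proof (rule that[OF K])
    fix f z assume f: "in_dirichlet p \<alpha> f" and z: "norm (z::complex) < 1"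
    have hol: "f holomorphic_on ball 0 1" and der: "in_bergman p \<alpha> (deriv f)" using f by (auto simp: in_dirichlet_def)
    define N where "N = bergman_norm p \<alpha> (deriv f)"
    have N: "N \<ge> 0" by (simp add: N_def bergman_norm_nonneg)
    have ns: "norm (of_real s * z) < 1" "norm (of_real s * z) = s * norm z" "s * norm z < 1" if "0 \<le> s" "s \<le> 1" for s
    proof -
      have "s * norm z \<le> 1 * norm z" using that by (intro mult_right_mono) auto
      then show "norm (of_real s * z) < 1" "s * norm z < 1" using z that by (auto simp: norm_mult)
      show "norm (of_real s * z) = s * norm z" using that by (simp add: norm_mult)
    qed
    \<comment> \<open>An antiderivative in \<open>s\<close> of the bound on the derivative of
      \<open>f\<close> along the segment; the mean value inequality compares the two.\<close>
    define \<phi> where "\<phi> s = K1 * N / \<sigma> * (1 - s * norm z) powr - \<sigma>" for s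
    have "norm (f (of_real 1 * z) - f (of_real 0 * z)) \<le> \<phi> 1 - \<phi> 0"
    proof (rule differentiable_bound_general[where f = "\<lambda>s. f (of_real s * z)" and f' = "\<lambda>s. deriv f (of_real s * z) * z" and \<phi> = \<phi>
          and \<phi>' = "\<lambda>s. K1 * N * (1 - s * norm z) powr - (\<sigma> + 1) * norm z"])
      have "continuous_on (ball 0 1) f" using hol by (rule holomorphic_on_imp_continuous_on)
      then show "continuous_on {0..1} (\<lambda>s. f (of_real s * z))"
        by (rule continuous_on_compose2) (auto intro!: continuous_intros simp: ns)
      show "continuous_on {0..1} \<phi>" unfolding \<phi>_def
        using z ns(3) by (intro continuous_intros) fastforce+
      fix s :: real assume s01: "0 < s" "s < 1"
      have "(f has_field_derivative deriv f (of_real s * z)) (at (of_real s * z))"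
        using s01 ns[of s] by (intro holomorphic_derivI[OF hol]) auto
      moreover have "((\<lambda>s. of_real s * z) has_vector_derivative z) (at s)"
        by (auto intro!: derivative_eq_intros simp: has_vector_derivative_def scaleR_conv_of_real)
      ultimately have "((f \<circ> (\<lambda>s. of_real s * z)) has_vector_derivative (z * deriv f (of_real s * z))) (at s)"
        by (intro field_vector_diff_chain_at)
      then show "((\<lambda>s. f (of_real s * z)) has_vector_derivative deriv f (of_real s * z) * z) (at s)"
        by (simp add: o_def mult.commute)
      have "((\<lambda>s. (1 - s * norm z) powr - \<sigma>) has_real_derivative (- \<sigma> * (1 - s * norm z) powr (- \<sigma> - 1) * (- norm z))) (at s)"
        using s01 ns(3)[of s] by (auto intro!: derivative_eq_intros)
      then have "(\<phi> has_real_derivative (K1 * N / \<sigma> * (- \<sigma> * (1 - s * norm z) powr (- \<sigma> - 1) * (- norm z)))) (at s)"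
        unfolding \<phi>_def by (rule DERIV_cmult)
      moreover have "K1 * N / \<sigma> * (- \<sigma> * (1 - s * norm z) powr (- \<sigma> - 1) * (- norm z)) = K1 * N * (1 - s * norm z) powr - (\<sigma> + 1) * norm z"
      proof -
        have "- \<sigma> - 1 = - (\<sigma> + 1)" by simp
        then show ?thesis using s by (simp only:) simp
      qed
      ultimately show "(\<phi> has_vector_derivative K1 * N * (1 - s * norm z) powr - (\<sigma> + 1) * norm z) (at s)"
        by (simp add: has_real_derivative_iff_has_vector_derivative)
      have "norm (deriv f (of_real s * z)) \<le> K1 * N * (1 - s * norm z) powr - (\<sigma> + 1)"
        using gr[OF der, of "of_real s * z"] ns[of s] s01 by (simp add: N_def \<sigma>_def)
      then show "norm (deriv f (of_real s * z) * z) \<le> K1 * N * (1 - s * norm z) powr - (\<sigma> + 1) * norm z"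
        by (simp add: norm_mult mult_right_mono)
    qed auto
    then have "norm (f z - f 0) \<le> K1 * N / \<sigma> * (1 - norm z) powr - \<sigma> - \<phi> 0" by (simp add: \<phi>_def)
    moreover have "\<phi> 0 \<ge> 0" using K1 N s by (simp add: \<phi>_def)
    ultimately have 1: "norm (f z - f 0) \<le> K1 / \<sigma> * N * (1 - norm z) powr - \<sigma>" by simp
    have ge1: "1 \<le> (1 - norm z) powr - \<sigma>"
      using powr_mono2'[of "- \<sigma>" "1 - norm z" 1] s z by simp
    have "norm (f z) \<le> norm (f 0) + norm (f z - f 0)" using norm_triangle_ineq[of "f 0" "f z - f 0"] by simp
    also have "\<dots> \<le> norm (f 0) * (1 - norm z) powr - \<sigma> + K1 / \<sigma> * N * (1 - norm z) powr - \<sigma>"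
      using ge1 1 mult_left_mono[OF ge1, of "norm (f 0)"] by simp
    also have "\<dots> \<le> K * (norm (f 0) + N) * (1 - norm z) powr - \<sigma>"
      using N K1 s by (simp add: K_def algebra_simps)
    finally show "norm (f z) \<le> K * dirichlet_norm p \<alpha> f * (1 - norm z) powr - ((\<alpha> + 2) / p - 1)"
      by (simp add: dirichlet_norm_def N_def \<sigma>_def)
  qed
qed

text \<open>The bound is a nonnegative integral because it is inserted under the integral over
  \<open>t\<close>, where Tonelli's theorem exchanges the two.\<close>

lemma radial_FTC_bound:
  assumes hol: "f holomorphic_on ball 0 1" and t: "0 \<le> t" "t < 1"
  shows "ennreal (norm (f (of_real t) - f 0)) \<le>
    (\<integral>\<^sup>+u. ennreal (norm (deriv f (of_real u))) * indicator {0..t} u \<partial>lborel)"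
proof -
  have cont: "continuous_on {0..t} (\<lambda>u. deriv f (of_real u))"
  proof -
    have "continuous_on (ball 0 1) (deriv f)"
      by (intro holomorphic_on_imp_continuous_on holomorphic_deriv hol) auto
    then show ?thesis by (rule continuous_on_compose2) (use t in \<open>auto intro!: continuous_intros\<close>)
  qed
  have "(\<integral>u. indicator {0..t} u *\<^sub>R deriv f (of_real u) \<partial>lborel) = f (of_real t) - f (of_real 0)"
  proof (rule integral_FTC_atLeastAtMost[OF t(1) _ cont])
    fix x assume x: "0 \<le> x" "x \<le> t"
    have "(f has_field_derivative deriv f (of_real x)) (at (of_real x))"
      using x t by (intro holomorphic_derivI[OF hol]) auto
    then have "((f \<circ> of_real) has_vector_derivative (1 * deriv f (of_real x))) (at x)"
      by (intro field_vector_diff_chain_at) (auto intro!: derivative_eq_intros simp: has_vector_derivative_def scaleR_conv_of_real)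
    then show "((\<lambda>u. f (of_real u)) has_vector_derivative deriv f (of_real x)) (at x within {0..t})"
      by (simp add: o_def has_vector_derivative_at_within)
  qed
  moreover have "integrable lborel (\<lambda>u. indicator {0..t} u *\<^sub>R deriv f (of_real u))"
    using borel_integrable_compact[OF compact_Icc cont] by simp
  ultimately have "ennreal (norm (f (of_real t) - f (of_real 0))) \<le> (\<integral>\<^sup>+u. norm (indicator {0..t} u *\<^sub>R deriv f (of_real u)) \<partial>lborel)"
    using integral_norm_bound_ennreal by metis
  also have "\<dots> = (\<integral>\<^sup>+u. ennreal (norm (deriv f (of_real u))) * indicator {0..t} u \<partial>lborel)"
    by (intro nn_integral_cong) (auto simp: indicator_def)
  finally show ?thesis by simp
qed

section \<open>Necessity\<close>

abbreviation unit_part :: "real measure \<Rightarrow> real measure" where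
  "unit_part \<mu> \<equiv> restrict_space \<mu> {0..<1}"

lemma carleson_mono:
  assumes "carleson s \<mu>" "s' \<le> s"
  shows "carleson s' \<mu>"
proof -
  obtain C where C: "\<And>t. 0 \<le> t \<Longrightarrow> t < 1 \<Longrightarrow> emeasure \<mu> {t..<1} \<le> ennreal (C * (1 - t) powr s)"
    using assms(1) by (auto simp: carleson_def)
  show ?thesis unfolding carleson_def
  proof (intro exI[of _ "max C 0"] allI impI)
    fix t :: real assume t: "0 \<le> t \<and> t < 1"
    have "C * (1 - t) powr s \<le> max C 0 * (1 - t) powr s" by (intro mult_right_mono) auto
    also have "\<dots> \<le> max C 0 * (1 - t) powr s'"
      using t assms(2) by (intro mult_left_mono powr_mono') auto
    finally show "emeasure \<mu> {t..<1} \<le> ennreal (max C 0 * (1 - t) powr s')"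
      using C t by (meson ennreal_leI order_trans)
  qed
qed

lemma decay_unit_part:
  assumes sets: "sets \<mu> = sets borel" and "carleson s \<mu>" "s \<ge> 0"
  obtains C where "decay (unit_part \<mu>) (\<lambda>t. 1 - t) C s"
proof -
  obtain C where C: "\<And>t. 0 \<le> t \<Longrightarrow> t < 1 \<Longrightarrow> emeasure \<mu> {t..<1} \<le> ennreal (C * (1 - t) powr s)"
    using assms(2) by (auto simp: carleson_def)
  have sp: "space \<mu> = UNIV" using sets_eq_imp_space_eq[OF sets] by simp
  have "decay (unit_part \<mu>) (\<lambda>t. 1 - t) (max C 0) s"
    unfolding decay_def
  proof (intro conjI ballI allI impI)
    have "(\<lambda>t::real. 1 - t) \<in> borel_measurable \<mu>" by (simp add: measurable_cong_sets[OF sets])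
    then show "(\<lambda>t. 1 - t) \<in> borel_measurable (unit_part \<mu>)"
      by (rule measurable_restrict_space1)
    fix r :: real assume r: "r > 0"
    \<comment> \<open>For \<open>r > 1\<close> the sublevel set is all of \<open>[0, 1)\<close>; the
      Carleson bound at 0 still suffices there because \<open>s \<ge> 0\<close>.\<close>
    let ?t = "max 0 (1 - r)"
    have eq: "{t \<in> space (unit_part \<mu>). 1 - t \<le> r} = {?t..<1}"
      by (auto simp: space_restrict_space sp)
    have "emeasure (unit_part \<mu>) {?t..<1} = emeasure \<mu> {?t..<1}"
      by (rule emeasure_restrict_space) (auto simp: sets sp)
    also have "\<dots> \<le> ennreal (C * (1 - ?t) powr s)" using r by (intro C) auto
    also have "\<dots> \<le> ennreal (max C 0 * r powr s)"
      using r assms(3) by (intro ennreal_leI mult_mono powr_mono2) auto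
    finally show "emeasure (unit_part \<mu>) {t \<in> space (unit_part \<mu>). 1 - t \<le> r} \<le> ennreal (max C 0 * r powr s)"
      unfolding eq .
  qed (auto simp: space_restrict_space)
  then show ?thesis by (rule that)
qed

lemma finite_unit_part:
  assumes sets: "sets \<mu> = sets borel" and "carleson s \<mu>"
  shows "finite_measure (unit_part \<mu>)"
proof -
  have sp: "space \<mu> = UNIV" using sets_eq_imp_space_eq[OF sets] by simp
  obtain C where "emeasure \<mu> {0..<1} \<le> ennreal (C * (1 - 0) powr s)"
    using assms(2) unfolding carleson_def by (metis order_refl zero_less_one)
  then have "emeasure \<mu> {0..<1} < \<infinity>" using ennreal_less_top le_less_trans by fastforce
  then have "emeasure (unit_part \<mu>) (space (unit_part \<mu>)) < \<infinity>"
    by (subst emeasure_restrict_space) (auto simp: sets sp space_restrict_space)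
  then show ?thesis by (intro finite_measureI) auto
qed

lemma measurable_unit_part:
  assumes sets: "sets \<mu> = sets borel" and f: "continuous_on {0..<1} f"
  shows "f \<in> borel_measurable (unit_part \<mu>)"
proof -
  have "sets (unit_part \<mu>) = sets (restrict_space borel {0..<1})"
    using sets by (simp cong: sets_restrict_space_cong)
  then show ?thesis using borel_measurable_continuous_on_restrict[OF f] by (simp cong: measurable_cong_sets)
qed

lemma space_unit_part: "sets \<mu> = sets borel \<Longrightarrow> space (unit_part \<mu>) = {0..<1}"
  using sets_eq_imp_space_eq[of \<mu> borel] by (simp add: space_restrict_space)

lemma set_integral_unit_part:
  fixes g :: "real \<Rightarrow> real"
  assumes sets: "sets \<mu> = sets borel"
  shows "(\<integral>t\<in>{0..<1}. g t \<partial>\<mu>) = (\<integral>t. g t \<partial>unit_part \<mu>)"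
  unfolding set_lebesgue_integral_def
  by (subst integral_restrict_space) (auto simp: sets sets_eq_imp_space_eq[OF sets])

lemma integrable_power_unit_part:
  assumes sets: "sets \<mu> = sets borel" and fin: "finite_measure (unit_part \<mu>)"
  shows "integrable (unit_part \<mu>) (\<lambda>t. t ^ n)"
proof (rule finite_measure.integrable_const_bound[OF fin, of _ 1])
  show "AE t in unit_part \<mu>. norm (t ^ n) \<le> 1"
    by (rule AE_I2) (auto simp: space_unit_part[OF sets] power_le_one)
  show "(\<lambda>t. t ^ n) \<in> borel_measurable (unit_part \<mu>)"
    by (intro measurable_unit_part[OF sets] continuous_intros)
qed

lemma mu_coeff_eq:
  assumes sets: "sets \<mu> = sets borel" and "\<beta> > 0"
  shows "mu_coeff \<mu> \<beta> n k = bin_coeff \<beta> n * (\<integral>t. t ^ (n + k) \<partial>unit_part \<mu>)"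
  by (simp add: mu_coeff_def Gamma_ratio_eq_bin_coeff assms set_integral_unit_part)

text \<open>\<open>|1 - tz|\<close> dominates \<open>1 - t\<close>, and \<open>|1 - z|\<close>
  exceeds it by at most \<open>1 - t\<close>. The kernel is thereby controlled by the distances of
  \<open>t\<close> and of \<open>z\<close> to 1 separately, so each integration becomes a case of
  \<open>decay_kernel\<close>.\<close>

lemma norm_one_minus_mult_ge:
  fixes z :: complex
  assumes t: "0 \<le> t" "t < 1" and z: "norm z < 1"
  shows "1 - t + norm (1 - z) \<le> 3 * norm (1 - of_real t * z)"
proof -
  have "t * norm z \<le> t * 1" using t z by (intro mult_left_mono) auto
  then have 1: "1 - t \<le> norm (1 - of_real t * z)"
    using norm_triangle_ineq2[of 1 "of_real t * z"] t by (simp add: norm_mult)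
  have "norm (1 - z) \<le> norm (1 - of_real t * z) + norm (of_real t * z - z)"
    using norm_triangle_ineq[of "1 - of_real t * z" "of_real t * z - z"] by simp
  also have "of_real t * z - z = - (of_real (1 - t) * z)" by (simp add: algebra_simps)
  also have "norm \<dots> = (1 - t) * norm z" using t by (simp add: norm_mult del: of_real_diff)
  also have "\<dots> \<le> (1 - t) * 1" using t z by (intro mult_left_mono) auto
  finally show ?thesis using 1 by simp
qed

lemma kernel_le:
  fixes z :: complex
  assumes t: "0 \<le> t" "t < 1" and z: "norm z < 1" and e: "e \<ge> 0"
  shows "norm (1 - of_real t * z) powr - e \<le> 3 powr e * (1 - t + norm (1 - z)) powr - e"
proof -
  have "1 - t + norm (1 - z) > 0" using t by (simp add: add_pos_nonneg)
  then have "norm (1 - of_real t * z) powr - e \<le> ((1 - t + norm (1 - z)) / 3) powr - e"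
    using norm_one_minus_mult_ge[OF t z] e by (intro powr_mono2') auto
  also have "\<dots> = 3 powr e * (1 - t + norm (1 - z)) powr - e"
    by (simp add: powr_divide powr_minus divide_simps)
  finally show ?thesis .
qed

text \<open>The derivative has size at most \<open>c * |1 - bz| powr - (c + 1)\<close>, and
  \<open>(c + 1) * p = \<alpha> + 2 + p\<close>. Against the decay exponent
  \<open>\<alpha> + 2\<close> of the weighted area, \<open>decay_kernel\<close> leaves
  \<open>(1 - b) powr - p\<close>, whose \<open>p\<close>-th root is
  \<open>1 / (1 - b)\<close>.\<close>

lemma test_function:
  assumes p: "p > 0" and \<alpha>: "\<alpha> > -1"
  defines "c \<equiv> (\<alpha> + 2) / p"
  obtains K where "\<And>b. 0 \<le> b \<Longrightarrow> b < 1 \<Longrightarrow> in_dirichlet p \<alpha> (\<lambda>z. (1 - of_real b * z) powr (- of_real c))"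
    "\<And>b. 0 \<le> b \<Longrightarrow> b < 1 \<Longrightarrow> dirichlet_norm p \<alpha> (\<lambda>z. (1 - of_real b * z) powr (- of_real c)) \<le> K / (1 - b)"
proof -
  have c: "c > 0" using p \<alpha> by (simp add: c_def)
  obtain C where C: "decay (wdisc \<alpha>) (\<lambda>z. norm (1 - z)) C (\<alpha> + 2)" using wdisc_decay[OF \<alpha>] .
  define e where "e = (c + 1) * p"
  have e: "e = \<alpha> + 2 + p" using p by (simp add: e_def c_def field_simps)
  obtain D where D: "D \<ge> 0" and ker: "\<And>\<delta>. \<delta> > 0 \<Longrightarrow>
    (\<integral>\<^sup>+z. ennreal (norm (1 - z) powr - 0 * (\<delta> + norm (1 - z)) powr - e) \<partial>wdisc \<alpha>) \<le> ennreal (D * \<delta> powr (\<alpha> + 2 - 0 - e))"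
    using decay_kernel[OF C, of 0 e] p \<alpha> e by auto
  define K1 where "K1 = (\<alpha> + 1) * (c powr p * 3 powr e * D)"
  have K1: "K1 \<ge> 0" using \<alpha> D by (simp add: K1_def)
  have main: "in_dirichlet p \<alpha> (\<lambda>z. (1 - of_real b * z) powr (- of_real c)) \<and>
     dirichlet_norm p \<alpha> (\<lambda>z. (1 - of_real b * z) powr (- of_real c)) \<le> (1 + K1 powr (1/p)) / (1 - b)"
    if b: "0 \<le> b" "b < 1" for b
  proof -
    define f where "f z = (1 - of_real b * z) powr (- of_real c)" for z :: complex
    have nz: "1 - of_real b * z \<notin> \<real>\<^sub>\<le>\<^sub>0" if "norm z < 1" for z :: complex
    proof -
      have "b * Re z \<le> b * norm z" using b by (intro mult_left_mono complex_Re_le_cmod) auto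
      also have "\<dots> \<le> b * 1" using b that by (intro mult_left_mono) auto
      finally have "Re (1 - of_real b * z) > 0" using b by simp
      then show ?thesis by (auto simp: complex_nonpos_Reals_iff)
    qed
    have hol: "f holomorphic_on ball 0 1" unfolding f_def
      by (intro holomorphic_intros) (use nz in auto)
    have der: "norm (deriv f z) \<le> c * norm (1 - of_real b * z) powr - (c + 1)" if z: "norm z < 1" for z
    proof -
      have "((\<lambda>z. (1 - of_real b * z) powr (- of_real c)) has_field_derivative
         (- of_real c * (1 - of_real b * z) powr (- of_real c - 1) * (- of_real b))) (at z)"
        by (rule DERIV_chain2[where g = "\<lambda>z. 1 - of_real b * z", OF has_field_derivative_powr[OF nz[OF z]]])
           (auto intro!: derivative_eq_intros)
      then have "deriv f z = of_real c * of_real b * (1 - of_real b * z) powr of_real (- c - 1)"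
        unfolding f_def by (subst DERIV_imp_deriv) (auto simp: mult_ac)
      then have "norm (deriv f z) = c * b * norm (1 - of_real b * z) powr - (c + 1)"
      proof -
        have "- c - 1 = - (c + 1)" by simp
        then show ?thesis using c b \<open>deriv f z = _\<close> by (simp only:) (simp add: norm_mult norm_powr_real_powr' del: of_real_minus of_real_diff of_real_add)
      qed
      also have "\<dots> \<le> c * 1 * norm (1 - of_real b * z) powr - (c + 1)"
        using c b by (intro mult_right_mono mult_left_mono) auto
      finally show ?thesis by simp
    qed
    have hold: "deriv f holomorphic_on ball 0 1" using hol by (rule holomorphic_deriv) auto
    have "bergman_int p \<alpha> (deriv f) = ennreal (\<alpha> + 1) * (\<integral>\<^sup>+z. ennreal (norm (deriv f z) powr p) \<partial>wdisc \<alpha>)"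
      by (intro bergman_int_eq holomorphic_on_imp_continuous_on hold)
    \<comment> \<open>The factor with exponent \<open>- 0\<close> equals 1 in the disc; it only
      brings the integrand into the shape of \<open>decay_kernel\<close> with
      \<open>y = 0\<close>.\<close>
    also have "\<dots> \<le> ennreal (\<alpha> + 1) * (\<integral>\<^sup>+z. ennreal (c powr p * 3 powr e) * ennreal (norm (1 - z) powr - 0 * (1 - b + norm (1 - z)) powr - e) \<partial>wdisc \<alpha>)"
    proof (intro mult_left_mono nn_integral_mono)
      fix z assume "z \<in> space (wdisc \<alpha>)"
      then have z: "norm z < 1" by simp
      have "norm (deriv f z) powr p \<le> (c * norm (1 - of_real b * z) powr - (c + 1)) powr p"
        using der[OF z] p by (intro powr_mono2) auto
      also have "\<dots> = c powr p * norm (1 - of_real b * z) powr - e"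
        using c p by (simp add: powr_mult powr_powr e_def algebra_simps)
      also have "\<dots> \<le> c powr p * (3 powr e * (1 - b + norm (1 - z)) powr - e)"
        using b z p \<alpha> e by (intro mult_left_mono kernel_le) auto
      finally have "norm (deriv f z) powr p \<le> (c powr p * 3 powr e) * (norm (1 - z) powr - 0 * (1 - b + norm (1 - z)) powr - e)"
        using z by (auto simp: mult_ac)
      then show "ennreal (norm (deriv f z) powr p) \<le> ennreal (c powr p * 3 powr e) * ennreal (norm (1 - z) powr - 0 * (1 - b + norm (1 - z)) powr - e)"
        by (simp add: ennreal_mult'[symmetric] ennreal_leI)
    qed simp
    also have "\<dots> = ennreal (\<alpha> + 1) * (ennreal (c powr p * 3 powr e) * (\<integral>\<^sup>+z. ennreal (norm (1 - z) powr - 0 * (1 - b + norm (1 - z)) powr - e) \<partial>wdisc \<alpha>))"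
    proof (subst nn_integral_cmult)
      have [measurable]: "(\<lambda>z. norm (1 - z)) \<in> borel_measurable (wdisc \<alpha>)" using C by (simp add: decay_def)
      show "(\<lambda>z. ennreal (norm (1 - z) powr - 0 * (1 - b + norm (1 - z)) powr - e)) \<in> borel_measurable (wdisc \<alpha>)"
        by measurable
    qed simp
    also have "\<dots> \<le> ennreal (\<alpha> + 1) * (ennreal (c powr p * 3 powr e) * ennreal (D * (1 - b) powr (\<alpha> + 2 - 0 - e)))"
      using b by (intro mult_left_mono ker) auto
    also have "\<dots> = ennreal (K1 * (1 - b) powr - p)"
      using \<alpha> D by (simp add: ennreal_mult'[symmetric] K1_def mult_ac e)
    finally have I: "bergman_int p \<alpha> (deriv f) \<le> ennreal (K1 * (1 - b) powr - p)" .
    then have "bergman_int p \<alpha> (deriv f) < \<infinity>" using ennreal_less_top le_less_trans by fastforce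
    then have inD: "in_dirichlet p \<alpha> f" using hol hold by (simp add: in_dirichlet_def in_bergman_def)
    have "enn2real (bergman_int p \<alpha> (deriv f)) \<le> K1 * (1 - b) powr - p"
      using I K1 by (metis enn2real_leI mult_nonneg_nonneg powr_ge_zero)
    then have "bergman_norm p \<alpha> (deriv f) \<le> (K1 * (1 - b) powr - p) powr (1/p)"
      unfolding bergman_norm_def using p by (intro powr_mono2) auto
    also have "\<dots> = K1 powr (1/p) / (1 - b)"
    proof -
      have "((1 - b) powr - p) powr (1/p) = (1 - b) powr - 1" unfolding powr_powr using p by simp
      also have "\<dots> = 1 / (1 - b)" using b by (simp add: powr_minus_divide)
      finally show ?thesis by (simp only: powr_mult) simp
    qed
    finally have "dirichlet_norm p \<alpha> f \<le> 1 + K1 powr (1/p) / (1 - b)"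
      by (simp add: dirichlet_norm_def f_def)
    also have "\<dots> \<le> 1 / (1 - b) + K1 powr (1/p) / (1 - b)" using b by simp
    finally show ?thesis using inD unfolding f_def by (simp add: add_divide_distrib)
  qed
  show ?thesis by (rule that[of "1 + K1 powr (1/p)"]) (use main in blast)+
qed

text \<open>The exponent is a count of powers of \<open>1 - b\<close>. The derivative of the image
  at \<open>b\<close> is at least \<open>\<mu>([b, 1))\<close> times order
  \<open>c + \<beta> + 1\<close>, where \<open>c\<close> comes from the sum over \<open>k\<close>
  and \<open>\<beta> + 1\<close> from the sum over \<open>n\<close>. It is at most of order
  \<open>1 + (\<beta> + 1) / q\<close>, from the norm of the test function and the growth in the
  target space.\<close>

lemma necessity:
  assumes sets: "sets \<mu> = sets borel" and fin: "finite_measure (unit_part \<mu>)"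
    and q: "q > 1" and p: "p > 0" and \<alpha>: "\<alpha> > -1" and \<beta>: "\<beta> > 0"
    and bd: "H_bounded_DD \<mu> \<beta> p \<alpha> q (\<beta> - 1)"
  shows "carleson ((\<alpha> + 2) / p + (\<beta> + 1) / conj_exp q - 1) \<mu>"
proof -
  define c where "c = (\<alpha> + 2) / p"
  have c: "c > 0" using p \<alpha> by (simp add: c_def)
  define F where "F b z = (1 - of_real b * z) powr (- of_real c)" for b and z :: complex
  obtain K where inD: "\<And>b. 0 \<le> b \<Longrightarrow> b < 1 \<Longrightarrow> in_dirichlet p \<alpha> (F b)"
    and nD: "\<And>b. 0 \<le> b \<Longrightarrow> b < 1 \<Longrightarrow> dirichlet_norm p \<alpha> (F b) \<le> K / (1 - b)"
    using test_function[OF p \<alpha>] unfolding F_def c_def by blast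
  obtain C0 where bdC: "\<And>f. in_dirichlet p \<alpha> f \<Longrightarrow> H_defined \<mu> \<beta> f \<and> in_dirichlet q (\<beta> - 1) (H_op \<mu> \<beta> f) \<and>
        dirichlet_norm q (\<beta> - 1) (H_op \<mu> \<beta> f) \<le> C0 * dirichlet_norm p \<alpha> f"
    using bd unfolding H_bounded_DD_def by blast
  obtain K2 where K2: "K2 \<ge> 0" and gr: "\<And>g z. in_bergman q (\<beta> - 1) g \<Longrightarrow> norm z < 1 \<Longrightarrow>
     norm (g z) \<le> K2 * bergman_norm q (\<beta> - 1) g * (1 - norm z) powr - ((\<beta> - 1 + 2) / q)"
    using bergman_growth[of q "\<beta> - 1"] q \<beta> by auto
  interpret U: finite_measure "unit_part \<mu>" by (rule fin)
  have sp: "space (unit_part \<mu>) = {0..<1}" by (rule space_unit_part[OF sets])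
  have sp\<mu>: "space \<mu> = UNIV" using sets_eq_imp_space_eq[OF sets] by simp
  define s where "s = c + (\<beta> + 1) / conj_exp q - 1"
  have s: "s = c + \<beta> - (\<beta> + 1) / q"
    using q by (simp add: s_def conj_exp_def field_simps)
  define m where "m b = measure (unit_part \<mu>) {b..<1}" for b
  define K3 where "K3 = K2 * (\<bar>C0\<bar> * \<bar>K\<bar>) * 2 powr (c + \<beta> + 1) * 2 / \<beta>"
  have K3: "K3 \<ge> 0" using K2 \<beta> by (simp add: K3_def)
  \<comment> \<open>For \<open>b \<ge> 1/2\<close> the factor \<open>b\<close> produced by the index
    shift of the derivative stays away from 0. In \<open>K3\<close> the factor
    \<open>2 / \<beta>\<close> comes from there, and the power of 2 from
    \<open>1 - b * b \<le> 2 * (1 - b)\<close>.\<close>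
  have main: "m b \<le> K3 * (1 - b) powr s" if b: "1/2 \<le> b" "b < 1" for b
  proof -
    have b0: "b \<ge> 0" using b by simp
    have b2: "\<bar>b * b\<bar> < 1" using mult_strict_mono[of b 1 b 1] b by simp
    let ?f = "F b"
    define h where "h = H_op \<mu> \<beta> ?f"
    have Hd: "H_defined \<mu> \<beta> ?f" and hD: "in_dirichlet q (\<beta> - 1) h" and hn: "dirichlet_norm q (\<beta> - 1) h \<le> C0 * dirichlet_norm p \<alpha> ?f"
      using bdC[OF inD[OF b0 b(2)]] by (auto simp: h_def)
    have tc: "taylor_coeff ?f k = of_real (bin_coeff c k * b ^ k)" for k
    proof (rule taylor_coeff_eqI)
      fix z :: complex assume z: "norm z < 1"
      have "norm (of_real b * z) < 1" using mult_strict_mono[of b 1 "norm z" 1] b z b0 by (simp add: norm_mult)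
      from bin_coeff_sums[OF this, of c]
      show "(\<lambda>n. of_real (bin_coeff c n * b ^ n) * z ^ n) sums F b z"
        by (simp add: F_def power_mult_distrib mult_ac)
    qed
    \<comment> \<open>Only the mass on \<open>[b, 1)\<close> is kept. Nothing cancels afterwards,
      since every other factor in the coefficients of the image is nonnegative.\<close>
    have moment: "b ^ j * m b \<le> (\<integral>t. t ^ j \<partial>unit_part \<mu>)" for j
    proof -
      have bs: "{b..<1} \<in> sets (unit_part \<mu>)"
        using b0 by (subst sets_restrict_space_iff) (auto simp: sets sp\<mu>)
      have "b ^ j * m b = (\<integral>t. b ^ j * indicator {b..<1} t \<partial>unit_part \<mu>)"
        using bs by (simp add: m_def)
      also have "\<dots> \<le> (\<integral>t. t ^ j \<partial>unit_part \<mu>)"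
      proof (rule integral_mono)
        show "integrable (unit_part \<mu>) (\<lambda>t. b ^ j * indicator {b..<1} t)"
          using bs U.emeasure_finite by (intro integrable_mult_right integrable_real_indicator) (auto simp: less_top[symmetric])
        show "integrable (unit_part \<mu>) (\<lambda>t. t ^ j)" by (rule integrable_power_unit_part[OF sets fin])
        show "b ^ j * indicator {b..<1} t \<le> t ^ j" if "t \<in> space (unit_part \<mu>)" for t
          using that b0 by (auto simp: sp indicator_def intro: power_mono)
      qed
      finally show ?thesis .
    qed
    have m0: "m b \<ge> 0" by (simp add: m_def)
    define R where "R = (1 - b * b) powr - c"
    have R: "(\<lambda>k. bin_coeff c k * (b * b) ^ k) sums R" unfolding R_def by (rule bin_coeff_sums_real[OF b2])
    define hc where "hc n = (\<Sum>k. mu_coeff \<mu> \<beta> n k * (bin_coeff c k * b ^ k))" for n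
    have sm: "summable (\<lambda>k. mu_coeff \<mu> \<beta> n k * (bin_coeff c k * b ^ k))" for n
    proof -
      have "summable (\<lambda>k. complex_of_real (mu_coeff \<mu> \<beta> n k) * taylor_coeff ?f k)"
        using Hd by (simp add: H_defined_def)
      then have "summable (\<lambda>k. complex_of_real (mu_coeff \<mu> \<beta> n k * (bin_coeff c k * b ^ k)))"
        by (simp add: tc)
      then show ?thesis by (simp only: summable_complex_of_real)
    qed
    have Hc: "H_coeff \<mu> \<beta> ?f n = of_real (hc n)" for n
    proof -
      have "H_coeff \<mu> \<beta> ?f n = (\<Sum>k. complex_of_real (mu_coeff \<mu> \<beta> n k * (bin_coeff c k * b ^ k)))"
        by (simp add: H_coeff_def tc)
      then show ?thesis unfolding hc_def using sm by (simp only: suminf_of_real)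
    qed
    \<comment> \<open>With the moment replaced by \<open>b ^ (n + k) * m b\<close>, the sum over
      \<open>k\<close> becomes a binomial series at \<open>b * b\<close> with value
      \<open>R\<close>.\<close>
    have hc_ge: "bin_coeff \<beta> n * b ^ n * m b * R \<le> hc n" for n
    proof -
      have "bin_coeff \<beta> n * b ^ n * m b * R = (\<Sum>k. (bin_coeff \<beta> n * b ^ n * m b) * (bin_coeff c k * (b * b) ^ k))"
        using R by (simp add: sums_iff suminf_mult)
      also have "\<dots> \<le> hc n" unfolding hc_def
      proof (rule suminf_le)
        fix k
        have "(bin_coeff \<beta> n * b ^ n * m b) * (bin_coeff c k * (b * b) ^ k) = (bin_coeff \<beta> n * (b ^ (n + k) * m b)) * (bin_coeff c k * b ^ k)"
          by (simp add: power_add power_mult_distrib mult_ac)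
        also have "\<dots> \<le> mu_coeff \<mu> \<beta> n k * (bin_coeff c k * b ^ k)"
          unfolding mu_coeff_eq[OF sets \<beta>] using \<beta> c b0
          by (intro mult_right_mono mult_left_mono moment) (auto intro!: bin_coeff_nonneg mult_nonneg_nonneg)
        finally show "(bin_coeff \<beta> n * b ^ n * m b) * (bin_coeff c k * (b * b) ^ k) \<le> mu_coeff \<mu> \<beta> n k * (bin_coeff c k * b ^ k)" .
      qed (use R sm in \<open>auto simp: sums_iff intro!: summable_mult\<close>)
      finally show ?thesis .
    qed
    have sumH: "summable (\<lambda>n. H_coeff \<mu> \<beta> ?f n * z ^ n)" if "norm z < 1" for z
      using Hd that by (simp add: H_defined_def)
    have nb: "norm (complex_of_real b) < 1" using b by simp
    have "(h has_field_derivative (\<Sum>n. diffs (H_coeff \<mu> \<beta> ?f) n * of_real b ^ n)) (at (of_real b))"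
      unfolding h_def H_op_def by (rule termdiffs_strong'[OF sumH nb])
    then have dh: "deriv h (of_real b) = (\<Sum>n. diffs (H_coeff \<mu> \<beta> ?f) n * of_real b ^ n)" by (rule DERIV_imp_deriv)
    have "summable (\<lambda>n. diffs (H_coeff \<mu> \<beta> ?f) n * of_real b ^ n)"
      by (rule termdiff_converges[OF nb sumH])
    then have "summable (\<lambda>n. complex_of_real (real (Suc n) * hc (Suc n) * b ^ n))"
      by (simp add: diffs_def Hc)
    then have smd: "summable (\<lambda>n. real (Suc n) * hc (Suc n) * b ^ n)" by (simp only: summable_complex_of_real)
    have dh2: "deriv h (of_real b) = of_real (\<Sum>n. real (Suc n) * hc (Suc n) * b ^ n)"
    proof -
      have "deriv h (of_real b) = (\<Sum>n. complex_of_real (real (Suc n) * hc (Suc n) * b ^ n))"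
        unfolding dh by (simp add: diffs_def Hc)
      then show ?thesis using suminf_of_real[OF smd] by metis
    qed
    have R2: "(\<lambda>n. bin_coeff (\<beta> + 1) n * (b * b) ^ n) sums ((1 - b * b) powr - (\<beta> + 1))"
      by (rule bin_coeff_sums_real[OF b2])
    have "m b * R * b * \<beta> * (1 - b * b) powr - (\<beta> + 1) = (\<Sum>n. (m b * R * b * \<beta>) * (bin_coeff (\<beta> + 1) n * (b * b) ^ n))"
      using R2 by (simp add: sums_iff suminf_mult)
    also have "\<dots> \<le> (\<Sum>n. real (Suc n) * hc (Suc n) * b ^ n)"
    proof (rule suminf_le)
      fix n
      have "(m b * R * b * \<beta>) * (bin_coeff (\<beta> + 1) n * (b * b) ^ n)
        = (\<beta> * bin_coeff (\<beta> + 1) n) * (b ^ Suc n * m b * R) * b ^ n"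
        by (simp add: power_mult_distrib mult_ac)
      also have "\<dots> = real (Suc n) * (bin_coeff \<beta> (Suc n) * b ^ Suc n * m b * R) * b ^ n"
        unfolding bin_coeff_Suc[symmetric] by (simp only: mult_ac)
      also have "\<dots> \<le> real (Suc n) * hc (Suc n) * b ^ n"
        using b0 by (intro mult_right_mono mult_left_mono hc_ge) auto
      finally show "(m b * R * b * \<beta>) * (bin_coeff (\<beta> + 1) n * (b * b) ^ n) \<le> real (Suc n) * hc (Suc n) * b ^ n" .
    qed (use R2 smd in \<open>auto simp: sums_iff intro!: summable_mult\<close>)
    also have "\<dots> \<le> norm (deriv h (of_real b))" unfolding dh2 by simp
    also have "\<dots> \<le> K2 * bergman_norm q (\<beta> - 1) (deriv h) * (1 - b) powr - ((\<beta> + 1) / q)"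
    proof -
      have "in_bergman q (\<beta> - 1) (deriv h)" using hD by (simp add: in_dirichlet_def)
      from gr[OF this nb] show ?thesis using b0 by (simp add: add.commute)
    qed
    also have "\<dots> \<le> K2 * (\<bar>C0\<bar> * \<bar>K\<bar> / (1 - b)) * (1 - b) powr - ((\<beta> + 1) / q)"
    proof (intro mult_right_mono mult_left_mono K2)
      have "bergman_norm q (\<beta> - 1) (deriv h) \<le> dirichlet_norm q (\<beta> - 1) h" by (simp add: dirichlet_norm_def)
      also have "\<dots> \<le> C0 * dirichlet_norm p \<alpha> ?f" by (rule hn)
      also have "\<dots> \<le> \<bar>C0\<bar> * dirichlet_norm p \<alpha> ?f" by (intro mult_right_mono dirichlet_norm_nonneg) simp
      also have "\<dots> \<le> \<bar>C0\<bar> * (\<bar>K\<bar> / (1 - b))"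
      proof (intro mult_left_mono)
        have "dirichlet_norm p \<alpha> ?f \<le> K / (1 - b)" by (rule nD[OF b0 b(2)])
        also have "\<dots> \<le> \<bar>K\<bar> / (1 - b)" using b by (intro divide_right_mono) auto
        finally show "dirichlet_norm p \<alpha> ?f \<le> \<bar>K\<bar> / (1 - b)" .
      qed simp
      finally show "bergman_norm q (\<beta> - 1) (deriv h) \<le> \<bar>C0\<bar> * \<bar>K\<bar> / (1 - b)" by simp
    qed simp
    finally have i1: "m b * R * b * \<beta> * (1 - b * b) powr - (\<beta> + 1) \<le> K2 * (\<bar>C0\<bar> * \<bar>K\<bar> / (1 - b)) * (1 - b) powr - ((\<beta> + 1) / q)" .
    then have ineq: "m b * R * b * \<beta> * (1 - b * b) powr - (\<beta> + 1) \<le> K2 * (\<bar>C0\<bar> * \<bar>K\<bar>) * (1 - b) powr (- 1 - (\<beta> + 1) / q)"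
    proof -
      have "(1 - b) powr (- 1 - (\<beta> + 1) / q) = (1 - b) powr - 1 * (1 - b) powr - ((\<beta> + 1) / q)"
        unfolding powr_add[symmetric] by simp
      also have "(1 - b) powr - 1 = 1 / (1 - b)" using b by (simp add: powr_minus_divide)
      finally show ?thesis using i1 by (simp add: mult_ac)
    qed
    have le2: "1 - b * b \<le> 2 * (1 - b)"
    proof -
      have "1 - b * b = (1 - b) * (1 + b)" by (simp add: algebra_simps)
      also have "\<dots> \<le> (1 - b) * 2" using b by (intro mult_left_mono) auto
      finally show ?thesis by simp
    qed
    have "(2 * (1 - b)) powr - (c + \<beta> + 1) \<le> (1 - b * b) powr - (c + \<beta> + 1)"
      using le2 b2 c \<beta> by (intro powr_mono2') auto
    also have "\<dots> = R * (1 - b * b) powr - (\<beta> + 1)" by (simp add: R_def powr_add[symmetric] algebra_simps)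
    finally have RR: "(2 * (1 - b)) powr - (c + \<beta> + 1) \<le> R * (1 - b * b) powr - (\<beta> + 1)" .
    have "m b * ((2 * (1 - b)) powr - (c + \<beta> + 1) * (\<beta> / 2)) \<le> m b * ((R * (1 - b * b) powr - (\<beta> + 1)) * (b * \<beta>))"
      using RR b \<beta> m0 by (intro mult_left_mono mult_mono) (auto simp: R_def)
    also have "\<dots> \<le> K2 * (\<bar>C0\<bar> * \<bar>K\<bar>) * (1 - b) powr (- 1 - (\<beta> + 1) / q)" using ineq by (simp add: mult_ac)
    finally have i2: "m b * ((2 * (1 - b)) powr - (c + \<beta> + 1) * (\<beta> / 2)) \<le> K2 * (\<bar>C0\<bar> * \<bar>K\<bar>) * (1 - b) powr (- 1 - (\<beta> + 1) / q)" .
    define w where "w = (2 * (1 - b)) powr (c + \<beta> + 1) * (2 / \<beta>)"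
    have w0: "w \<ge> 0" using \<beta> by (simp add: w_def)
    have "(2 * (1 - b)) powr - (c + \<beta> + 1) * (2 * (1 - b)) powr (c + \<beta> + 1) = 1"
      using b by (subst powr_add[symmetric]) simp
    then have "m b = m b * ((2 * (1 - b)) powr - (c + \<beta> + 1) * (\<beta> / 2)) * w"
      using \<beta> by (simp add: w_def)
    also have "\<dots> \<le> K2 * (\<bar>C0\<bar> * \<bar>K\<bar>) * (1 - b) powr (- 1 - (\<beta> + 1) / q) * w"
      using i2 w0 by (rule mult_right_mono)
    also have "\<dots> = K3 * ((1 - b) powr (- 1 - (\<beta> + 1) / q) * (1 - b) powr (c + \<beta> + 1))"
      unfolding w_def K3_def powr_mult by simp
    also have "(1 - b) powr (- 1 - (\<beta> + 1) / q) * (1 - b) powr (c + \<beta> + 1) = (1 - b) powr s"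
      by (simp add: powr_add[symmetric] s)
    finally show ?thesis .
  qed
  \<comment> \<open>For \<open>t < 1/2\<close> the total mass is a sufficient bound; the power of 2
    compensates \<open>(1 - t) powr s\<close> whatever the sign of \<open>s\<close>.\<close>
  define K4 where "K4 = measure (unit_part \<mu>) {0..<1} * 2 powr \<bar>s\<bar>"
  have em: "emeasure \<mu> {t..<1} = ennreal (m t)" if t: "0 \<le> t" for t
  proof -
    have "emeasure \<mu> {t..<1} = emeasure (unit_part \<mu>) {t..<1}"
      by (rule emeasure_restrict_space[symmetric]) (use t in \<open>auto simp: sets sp\<mu>\<close>)
    then show ?thesis by (simp add: m_def U.emeasure_eq_measure)
  qed
  have "carleson s \<mu>" unfolding carleson_def
  proof (intro exI[of _ "K3 + K4"] allI impI)
    fix t :: real assume t: "0 \<le> t \<and> t < 1"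
    have "m t \<le> (K3 + K4) * (1 - t) powr s"
    proof (cases "t \<ge> 1/2")
      case True
      then have "m t \<le> K3 * (1 - t) powr s" using main t by blast
      also have "\<dots> \<le> (K3 + K4) * (1 - t) powr s" by (intro mult_right_mono) (auto simp: K4_def)
      finally show ?thesis .
    next
      case False
      have "m t \<le> measure (unit_part \<mu>) {0..<1}" unfolding m_def
      proof (rule U.finite_measure_mono)
        show "{0..<1} \<in> sets (unit_part \<mu>)" using sets.top[of "unit_part \<mu>"] by (simp only: sp)
      qed (use t in auto)
      also have "\<dots> \<le> K4 * (1 - t) powr s"
      proof -
        have "(1 / (1 - t)) powr s \<le> 2 powr \<bar>s\<bar>" using t False by (intro powr_le_powr_abs) (auto simp: field_simps)
        then have "1 \<le> 2 powr \<bar>s\<bar> * (1 - t) powr s" using t by (simp add: powr_divide field_simps)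
        then show ?thesis unfolding K4_def mult.assoc
          using mult_left_mono[of 1 _ "measure (unit_part \<mu>) {0..<1}"] by simp
      qed
      also have "\<dots> \<le> (K3 + K4) * (1 - t) powr s" using K3 by (intro mult_right_mono) auto
      finally show ?thesis .
    qed
    then show "emeasure \<mu> {t..<1} \<le> ennreal ((K3 + K4) * (1 - t) powr s)" using em t by (simp add: ennreal_leI)
  qed
  then show ?thesis by (simp add: s_def c_def)
qed

section \<open>Sufficiency\<close>

text \<open>The part \<open>[-1, 0)\<close> has length 1 and is meant to carry the constant value
  \<open>|f(0)|\<close>. Then \<open>|f(0)|\<close> plus the integral of \<open>|f'|\<close> up to
  \<open>t\<close> is one integral over \<open>u \<le> t\<close>, and the Schur test treats both
  terms together.\<close>

abbreviation seg :: "real measure" where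
  "seg \<equiv> restrict_space lborel {-1..<1}"

lemma decay_seg: "decay seg (\<lambda>u. 1 - u) 1 1"
  unfolding decay_def
proof (intro conjI ballI allI impI)
  show "(\<lambda>u. 1 - u) \<in> borel_measurable seg" by (rule measurable_restrict_space1) simp
  fix r :: real assume r: "r > 0"
  have eq: "{u \<in> space seg. 1 - u \<le> r} = {max (-1) (1 - r)..<1}"
    by (auto simp: space_restrict_space)
  show "emeasure seg {u \<in> space seg. 1 - u \<le> r} \<le> ennreal (1 * r powr 1)"
    unfolding eq using r by (subst emeasure_restrict_space) (auto intro: ennreal_leI)
qed (auto simp: space_restrict_space)

lemma finite_measure_seg: "finite_measure seg"
  by (rule finite_measureI) (auto simp: space_restrict_space emeasure_restrict_space)

text \<open>Schur test with weight \<open>(1 - u) powr - (\<sigma> + 1)\<close>, an exponent for which all the integrals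
  over \<open>u\<close>, \<open>t\<close> and \<open>z\<close> are within the range of the decay estimates.\<close>

lemma schur_estimate:
  fixes \<sigma> q B :: real
  assumes q: "q > 1" and \<sigma>: "\<sigma> > 0" and B: "B > 1"
    and sets: "sets \<mu> = sets borel" and carl: "carleson (\<sigma> + B * (q - 1) / q) \<mu>"
  obtains K where "K \<ge> 0" "\<And>\<phi> X. \<phi> \<in> borel_measurable borel \<Longrightarrow> (\<And>u. \<phi> u \<ge> 0) \<Longrightarrow>
     (\<And>z. norm z < 1 \<Longrightarrow> X z \<ge> 0 \<and> ennreal (X z) \<le> (\<integral>\<^sup>+t. ennreal ((1 - t + norm (1 - z)) powr - B) *
         (\<integral>\<^sup>+u. ennreal (\<phi> u) * (if u \<le> t then 1 else 0) \<partial>seg) \<partial>unit_part \<mu>)) \<Longrightarrow>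
     (\<integral>\<^sup>+z. ennreal (X z powr q) \<partial>wdisc (B - 2)) \<le>
       ennreal K * (\<integral>\<^sup>+u. ennreal (\<phi> u powr q * (1 - u) powr ((\<sigma> + 1) * q - 1)) \<partial>seg)"
proof -
  \<comment> \<open>\<open>\<tau>\<close> is \<open>B / q'\<close>, the part of the Carleson
    exponent beyond \<open>\<sigma>\<close>. The inequalities \<open>0 < \<tau> < B\<close> are what
    the integrals over \<open>t\<close> and \<open>z\<close> need.\<close>
  define \<tau> where "\<tau> = B * (q - 1) / q"
  define s where "s = \<sigma> + \<tau>"
  have \<tau>: "\<tau> > 0" using q B by (simp add: \<tau>_def)
  have \<tau>B: "\<tau> - B = - (B / q)" using q by (simp add: \<tau>_def field_simps)
  have \<tau>lt: "\<tau> < B" using \<tau>B q B by (smt (verit) divide_pos_pos)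
  have Jexp: "- (B / q) * (q - 1) = - \<tau>" by (simp add: \<tau>_def)
  let ?M = "unit_part \<mu>" and ?W = "wdisc (B - 2)"
  obtain C where dM: "decay ?M (\<lambda>t. 1 - t) C s"
    using decay_unit_part[OF sets carl] \<sigma> \<tau> by (auto simp: s_def \<tau>_def)
  obtain C' where dW: "decay ?W (\<lambda>z. norm (1 - z)) C' B"
    using wdisc_decay[of "B - 2"] B by auto
  have C: "C \<ge> 0" using dM by (simp add: decay_def)
  interpret M: finite_measure ?M by (rule finite_unit_part[OF sets carl])
  interpret W: finite_measure ?W by (rule finite_measure_wdisc) (use B in simp)
  interpret L: finite_measure seg by (rule finite_measure_seg)
  interpret LM: pair_sigma_finite seg ?M by standard
  interpret LW: pair_sigma_finite seg ?W by standard
  interpret MW: pair_sigma_finite ?M ?W by standard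
  have [measurable]: "(\<lambda>t. t) \<in> borel_measurable ?M"
    by (intro measurable_unit_part[OF sets] continuous_intros)
  have [measurable]: "(\<lambda>z. norm (1 - z)) \<in> borel_measurable ?W" using dW by (simp add: decay_def)
  have [measurable]: "(\<lambda>u. u) \<in> borel_measurable seg" by (rule measurable_restrict_space1) simp
  define k where "k t z = (1 - t + norm (1 - z)) powr - B" for t and z :: complex
  define i where "i u t = (if u \<le> t then 1 else 0 :: ennreal)" for u t :: real
  define D1 where "D1 = 2 powr \<bar>\<sigma> + 1\<bar> * 2 powr (1 - (\<sigma> + 1)) / (1 - 2 powr (1 - (\<sigma> + 1)))"
  have "(2::real) powr - \<sigma> < 2 powr 0" using \<sigma> by (intro powr_less_mono) auto
  then have D1: "D1 \<ge> 0" by (simp add: D1_def)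
  have int_u: "(\<integral>\<^sup>+u. ennreal ((1 - u) powr - (\<sigma> + 1)) * i u t \<partial>seg) \<le> ennreal (D1 * (1 - t) powr - \<sigma>)" if "t < 1" for t
  proof -
    have "(\<integral>\<^sup>+u. ennreal ((1 - u) powr - (\<sigma> + 1)) * indicator {u. 1 - t \<le> 1 - u} u \<partial>seg)
       \<le> ennreal (1 * D1 * (1 - t) powr (1 - (\<sigma> + 1)))"
      unfolding D1_def by (rule decay_integral_ge[OF decay_seg]) (use that \<sigma> in auto)
    moreover have "indicator {u. 1 - t \<le> 1 - u} u = i u t" for u by (simp add: i_def indicator_def)
    ultimately show ?thesis by simp
  qed
  \<comment> \<open>Here the two conditions of \<open>decay_kernel\<close> say
    \<open>\<sigma> < s\<close>, that is \<open>\<tau> > 0\<close>, and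
    \<open>s < \<sigma> + B\<close>, that is \<open>\<tau> < B\<close>.\<close>
  obtain D2 where D2: "D2 \<ge> 0" and kM: "\<And>\<delta>. \<delta> > 0 \<Longrightarrow>
    (\<integral>\<^sup>+t. ennreal ((1 - t) powr - \<sigma> * (\<delta> + (1 - t)) powr - B) \<partial>?M) \<le> ennreal (D2 * \<delta> powr (s - \<sigma> - B))"
    using decay_kernel[OF dM, of \<sigma> B] \<tau> \<tau>lt B by (auto simp: s_def)
  obtain D3 where D3: "D3 \<ge> 0" and kW: "\<And>\<delta>. \<delta> > 0 \<Longrightarrow>
    (\<integral>\<^sup>+z. ennreal (norm (1 - z) powr - \<tau> * (\<delta> + norm (1 - z)) powr - B) \<partial>?W) \<le> ennreal (D3 * \<delta> powr (B - \<tau> - B))"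
    using decay_kernel[OF dW, of \<tau> B] \<tau> \<tau>lt B by auto
  define D4 where "D4 = C * (2 powr \<bar>\<tau>\<bar> / (1 - (1/2) powr (s - \<tau>)))"
  have "(1/2::real) powr \<sigma> < (1/2) powr 0" using \<sigma> by (intro powr_less_mono') auto
  then have D4: "D4 \<ge> 0" using C by (simp add: D4_def s_def)
  \<comment> \<open>This integral over \<open>t \<ge> u\<close> converges because
    \<open>\<tau> < s\<close>, which is \<open>\<sigma> > 0\<close>.\<close>
  have int_t: "(\<integral>\<^sup>+t. ennreal ((1 - t) powr - \<tau>) * i u t \<partial>?M) \<le> ennreal (D4 * (1 - u) powr \<sigma>)" if "u < 1" for u
  proof -
    have "(\<integral>\<^sup>+t. ennreal ((1 - t) powr - \<tau>) * indicator {t. 1 - t \<le> 1 - u} t \<partial>?M)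
       \<le> ennreal (D4 * (1 - u) powr (s - \<tau>))"
      unfolding D4_def by (rule decay_integral_le[OF dM]) (use that \<sigma> in \<open>auto simp: s_def\<close>)
    moreover have "indicator {t. 1 - t \<le> 1 - u} t = i u t" for t by (simp add: i_def indicator_def)
    ultimately show ?thesis by (simp add: s_def)
  qed
  define J where "J = D1 * D2"
  have J: "J \<ge> 0" using D1 D2 by (simp add: J_def)
  define K where "K = J powr (q - 1) * (D3 * D4)"
  have K: "K \<ge> 0" using D3 D4 by (simp add: K_def)
  have [measurable]: "(\<lambda>x. i (f x) (g x)) \<in> borel_measurable N"
    if [measurable]: "f \<in> borel_measurable N" "g \<in> borel_measurable N" for f g and N :: "'x measure"
    unfolding i_def by measurable
  show ?thesis
  proof (rule that[OF K])
    fix \<phi> :: "real \<Rightarrow> real" and X :: "complex \<Rightarrow> real"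
    assume \<phi>m: "\<phi> \<in> borel_measurable borel" and \<phi>0: "\<And>u. \<phi> u \<ge> 0"
      and X: "\<And>z. norm z < 1 \<Longrightarrow> X z \<ge> 0 \<and> ennreal (X z) \<le> (\<integral>\<^sup>+t. ennreal ((1 - t + norm (1 - z)) powr - B) *
         (\<integral>\<^sup>+u. ennreal (\<phi> u) * (if u \<le> t then 1 else 0) \<partial>seg) \<partial>?M)"
    have [measurable]: "\<phi> \<in> borel_measurable seg"
      by (rule measurable_restrict_space1) (use \<phi>m in simp)
    define \<psi> where "\<psi> u = \<phi> u powr q * (1 - u) powr ((\<sigma> + 1) * (q - 1))" for u
    have [measurable]: "\<psi> \<in> borel_measurable seg" unfolding \<psi>_def by measurable
    \<comment> \<open>The kernel of the operator in the variables \<open>z\<close> and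
      \<open>u\<close>, with \<open>t\<close> integrated out. Hoelder's inequality is applied for
      the measure with density \<open>Kz z\<close>.\<close>
    define Kz where "Kz z u = (\<integral>\<^sup>+t. ennreal (k t z) * i u t \<partial>?M)" for z u
    have Kzm: "Kz z \<in> borel_measurable seg" for z
      unfolding Kz_def k_def by (rule M.borel_measurable_nn_integral) measurable
    have Kzm2 [measurable]: "(\<lambda>(u, z). Kz z u) \<in> borel_measurable (seg \<Otimes>\<^sub>M ?W)"
      unfolding Kz_def k_def by measurable
    have pt: "ennreal (X z powr q) \<le> ennreal (J powr (q - 1)) * (ennreal (norm (1 - z) powr - \<tau>) *
        (\<integral>\<^sup>+u. ennreal (\<psi> u) * Kz z u \<partial>seg))" if z: "norm z < 1" for z
    proof -
      have hz: "norm (1 - z) > 0" using z by auto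
      have [measurable]: "(\<lambda>t. k t z) \<in> borel_measurable ?M" unfolding k_def by measurable
      note [measurable] = Kzm[of z]
      have swap: "(\<integral>\<^sup>+u. ennreal (g u) * Kz z u \<partial>seg) = (\<integral>\<^sup>+t. ennreal (k t z) * (\<integral>\<^sup>+u. ennreal (g u) * i u t \<partial>seg) \<partial>?M)"
        if [measurable]: "g \<in> borel_measurable seg" for g
      proof -
        have "(\<integral>\<^sup>+u. ennreal (g u) * Kz z u \<partial>seg) = (\<integral>\<^sup>+u. (\<integral>\<^sup>+t. ennreal (g u) * (ennreal (k t z) * i u t) \<partial>?M) \<partial>seg)"
          unfolding Kz_def by (intro nn_integral_cong nn_integral_cmult[symmetric]) measurable
        also have "\<dots> = (\<integral>\<^sup>+t. (\<integral>\<^sup>+u. ennreal (g u) * (ennreal (k t z) * i u t) \<partial>seg) \<partial>?M)"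
          by (rule LM.Fubini'[symmetric]) measurable
        also have "\<dots> = (\<integral>\<^sup>+t. (\<integral>\<^sup>+u. ennreal (k t z) * (ennreal (g u) * i u t) \<partial>seg) \<partial>?M)"
          by (simp add: mult_ac)
        also have "\<dots> = (\<integral>\<^sup>+t. ennreal (k t z) * (\<integral>\<^sup>+u. ennreal (g u) * i u t \<partial>seg) \<partial>?M)"
          by (intro nn_integral_cong nn_integral_cmult) measurable
        finally show ?thesis .
      qed
      define N where "N = density seg (Kz z)"
      have sN [measurable_cong]: "sets N = sets seg" by (simp add: N_def)
      have spN: "space N = {-1..<1}" by (simp add: N_def space_restrict_space)
      \<comment> \<open>\<open>v\<close> is the Schur weight: its \<open>q'\<close>-th power is
        \<open>(1 - u) powr - (\<sigma> + 1)\<close>, and \<open>w\<close> is \<open>\<phi>\<close>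
        divided by \<open>v\<close>.\<close>
      define v where "v u = (1 - u) powr - ((\<sigma> + 1) * (q - 1) / q)" for u :: real
      define w where "w u = \<phi> u * (1 - u) powr ((\<sigma> + 1) * (q - 1) / q)" for u :: real
      have [measurable]: "v \<in> borel_measurable seg" "w \<in> borel_measurable seg"
        unfolding v_def w_def by measurable
      have intN: "(\<integral>\<^sup>+u. g u \<partial>N) = (\<integral>\<^sup>+u. g u * Kz z u \<partial>seg)" if "g \<in> borel_measurable seg" for g
        unfolding N_def by (subst nn_integral_density) (use that Kzm in \<open>auto simp: mult.commute\<close>)
      have "ennreal (X z powr q) \<le> ennreal ((J * norm (1 - z) powr - (B / q)) powr (q - 1)) * (\<integral>\<^sup>+u. ennreal (w u powr q) \<partial>N)"
      proof (rule nn_integral_Holder[OF _ _ _ _ q])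
        show "w \<in> borel_measurable N" "v \<in> borel_measurable N" by measurable
        show "w u \<ge> 0" "v u \<ge> 0" for u using \<phi>0 by (auto simp: w_def v_def)
        show "J * norm (1 - z) powr - (B / q) \<ge> 0" using J by simp
        have "v u powr (q / (q - 1)) = (1 - u) powr - (\<sigma> + 1)" for u
          using q by (simp add: v_def powr_powr)
        then have "(\<integral>\<^sup>+u. ennreal (v u powr (q / (q - 1))) \<partial>N) = (\<integral>\<^sup>+u. ennreal ((1 - u) powr - (\<sigma> + 1)) * Kz z u \<partial>seg)"
          by (subst intN) (simp_all only:, measurable)
        also have "\<dots> = (\<integral>\<^sup>+t. ennreal (k t z) * (\<integral>\<^sup>+u. ennreal ((1 - u) powr - (\<sigma> + 1)) * i u t \<partial>seg) \<partial>?M)"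
          by (rule swap) measurable
        also have "\<dots> \<le> (\<integral>\<^sup>+t. ennreal (k t z) * ennreal (D1 * (1 - t) powr - \<sigma>) \<partial>?M)"
          by (intro nn_integral_mono mult_left_mono int_u) (auto simp: space_restrict_space)
        also have "\<dots> = (\<integral>\<^sup>+t. ennreal D1 * ennreal ((1 - t) powr - \<sigma> * (norm (1 - z) + (1 - t)) powr - B) \<partial>?M)"
          using D1 by (intro nn_integral_cong) (simp add: ennreal_mult'[symmetric] k_def mult_ac add_ac)
        also have "\<dots> = ennreal D1 * (\<integral>\<^sup>+t. ennreal ((1 - t) powr - \<sigma> * (norm (1 - z) + (1 - t)) powr - B) \<partial>?M)"
          by (rule nn_integral_cmult) measurable
        also have "\<dots> \<le> ennreal D1 * ennreal (D2 * norm (1 - z) powr (s - \<sigma> - B))"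
          by (intro mult_left_mono kM hz) simp
        also have "\<dots> = ennreal (J * norm (1 - z) powr - (B / q))"
          using D1 D2 \<tau>B by (simp add: ennreal_mult'[symmetric] J_def s_def mult_ac)
        finally show "(\<integral>\<^sup>+u. ennreal (v u powr (q / (q - 1))) \<partial>N) \<le> ennreal (J * norm (1 - z) powr - (B / q))" .
        show "X z \<ge> 0" using X[OF z] by simp
        have "ennreal (X z) \<le> (\<integral>\<^sup>+t. ennreal (k t z) * (\<integral>\<^sup>+u. ennreal (\<phi> u) * i u t \<partial>seg) \<partial>?M)"
          using X[OF z] by (simp add: k_def i_def)
        also have "\<dots> = (\<integral>\<^sup>+u. ennreal (\<phi> u) * Kz z u \<partial>seg)" by (rule swap[symmetric]) measurable
        also have "\<dots> = (\<integral>\<^sup>+u. ennreal (\<phi> u) \<partial>N)" by (rule intN[symmetric]) measurable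
        also have "\<dots> = (\<integral>\<^sup>+u. ennreal (w u * v u) \<partial>N)"
        proof (intro nn_integral_cong)
          fix u assume "u \<in> space N"
          then have "(1 - u) powr ((\<sigma> + 1) * (q - 1) / q) * (1 - u) powr - ((\<sigma> + 1) * (q - 1) / q) = 1"
            by (subst powr_add[symmetric]) (simp add: spN)
          then have "w u * v u = \<phi> u" by (simp add: w_def v_def mult.assoc)
          then show "ennreal (\<phi> u) = ennreal (w u * v u)" by simp
        qed
        finally show "ennreal (X z) \<le> (\<integral>\<^sup>+u. ennreal (w u * v u) \<partial>N)" .
      qed
      \<comment> \<open>The weight integral has order \<open>|1 - z| powr - (B / q)\<close>, and its
        power \<open>q - 1\<close> has exponent \<open>- \<tau>\<close>. Integration over
        \<open>z\<close> turns this into \<open>(1 - t) powr - \<tau>\<close>, which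
        \<open>int_t\<close> can handle.\<close>
      also have "(J * norm (1 - z) powr - (B / q)) powr (q - 1) = J powr (q - 1) * norm (1 - z) powr - \<tau>"
        unfolding powr_mult powr_powr Jexp ..
      also have "(\<integral>\<^sup>+u. ennreal (w u powr q) \<partial>N) = (\<integral>\<^sup>+u. ennreal (w u powr q) * Kz z u \<partial>seg)"
        by (rule intN) measurable
      also have "(\<lambda>u. ennreal (w u powr q)) = (\<lambda>u. ennreal (\<psi> u))"
        using q by (simp add: w_def \<psi>_def powr_mult powr_powr)
      finally show ?thesis by (simp add: ennreal_mult mult.assoc)
    qed
    have "(\<integral>\<^sup>+z. ennreal (X z powr q) \<partial>?W) \<le> (\<integral>\<^sup>+z. ennreal (J powr (q - 1)) * (ennreal (norm (1 - z) powr - \<tau>) *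
        (\<integral>\<^sup>+u. ennreal (\<psi> u) * Kz z u \<partial>seg)) \<partial>?W)"
      by (intro nn_integral_mono pt) simp
    also have "\<dots> = ennreal (J powr (q - 1)) * (\<integral>\<^sup>+z. ennreal (norm (1 - z) powr - \<tau>) *
        (\<integral>\<^sup>+u. ennreal (\<psi> u) * Kz z u \<partial>seg) \<partial>?W)"
    proof (rule nn_integral_cmult)
      have "(\<lambda>(z, u). Kz z u) \<in> borel_measurable (?W \<Otimes>\<^sub>M seg)" unfolding Kz_def k_def by measurable
      then have [measurable]: "(\<lambda>z. \<integral>\<^sup>+u. ennreal (\<psi> u) * Kz z u \<partial>seg) \<in> borel_measurable ?W"
        by (intro L.borel_measurable_nn_integral) measurable
      show "(\<lambda>z. ennreal (norm (1 - z) powr - \<tau>) * (\<integral>\<^sup>+u. ennreal (\<psi> u) * Kz z u \<partial>seg)) \<in> borel_measurable ?W"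
        by measurable
    qed
    also have "(\<integral>\<^sup>+z. ennreal (norm (1 - z) powr - \<tau>) * (\<integral>\<^sup>+u. ennreal (\<psi> u) * Kz z u \<partial>seg) \<partial>?W)
      = (\<integral>\<^sup>+z. (\<integral>\<^sup>+u. ennreal (\<psi> u) * (ennreal (norm (1 - z) powr - \<tau>) * Kz z u) \<partial>seg) \<partial>?W)"
    proof (intro nn_integral_cong)
      fix z
      note [measurable] = Kzm[of z]
      show "ennreal (norm (1 - z) powr - \<tau>) * (\<integral>\<^sup>+u. ennreal (\<psi> u) * Kz z u \<partial>seg) = (\<integral>\<^sup>+u. ennreal (\<psi> u) * (ennreal (norm (1 - z) powr - \<tau>) * Kz z u) \<partial>seg)"
        by (subst nn_integral_cmult[symmetric]) (simp_all add: mult_ac)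
    qed
    also have "\<dots> = (\<integral>\<^sup>+u. (\<integral>\<^sup>+z. ennreal (\<psi> u) * (ennreal (norm (1 - z) powr - \<tau>) * Kz z u) \<partial>?W) \<partial>seg)"
      by (rule LW.Fubini') measurable
    also have "\<dots> \<le> (\<integral>\<^sup>+u. ennreal (D3 * D4) * ennreal (\<phi> u powr q * (1 - u) powr ((\<sigma> + 1) * q - 1)) \<partial>seg)"
    proof (intro nn_integral_mono)
      fix u assume "u \<in> space seg"
      then have u: "u < 1" by (auto simp: space_restrict_space)
      have [measurable]: "(\<lambda>z. Kz z u) \<in> borel_measurable ?W"
        unfolding Kz_def k_def by (rule M.borel_measurable_nn_integral) measurable
      have "(\<integral>\<^sup>+z. ennreal (\<psi> u) * (ennreal (norm (1 - z) powr - \<tau>) * Kz z u) \<partial>?W)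
        = ennreal (\<psi> u) * (\<integral>\<^sup>+z. ennreal (norm (1 - z) powr - \<tau>) * Kz z u \<partial>?W)"
        by (rule nn_integral_cmult) measurable
      also have "(\<integral>\<^sup>+z. ennreal (norm (1 - z) powr - \<tau>) * Kz z u \<partial>?W)
        = (\<integral>\<^sup>+z. (\<integral>\<^sup>+t. i u t * ennreal (norm (1 - z) powr - \<tau> * k t z) \<partial>?M) \<partial>?W)"
      proof (intro nn_integral_cong)
        fix z
        have [measurable]: "(\<lambda>t. k t z) \<in> borel_measurable ?M" unfolding k_def by measurable
        show "ennreal (norm (1 - z) powr - \<tau>) * Kz z u = (\<integral>\<^sup>+t. i u t * ennreal (norm (1 - z) powr - \<tau> * k t z) \<partial>?M)"
          unfolding Kz_def
          by (subst nn_integral_cmult[symmetric]) (simp_all add: ennreal_mult k_def mult_ac)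
      qed
      also have "\<dots> = (\<integral>\<^sup>+t. (\<integral>\<^sup>+z. i u t * ennreal (norm (1 - z) powr - \<tau> * k t z) \<partial>?W) \<partial>?M)"
        unfolding k_def by (rule MW.Fubini') measurable
      also have "\<dots> \<le> (\<integral>\<^sup>+t. ennreal D3 * (ennreal ((1 - t) powr - \<tau>) * i u t) \<partial>?M)"
      proof (intro nn_integral_mono)
        fix t assume "t \<in> space ?M"
        then have t: "t < 1" by (auto simp: space_restrict_space)
        have "(\<integral>\<^sup>+z. i u t * ennreal (norm (1 - z) powr - \<tau> * k t z) \<partial>?W) = i u t * (\<integral>\<^sup>+z. ennreal (norm (1 - z) powr - \<tau> * k t z) \<partial>?W)"
          unfolding k_def by (rule nn_integral_cmult) measurable
        also have "\<dots> \<le> i u t * ennreal (D3 * (1 - t) powr (B - \<tau> - B))"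
          unfolding k_def using t by (intro mult_left_mono kW) auto
        also have "\<dots> = ennreal D3 * (ennreal ((1 - t) powr - \<tau>) * i u t)"
          using D3 by (simp add: ennreal_mult' mult_ac)
        finally show "(\<integral>\<^sup>+z. i u t * ennreal (norm (1 - z) powr - \<tau> * k t z) \<partial>?W) \<le> ennreal D3 * (ennreal ((1 - t) powr - \<tau>) * i u t)" .
      qed
      also have "\<dots> = ennreal D3 * (\<integral>\<^sup>+t. ennreal ((1 - t) powr - \<tau>) * i u t \<partial>?M)"
        by (rule nn_integral_cmult) measurable
      also have "\<dots> \<le> ennreal D3 * ennreal (D4 * (1 - u) powr \<sigma>)"
        by (intro mult_left_mono int_t u) simp
      finally have "(\<integral>\<^sup>+z. ennreal (\<psi> u) * (ennreal (norm (1 - z) powr - \<tau>) * Kz z u) \<partial>?W)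
        \<le> ennreal (\<psi> u) * (ennreal D3 * ennreal (D4 * (1 - u) powr \<sigma>))"
        by (simp add: mult_left_mono)
      also have "\<dots> = ennreal (D3 * D4) * ennreal (\<psi> u * (1 - u) powr \<sigma>)"
        using D3 D4 by (simp add: ennreal_mult'[symmetric] \<psi>_def mult_ac)
      also have "\<psi> u * (1 - u) powr \<sigma> = \<phi> u powr q * (1 - u) powr ((\<sigma> + 1) * q - 1)"
      proof -
        have "(\<sigma> + 1) * (q - 1) + \<sigma> = (\<sigma> + 1) * q - 1" by (simp add: algebra_simps)
        then show ?thesis by (simp only: \<psi>_def mult.assoc powr_add[symmetric])
      qed
      finally show "(\<integral>\<^sup>+z. ennreal (\<psi> u) * (ennreal (norm (1 - z) powr - \<tau>) * Kz z u) \<partial>?W)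
        \<le> ennreal (D3 * D4) * ennreal (\<phi> u powr q * (1 - u) powr ((\<sigma> + 1) * q - 1))" .
    qed
    also have "\<dots> = ennreal (D3 * D4) * (\<integral>\<^sup>+u. ennreal (\<phi> u powr q * (1 - u) powr ((\<sigma> + 1) * q - 1)) \<partial>seg)"
      by (rule nn_integral_cmult) measurable
    finally show "(\<integral>\<^sup>+z. ennreal (X z powr q) \<partial>?W) \<le>
       ennreal K * (\<integral>\<^sup>+u. ennreal (\<phi> u powr q * (1 - u) powr ((\<sigma> + 1) * q - 1)) \<partial>seg)"
      using D3 D4 by (simp add: K_def ennreal_mult mult_left_mono mult.assoc)
  qed
qed

section \<open>Integral representation of the operator\<close>

lemma integrable_unit_part_growth:
  fixes f :: "real \<Rightarrow> 'b::{banach, second_countable_topology}"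
  assumes sets: "sets \<mu> = sets borel" and carl: "carleson s \<mu>" and a: "0 \<le> s" "a < s"
    and m: "f \<in> borel_measurable (unit_part \<mu>)"
    and gr: "\<And>t. 0 \<le> t \<Longrightarrow> t < 1 \<Longrightarrow> norm (f t) \<le> Q * (1 - t) powr - a"
  shows "integrable (unit_part \<mu>) f"
proof (rule integrableI_bounded[OF m])
  obtain C where dM: "decay (unit_part \<mu>) (\<lambda>t. 1 - t) C s" using decay_unit_part[OF sets carl a(1)] .
  have [measurable]: "(\<lambda>t. 1 - t) \<in> borel_measurable (unit_part \<mu>)" using dM by (simp add: decay_def)
  have "(\<integral>\<^sup>+t. ennreal (norm (f t)) \<partial>unit_part \<mu>) \<le> (\<integral>\<^sup>+t. ennreal \<bar>Q\<bar> * (ennreal ((1 - t) powr - a) * indicator {t. 1 - t \<le> 1} t) \<partial>unit_part \<mu>)"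
  proof (intro nn_integral_mono)
    fix t assume "t \<in> space (unit_part \<mu>)"
    then have t: "0 \<le> t" "t < 1" by (auto simp: space_unit_part[OF sets])
    have "norm (f t) \<le> Q * (1 - t) powr - a" by (rule gr[OF t])
    also have "\<dots> \<le> \<bar>Q\<bar> * (1 - t) powr - a" by (intro mult_right_mono) auto
    finally show "ennreal (norm (f t)) \<le> ennreal \<bar>Q\<bar> * (ennreal ((1 - t) powr - a) * indicator {t. 1 - t \<le> 1} t)"
      using t by (simp add: ennreal_mult[symmetric] ennreal_leI)
  qed
  also have "\<dots> = ennreal \<bar>Q\<bar> * (\<integral>\<^sup>+t. ennreal ((1 - t) powr - a) * indicator {t. 1 - t \<le> 1} t \<partial>unit_part \<mu>)"
    by (rule nn_integral_cmult) measurable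
  also have "\<dots> < \<infinity>"
  proof -
    have "(\<integral>\<^sup>+t. ennreal ((1 - t) powr - a) * indicator {t. 1 - t \<le> 1} t \<partial>unit_part \<mu>) < \<infinity>"
      using decay_integral_le[OF dM zero_less_one a(2)] by (rule le_less_trans) simp
    then show ?thesis by (simp add: ennreal_mult_less_top)
  qed
  finally show "(\<integral>\<^sup>+t. ennreal (norm (f t)) \<partial>unit_part \<mu>) < \<infinity>" .
qed

text \<open>The condition \<open>\<sigma> + 1/2 < s\<close> makes the sum of
  \<open>|a k| * t ^ k\<close> integrable, which justifies exchanging it with the integral in
  \<open>H_coeff\<close>. The coefficients of the image are then binomial coefficients times moments
  of \<open>f\<close>. From there on integrability of \<open>f\<close> is enough, because for fixed
  \<open>z\<close> the series in \<open>n\<close> converges uniformly in \<open>t\<close>.\<close>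

lemma H_op_integral:
  assumes sets: "sets \<mu> = sets borel" and carl: "carleson s \<mu>" and \<sigma>: "\<sigma> \<ge> 0" "\<sigma> + 1/2 < s" and \<beta>: "\<beta> > 0"
    and hol: "f holomorphic_on ball 0 1" and Q: "Q \<ge> 0"
    and gr: "\<And>z. norm z < 1 \<Longrightarrow> norm (f z) \<le> Q * (1 - norm z) powr - \<sigma>"
  shows "H_defined \<mu> \<beta> f" "H_op \<mu> \<beta> f holomorphic_on ball 0 1"
    "ennreal (norm (H_op \<mu> \<beta> f 0)) \<le> (\<integral>\<^sup>+t. ennreal (norm (f (of_real t))) \<partial>unit_part \<mu>)"
    "\<And>z. norm z < 1 \<Longrightarrow> ennreal (norm (deriv (H_op \<mu> \<beta> f) z)) \<le>
       (\<integral>\<^sup>+t. ennreal (\<beta> * norm (f (of_real t)) * norm (1 - of_real t * z) powr - (\<beta> + 1)) \<partial>unit_part \<mu>)"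
proof -
  let ?M = "unit_part \<mu>"
  have sp: "space ?M = {0..<1}" by (rule space_unit_part[OF sets])
  have fin: "finite_measure ?M" by (rule finite_unit_part[OF sets carl])
  have s0: "0 \<le> s" using \<sigma> by simp
  define a where "a = taylor_coeff f"
  have asum: "summable (\<lambda>k. norm (a k) * t ^ k)" 
    "(\<Sum>k. norm (a k) * t ^ k) \<le> Q * 4 powr \<sigma> * sqrt 2 * (1 - t) powr - (\<sigma> + 1/2)" if "0 \<le> t" "t < 1" for t
    using taylor_coeff_abs_sum[OF hol Q \<sigma>(1) gr that] by (auto simp: a_def)
  have fsums: "(\<lambda>k. a k * of_real t ^ k) sums f (of_real t)" if "0 \<le> t" "t < 1" for t
    unfolding a_def using taylor_coeff_sums[OF hol, of "of_real t"] that by simp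
  have cf: "continuous_on {0..<1} (\<lambda>t. f (of_real t))"
    by (rule continuous_on_compose2[OF holomorphic_on_imp_continuous_on[OF hol]]) (auto intro!: continuous_intros)
  have intf: "integrable ?M (\<lambda>t. f (of_real t))"
  proof (rule integrable_unit_part_growth[OF sets carl s0])
    show "(\<lambda>t. f (of_real t)) \<in> borel_measurable ?M" by (rule measurable_unit_part[OF sets cf])
    show "norm (f (of_real t)) \<le> Q * (1 - t) powr - \<sigma>" if "0 \<le> t" "t < 1" for t
      using gr[of "of_real t"] that by simp
  qed (use \<sigma> in auto)
  have intp: "integrable ?M (\<lambda>t. t ^ n)" for n by (rule integrable_power_unit_part[OF sets fin])
  have meas_sum: "(\<lambda>t. \<Sum>k. norm (a k) * t ^ k) \<in> borel_measurable ?M"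
    by (intro borel_measurable_suminf borel_measurable_times borel_measurable_const borel_measurable_integrable[OF intp])
  have int_sum: "integrable ?M (\<lambda>t. \<Sum>k. norm (a k) * t ^ k)"
  proof (rule integrable_unit_part_growth[OF sets carl s0 \<sigma>(2) meas_sum])
    fix t :: real assume t: "0 \<le> t" "t < 1"
    have "0 \<le> (\<Sum>k. norm (a k) * t ^ k)" using asum(1)[OF t] t by (intro suminf_nonneg) auto
    then show "norm (\<Sum>k. norm (a k) * t ^ k) \<le> Q * 4 powr \<sigma> * sqrt 2 * (1 - t) powr - (\<sigma> + 1/2)"
      using asum(2)[OF t] by simp
  qed
  \<comment> \<open>Partial sums are integrals of partial sums, hence bounded by the integral of the
    full absolute series. This is the dominating series for every index \<open>n\<close>, since
    \<open>t ^ (n + k) \<le> t ^ k\<close>.\<close>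
  have mom_sum: "summable (\<lambda>k. norm (a k) * (\<integral>t. t ^ k \<partial>?M))"
  proof (rule bounded_imp_summable)
    show "0 \<le> norm (a k) * (\<integral>t. t ^ k \<partial>?M)" for k
      by (intro mult_nonneg_nonneg Bochner_Integration.integral_nonneg) (auto simp: sp)
    fix n
    have "(\<Sum>k\<le>n. norm (a k) * (\<integral>t. t ^ k \<partial>?M)) = (\<integral>t. (\<Sum>k\<le>n. norm (a k) * t ^ k) \<partial>?M)"
      by (subst Bochner_Integration.integral_sum) (auto intro: integrable_mult_right intp)
    also have "\<dots> \<le> (\<integral>t. (\<Sum>k. norm (a k) * t ^ k) \<partial>?M)"
    proof (rule integral_mono[OF _ int_sum])
      show "integrable ?M (\<lambda>t. \<Sum>k\<le>n. norm (a k) * t ^ k)"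
        by (intro Bochner_Integration.integrable_sum integrable_mult_right intp)
      show "(\<Sum>k\<le>n. norm (a k) * t ^ k) \<le> (\<Sum>k. norm (a k) * t ^ k)" if "t \<in> space ?M" for t
        using that asum(1)[of t] by (intro sum_le_suminf) (auto simp: sp)
    qed
    finally show "(\<Sum>k\<le>n. norm (a k) * (\<integral>t. t ^ k \<partial>?M)) \<le> (\<integral>t. (\<Sum>k. norm (a k) * t ^ k) \<partial>?M)" .
  qed
  define J where "J n = (\<integral>t. of_real (t ^ n) * f (of_real t) \<partial>?M)" for n
  have Hsums: "(\<lambda>k. of_real (mu_coeff \<mu> \<beta> n k) * a k) sums (of_real (bin_coeff \<beta> n) * J n)" for n
  proof -
    have icx: "integrable ?M (\<lambda>t. of_real (t ^ (n + k)) * a k)" for k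
      by (intro integrable_mult_left integrable_of_real intp)
    have nrm: "norm (of_real (t ^ (n + k)) * a k) = t ^ (n + k) * norm (a k)" if "t \<in> space ?M" for t k
      using that by (simp add: sp norm_mult norm_power)
    have le: "t ^ (n + k) * norm (a k) \<le> norm (a k) * t ^ k" if "t \<in> space ?M" for t k
    proof -
      have "t ^ (n + k) \<le> t ^ k" using that by (intro power_decreasing) (auto simp: sp)
      then have "t ^ (n + k) * norm (a k) \<le> t ^ k * norm (a k)" by (rule mult_right_mono) simp
      then show ?thesis by (simp only: mult.commute[of "norm (a k)"])
    qed
    have "(\<lambda>k. \<integral>t. of_real (t ^ (n + k)) * a k \<partial>?M) sums (\<integral>t. (\<Sum>k. of_real (t ^ (n + k)) * a k) \<partial>?M)"
    proof (rule sums_integral[OF icx])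
      show "AE t in ?M. summable (\<lambda>k. norm (of_real (t ^ (n + k)) * a k))"
      proof (rule AE_I2)
        fix t assume t: "t \<in> space ?M"
        show "summable (\<lambda>k. norm (of_real (t ^ (n + k)) * a k))"
          by (rule summable_comparison_test'[OF asum(1)[of t], of 0]) (use t le nrm in \<open>auto simp: sp\<close>)
      qed
      have "(\<integral>t. norm (of_real (t ^ (n + k)) * a k) \<partial>?M) \<le> norm (a k) * (\<integral>t. t ^ k \<partial>?M)" for k
      proof -
        have "(\<integral>t. norm (of_real (t ^ (n + k)) * a k) \<partial>?M) \<le> (\<integral>t. norm (a k) * t ^ k \<partial>?M)"
          by (rule integral_mono) (use icx intp le nrm in \<open>auto intro: integrable_mult_right integrable_norm\<close>)
        then show ?thesis by simp
      qed
      then show "summable (\<lambda>k. \<integral>t. norm (of_real (t ^ (n + k)) * a k) \<partial>?M)"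
        by (intro summable_comparison_test'[OF mom_sum, of 0]) auto
    qed
    also have "(\<integral>t. (\<Sum>k. of_real (t ^ (n + k)) * a k) \<partial>?M) = J n"
      unfolding J_def
    proof (rule Bochner_Integration.integral_cong)
      fix t assume "t \<in> space ?M"
      then have "(\<lambda>k. of_real t ^ n * (a k * of_real t ^ k)) sums (of_real t ^ n * f (of_real t))"
        by (intro sums_mult fsums) (auto simp: sp)
      then show "(\<Sum>k. of_real (t ^ (n + k)) * a k) = of_real (t ^ n) * f (of_real t)"
        by (simp add: sums_iff power_add mult_ac)
    qed simp
    finally have "(\<lambda>k. \<integral>t. of_real (t ^ (n + k)) * a k \<partial>?M) sums J n" .
    then have "(\<lambda>k. of_real (bin_coeff \<beta> n) * (\<integral>t. of_real (t ^ (n + k)) * a k \<partial>?M)) sums (of_real (bin_coeff \<beta> n) * J n)"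
      by (rule sums_mult)
    also have "(\<lambda>k. of_real (bin_coeff \<beta> n) * (\<integral>t. of_real (t ^ (n + k)) * a k \<partial>?M)) = (\<lambda>k. of_real (mu_coeff \<mu> \<beta> n k) * a k)"
    proof
      fix k
      have "(\<integral>t. of_real (t ^ (n + k)) * a k \<partial>?M) = of_real (\<integral>t. t ^ (n + k) \<partial>?M) * a k"
        by (simp del: of_real_power)
      then show "of_real (bin_coeff \<beta> n) * (\<integral>t. of_real (t ^ (n + k)) * a k \<partial>?M) = of_real (mu_coeff \<mu> \<beta> n k) * a k"
        unfolding mu_coeff_eq[OF sets \<beta>] of_real_mult by (simp only: mult.assoc)
    qed
    finally show ?thesis .
  qed
  have Hc: "H_coeff \<mu> \<beta> f n = of_real (bin_coeff \<beta> n) * J n" for n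
    using Hsums[of n] by (simp add: H_coeff_def a_def sums_iff)
  define I where "I = (\<integral>t. norm (f (of_real t)) \<partial>?M)"
  have intnf: "integrable ?M (\<lambda>t. norm (f (of_real t)))" by (rule integrable_norm[OF intf])
  have intJ: "integrable ?M (\<lambda>t. of_real (t ^ n) * f (of_real t))" for n
  proof (rule Bochner_Integration.integrable_bound[OF intf])
    show "(\<lambda>t. of_real (t ^ n) * f (of_real t)) \<in> borel_measurable ?M"
      by (intro measurable_unit_part[OF sets] continuous_intros cf)
    show "AE t in ?M. norm (of_real (t ^ n) * f (of_real t)) \<le> norm (f (of_real t))"
      by (rule AE_I2) (auto simp: sp norm_mult norm_power power_le_one mult_left_le_one_le)
  qed
  have Jle: "norm (J n) \<le> I" for n
  proof -
    have "norm (J n) \<le> (\<integral>t. norm (of_real (t ^ n) * f (of_real t)) \<partial>?M)"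
      unfolding J_def by (rule integral_norm_bound)
    also have "\<dots> \<le> I" unfolding I_def
      by (rule integral_mono[OF integrable_norm[OF intJ] intnf])
         (auto simp: sp norm_mult norm_power power_le_one mult_left_le_one_le)
    finally show ?thesis .
  qed
  \<comment> \<open>All moments of \<open>f\<close> are bounded by \<open>I\<close>, so the binomial
    series at \<open>|z|\<close> is a majorant.\<close>
  have Hsummable: "summable (\<lambda>n. H_coeff \<mu> \<beta> f n * z ^ n)" if z: "norm z < 1" for z
  proof (rule summable_comparison_test'[of "\<lambda>n. I * (bin_coeff \<beta> n * norm z ^ n)" 0])
    show "summable (\<lambda>n. I * (bin_coeff \<beta> n * norm z ^ n))"
      using bin_coeff_sums_real[of "norm z" \<beta>] z by (intro summable_mult) (simp add: sums_iff)
    fix n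
    have "norm (H_coeff \<mu> \<beta> f n * z ^ n) = (bin_coeff \<beta> n * norm z ^ n) * norm (J n)"
      using bin_coeff_nonneg[of \<beta> n] \<beta> by (simp add: Hc norm_mult norm_power)
    also have "\<dots> \<le> (bin_coeff \<beta> n * norm z ^ n) * I"
      using bin_coeff_nonneg[of \<beta> n] \<beta> by (intro mult_left_mono Jle) auto
    finally show "norm (H_coeff \<mu> \<beta> f n * z ^ n) \<le> I * (bin_coeff \<beta> n * norm z ^ n)" by (simp add: mult_ac)
  qed
  show "H_defined \<mu> \<beta> f" unfolding H_defined_def
    using Hsums Hsummable by (auto simp: a_def sums_iff)
  show "H_op \<mu> \<beta> f holomorphic_on ball 0 1"
  proof (rule power_series_holomorphic)
    show "(\<lambda>n. H_coeff \<mu> \<beta> f n * (w - 0) ^ n) sums H_op \<mu> \<beta> f w" if "w \<in> ball 0 1" for w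
      using summable_sums[OF Hsummable[of w]] that by (simp add: H_op_def)
  qed
  have "H_op \<mu> \<beta> f 0 = H_coeff \<mu> \<beta> f 0" unfolding H_op_def by (rule powser_zero)
  also have "\<dots> = (\<integral>t. f (of_real t) \<partial>?M)" by (simp add: Hc J_def bin_coeff_def)
  finally show "ennreal (norm (H_op \<mu> \<beta> f 0)) \<le> (\<integral>\<^sup>+t. ennreal (norm (f (of_real t))) \<partial>unit_part \<mu>)"
    using integral_norm_bound_ennreal[OF intf] by simp
  fix z :: complex assume z: "norm z < 1"
  have "(H_op \<mu> \<beta> f has_field_derivative (\<Sum>n. diffs (H_coeff \<mu> \<beta> f) n * z ^ n)) (at z)"
    unfolding H_op_def by (rule termdiffs_strong'[OF Hsummable z])
  then have dH: "deriv (H_op \<mu> \<beta> f) z = (\<Sum>n. diffs (H_coeff \<mu> \<beta> f) n * z ^ n)" by (rule DERIV_imp_deriv)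
  \<comment> \<open>The integrand of the \<open>n\<close>-th term of the differentiated series. The
    index shift turns the coefficient into \<open>\<beta> * bin_coeff (\<beta> + 1) n\<close> and
    leaves the power \<open>t ^ Suc n\<close>; its surplus factor \<open>t\<close> is finally
    bounded by 1.\<close>
  define g where "g n t = (of_real (\<beta> * bin_coeff (\<beta> + 1) n) * z ^ n) * (of_real (t ^ Suc n) * f (of_real t))" for n and t :: real
  have gi: "integrable ?M (g n)" for n unfolding g_def by (intro integrable_mult_right intJ)
  have b0: "bin_coeff (\<beta> + 1) n \<ge> 0" for n using bin_coeff_nonneg[of "\<beta> + 1" n] \<beta> by simp
  have nzt: "norm (of_real t * z) < 1" if "t \<in> space ?M" for t
    using that z mult_strict_mono'[of t 1 "norm z" 1] by (simp add: sp norm_mult)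
  have gn: "norm (g n t) \<le> \<beta> * (bin_coeff (\<beta> + 1) n * norm z ^ n) * norm (f (of_real t))" if "t \<in> space ?M" for n t
  proof -
    have "norm (g n t) = (\<beta> * (bin_coeff (\<beta> + 1) n * norm z ^ n)) * (t ^ Suc n * norm (f (of_real t)))"
      using that \<beta> b0 by (simp add: g_def norm_mult norm_power sp del: of_real_power power_Suc of_real_mult) 
    also have "\<dots> \<le> (\<beta> * (bin_coeff (\<beta> + 1) n * norm z ^ n)) * (1 * norm (f (of_real t)))"
      using that \<beta> b0 by (intro mult_left_mono mult_right_mono power_le_one) (auto simp: sp)
    finally show ?thesis by simp
  qed
  have bs: "summable (\<lambda>n. bin_coeff (\<beta> + 1) n * norm z ^ n)"
    using bin_coeff_sums_real[of "norm z" "\<beta> + 1"] z by (simp add: sums_iff)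
  have AEs: "AE t in ?M. summable (\<lambda>n. norm (g n t))"
  proof (rule AE_I2)
    fix t assume t: "t \<in> space ?M"
    show "summable (\<lambda>n. norm (g n t))"
    proof (rule summable_comparison_test'[of _ 0])
      show "summable (\<lambda>n. \<beta> * (bin_coeff (\<beta> + 1) n * norm z ^ n) * norm (f (of_real t)))"
        by (intro summable_mult2 summable_mult bs)
    qed (use gn[OF t] in auto)
  qed
  have Is: "summable (\<lambda>n. \<integral>t. norm (g n t) \<partial>?M)"
  proof (rule summable_comparison_test'[of _ 0])
    show "summable (\<lambda>n. \<beta> * (bin_coeff (\<beta> + 1) n * norm z ^ n) * I)"
      by (intro summable_mult2 summable_mult bs)
    fix n
    have "(\<integral>t. norm (g n t) \<partial>?M) \<le> (\<integral>t. \<beta> * (bin_coeff (\<beta> + 1) n * norm z ^ n) * norm (f (of_real t)) \<partial>?M)"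
      by (rule integral_mono[OF integrable_norm[OF gi] integrable_mult_right[OF intnf] gn])
    then show "norm (\<integral>t. norm (g n t) \<partial>?M) \<le> \<beta> * (bin_coeff (\<beta> + 1) n * norm z ^ n) * I"
      by (simp add: I_def)
  qed
  have dH2: "diffs (H_coeff \<mu> \<beta> f) n * z ^ n = (\<integral>t. g n t \<partial>?M)" for n
  proof -
    have "complex_of_real (real (Suc n)) * of_real (bin_coeff \<beta> (Suc n)) = of_real (\<beta> * bin_coeff (\<beta> + 1) n)"
      using bin_coeff_Suc[of n \<beta>] by (metis of_real_mult)
    moreover have "diffs (H_coeff \<mu> \<beta> f) n * z ^ n = (complex_of_real (real (Suc n)) * of_real (bin_coeff \<beta> (Suc n))) * z ^ n * J (Suc n)"
      unfolding diffs_def Hc by (simp only: mult_ac of_real_of_nat_eq)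
    ultimately have "diffs (H_coeff \<mu> \<beta> f) n * z ^ n = (of_real (\<beta> * bin_coeff (\<beta> + 1) n) * z ^ n) * J (Suc n)"
      by simp
    also have "\<dots> = (\<integral>t. g n t \<partial>?M)" unfolding g_def J_def by (rule integral_mult_right_zero[symmetric])
    finally show ?thesis .
  qed
  have "deriv (H_op \<mu> \<beta> f) z = (\<integral>t. (\<Sum>n. g n t) \<partial>?M)"
    unfolding dH dH2 by (rule integral_suminf[OF gi AEs Is, symmetric])
  then have "ennreal (norm (deriv (H_op \<mu> \<beta> f) z)) \<le> (\<integral>\<^sup>+t. ennreal (norm (\<Sum>n. g n t)) \<partial>?M)"
    using integral_norm_bound_ennreal[OF integrable_suminf[OF gi AEs Is]] by simp
  also have "\<dots> \<le> (\<integral>\<^sup>+t. ennreal (\<beta> * norm (f (of_real t)) * norm (1 - of_real t * z) powr - (\<beta> + 1)) \<partial>?M)"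
  proof (intro nn_integral_mono ennreal_leI)
    fix t assume t: "t \<in> space ?M"
    have "(\<lambda>n. (of_real \<beta> * of_real t * f (of_real t)) * (of_real (bin_coeff (\<beta> + 1) n) * (of_real t * z) ^ n)) sums
      ((of_real \<beta> * of_real t * f (of_real t)) * (1 - of_real t * z) powr (- of_real (\<beta> + 1)))"
      by (intro sums_mult bin_coeff_sums nzt[OF t])
    then have "(\<Sum>n. g n t) = (of_real \<beta> * of_real t * f (of_real t)) * (1 - of_real t * z) powr (- of_real (\<beta> + 1))"
      by (simp add: sums_iff g_def power_mult_distrib mult_ac)
    then have "norm (\<Sum>n. g n t) = t * (\<beta> * norm (f (of_real t)) * norm (1 - of_real t * z) powr - (\<beta> + 1))"
      using t \<beta> by (simp add: sp norm_mult norm_powr_real_powr')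
    also have "\<dots> \<le> 1 * (\<beta> * norm (f (of_real t)) * norm (1 - of_real t * z) powr - (\<beta> + 1))"
      using t \<beta> by (intro mult_right_mono) (auto simp: sp)
    finally show "norm (\<Sum>n. g n t) \<le> \<beta> * norm (f (of_real t)) * norm (1 - of_real t * z) powr - (\<beta> + 1)" by simp
  qed
  finally show "ennreal (norm (deriv (H_op \<mu> \<beta> f) z)) \<le>
       (\<integral>\<^sup>+t. ennreal (\<beta> * norm (f (of_real t)) * norm (1 - of_real t * z) powr - (\<beta> + 1)) \<partial>?M)" .
qed

text \<open>The two Carleson hypotheses have different tasks: \<open>carl0\<close> is the exponent
  of the Schur test and gives the norm bound on the derivative, while \<open>carl\<close> makes the
  operator well defined, gives its integral representation and bounds its value at 0.\<close>

lemma sufficiency: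
  fixes p q \<alpha> \<beta> s :: real
  defines "\<sigma> \<equiv> (\<alpha> + 2) / p - 1"
  assumes sets: "sets \<mu> = sets borel"
    and q: "q > 1" and p: "0 < p" "p \<le> q" and \<alpha>: "\<alpha> > -1" and \<beta>: "\<beta> > 0" and \<sigma>: "\<sigma> > 0"
    and carl0: "carleson (\<sigma> + (\<beta> + 1) * (q - 1) / q) \<mu>"
    and carl: "carleson s \<mu>" "\<sigma> + 1/2 < s"
  shows "H_bounded_DD \<mu> \<beta> p \<alpha> q (\<beta> - 1)"
proof -
  let ?M = "unit_part \<mu>" and ?W = "wdisc (\<beta> - 1)"
  have sp: "space ?M = {0..<1}" by (rule space_unit_part[OF sets])
  have \<sigma>1: "(\<alpha> + 2) / p > 1" and \<sigma>p: "(\<sigma> + 1) * p = \<alpha> + 2" using \<sigma> p by (auto simp: \<sigma>_def)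
  obtain K1 where K1: "K1 \<ge> 0" and grD: "\<And>f z. in_dirichlet p \<alpha> f \<Longrightarrow> norm z < 1 \<Longrightarrow>
     norm (f z) \<le> K1 * dirichlet_norm p \<alpha> f * (1 - norm z) powr - \<sigma>"
    using dirichlet_growth[OF p(1) \<alpha> \<sigma>1] unfolding \<sigma>_def by blast
  obtain K2 where K2: "K2 \<ge> 0" and rad: "\<And>g. in_bergman p \<alpha> g \<Longrightarrow>
     (\<integral>\<^sup>+u. ennreal (norm (g (of_real u)) powr p * (1 - u) powr (\<alpha> + 1)) * indicator {0..<1} u \<partial>lborel)
       \<le> ennreal (K2 * bergman_norm p \<alpha> g powr p)"
    using bergman_radial[OF p(1) \<alpha>] by blast
  obtain K3 where K3: "K3 \<ge> 0" and grB: "\<And>g z. in_bergman p \<alpha> g \<Longrightarrow> norm z < 1 \<Longrightarrow>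
     norm (g z) \<le> K3 * bergman_norm p \<alpha> g * (1 - norm z) powr - ((\<alpha> + 2) / p)"
    using bergman_growth[OF p(1) \<alpha>] by blast
  have B1: "\<beta> + 1 > 1" "\<beta> + 1 - 2 = \<beta> - 1" using \<beta> by auto
  obtain K4 where K4: "K4 \<ge> 0" and schur: "\<And>\<phi> X. \<phi> \<in> borel_measurable borel \<Longrightarrow> (\<And>u. \<phi> u \<ge> 0) \<Longrightarrow>
     (\<And>z. norm z < 1 \<Longrightarrow> X z \<ge> 0 \<and> ennreal (X z) \<le> (\<integral>\<^sup>+t. ennreal ((1 - t + norm (1 - z)) powr - (\<beta> + 1)) *
         (\<integral>\<^sup>+u. ennreal (\<phi> u) * (if u \<le> t then 1 else 0) \<partial>seg) \<partial>?M)) \<Longrightarrow>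
     (\<integral>\<^sup>+z. ennreal (X z powr q) \<partial>?W) \<le>
       ennreal K4 * (\<integral>\<^sup>+u. ennreal (\<phi> u powr q * (1 - u) powr ((\<sigma> + 1) * q - 1)) \<partial>seg)"
    using schur_estimate[OF q \<sigma> B1(1) sets carl0] unfolding B1(2) by blast
  have s: "s \<ge> 0" "\<sigma> < s" using carl(2) \<sigma> by auto
  obtain C where dM: "decay ?M (\<lambda>t. 1 - t) C s" using decay_unit_part[OF sets carl(1) s(1)] .
  have C: "C \<ge> 0" using dM by (simp add: decay_def)
  have [measurable]: "(\<lambda>t. 1 - t) \<in> borel_measurable ?M" using dM by (simp add: decay_def)
  define E where "E = C * (2 powr \<bar>\<sigma>\<bar> / (1 - (1/2) powr (s - \<sigma>)))"
  have "(1/2::real) powr (s - \<sigma>) < (1/2) powr 0" using s by (intro powr_less_mono') auto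
  then have E: "E \<ge> 0" using C by (simp add: E_def)
  have intE: "(\<integral>\<^sup>+t. ennreal ((1 - t) powr - \<sigma>) \<partial>?M) \<le> ennreal E"
  proof -
    have "(\<integral>\<^sup>+t. ennreal ((1 - t) powr - \<sigma>) \<partial>?M) = (\<integral>\<^sup>+t. ennreal ((1 - t) powr - \<sigma>) * indicator {t. 1 - t \<le> 1} t \<partial>?M)"
      by (intro nn_integral_cong) (auto simp: sp)
    also have "\<dots> \<le> ennreal (E * 1 powr (s - \<sigma>))"
      unfolding E_def by (rule decay_integral_le[OF dM _ s(2)]) simp
    finally show ?thesis by simp
  qed
  \<comment> \<open>The exponent that the Schur test leaves on \<open>1 - u\<close>. It is
    nonnegative, so on \<open>[-1, 0)\<close> the weight is at most \<open>2 powr e\<close>.\<close>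
  define e where "e = (\<sigma> + 1) * q - 1"
  have e: "e \<ge> 0" using mult_mono[of 1 "\<sigma> + 1" 1 q] \<sigma> q by (simp add: e_def)
  define K5 where "K5 = K4 * (2 powr e + K3 powr (q - p) * K2)"
  have K5: "K5 \<ge> 0" using K4 K2 by (simp add: K5_def)
  \<comment> \<open>Collects the factor \<open>\<beta>\<close> of the derivative and the constant of
    \<open>kernel_le\<close>, so that \<open>X\<close> below satisfies the hypothesis of the Schur
    test with constant 1.\<close>
  define G where "G = \<beta> * 3 powr (\<beta> + 1)"
  have G: "G > 0" using \<beta> by (simp add: G_def)
  define K6 where "K6 = \<beta> * G powr q * K5"
  have K6: "K6 \<ge> 0" using \<beta> K5 by (simp add: K6_def)
  show ?thesis unfolding H_bounded_DD_def
  proof (intro exI[of _ "K1 * E + K6 powr (1/q)"] allI impI)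
    fix f assume f: "in_dirichlet p \<alpha> f"
    have hol: "f holomorphic_on ball 0 1" and der: "in_bergman p \<alpha> (deriv f)" using f by (auto simp: in_dirichlet_def)
    define Nf where "Nf = dirichlet_norm p \<alpha> f"
    define N where "N = bergman_norm p \<alpha> (deriv f)"
    have N: "N \<ge> 0" "N \<le> Nf" "norm (f 0) \<le> Nf" "Nf \<ge> 0"
      using bergman_norm_nonneg[of p \<alpha> "deriv f"] by (auto simp: N_def Nf_def dirichlet_norm_def)
    have gr: "norm (f z) \<le> (K1 * Nf) * (1 - norm z) powr - \<sigma>" if "norm z < 1" for z
      using grD[OF f that] by (simp add: Nf_def)
    have Q: "K1 * Nf \<ge> 0" using K1 N by simp
    define h where "h = H_op \<mu> \<beta> f"
    note H = H_op_integral[OF sets carl(1) less_imp_le[OF \<sigma>] carl(2) \<beta> hol Q gr]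
    have hdef: "H_defined \<mu> \<beta> f" and hh: "h holomorphic_on ball 0 1" using H(1,2) by (auto simp: h_def)
    have "ennreal (norm (h 0)) \<le> (\<integral>\<^sup>+t. ennreal (norm (f (of_real t))) \<partial>?M)" using H(3) by (simp add: h_def)
    also have "\<dots> \<le> (\<integral>\<^sup>+t. ennreal (K1 * Nf) * ennreal ((1 - t) powr - \<sigma>) \<partial>?M)"
    proof (intro nn_integral_mono)
      fix t assume "t \<in> space ?M"
      then show "ennreal (norm (f (of_real t))) \<le> ennreal (K1 * Nf) * ennreal ((1 - t) powr - \<sigma>)"
        using gr[of "of_real t"] Q by (auto simp: sp ennreal_mult[symmetric] intro: ennreal_leI)
    qed
    also have "\<dots> = ennreal (K1 * Nf) * (\<integral>\<^sup>+t. ennreal ((1 - t) powr - \<sigma>) \<partial>?M)"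
      by (rule nn_integral_cmult) measurable
    also have "\<dots> \<le> ennreal (K1 * Nf) * ennreal E" by (intro mult_left_mono intE) simp
    also have "\<dots> = ennreal (K1 * E * Nf)" using Q E by (simp add: ennreal_mult[symmetric] mult_ac)
    finally have h0: "norm (h 0) \<le> K1 * E * Nf" using K1 E N by (simp add: ennreal_le_iff)
    \<comment> \<open>The derivative is cut off outside \<open>[0, 1)\<close>, where its continuity
      is not known; this makes \<open>\<phi>\<close> Borel on the whole line. On
      \<open>[-1, 0)\<close> it carries \<open>|f(0)|\<close>.\<close>
    define \<phi> where "\<phi> u = indicator {-1..<0} u * norm (f 0) + indicator {0..<1} u *\<^sub>R norm (deriv f (of_real u))" for u :: real
    have cder: "continuous_on {0..<1} (\<lambda>u. norm (deriv f (complex_of_real u)))"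
    proof -
      have "continuous_on (ball 0 1) (deriv f)"
        by (intro holomorphic_on_imp_continuous_on holomorphic_deriv hol) auto
      then have "continuous_on {0..<1} (\<lambda>u. deriv f (complex_of_real u))"
        by (rule continuous_on_compose2) (auto intro!: continuous_intros)
      then show ?thesis by (rule continuous_on_norm)
    qed
    have \<phi>m: "\<phi> \<in> borel_measurable borel" unfolding \<phi>_def
      by (intro borel_measurable_add borel_measurable_times borel_measurable_const borel_measurable_indicator
          borel_measurable_continuous_on_indicator[OF _ cder]) auto
    have \<phi>0: "\<phi> u \<ge> 0" for u by (simp add: \<phi>_def)
    have \<phi>_neg: "\<phi> u = norm (f 0)" if "u \<in> {-1..<0}" for u using that by (simp add: \<phi>_def indicator_def)
    have \<phi>_pos: "\<phi> u = norm (deriv f (of_real u))" if "u \<in> {0..<1}" for u using that by (simp add: \<phi>_def indicator_def)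
    have fle: "ennreal (norm (f (of_real t))) \<le> (\<integral>\<^sup>+u. ennreal (\<phi> u) * (if u \<le> t then 1 else 0) \<partial>seg)"
      if t: "0 \<le> t" "t < 1" for t
    proof -
      have "norm (f (of_real t)) \<le> norm (f 0) + norm (f (of_real t) - f 0)"
        using norm_triangle_ineq[of "f 0" "f (of_real t) - f 0"] by simp
      then have "ennreal (norm (f (of_real t))) \<le> ennreal (norm (f 0)) + ennreal (norm (f (of_real t) - f 0))"
        by (metis ennreal_leI ennreal_plus norm_ge_zero)
      also have "\<dots> \<le> (\<integral>\<^sup>+u. ennreal (norm (f 0)) * indicator {-1..<0::real} u \<partial>lborel)
         + (\<integral>\<^sup>+u. ennreal (norm (deriv f (of_real u))) * indicator {0..t} u \<partial>lborel)"
        by (intro add_mono radial_FTC_bound[OF hol t]) (simp add: nn_integral_cmult_indicator)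
      also have "\<dots> = (\<integral>\<^sup>+u. ennreal (norm (f 0)) * indicator {-1..<0} u + ennreal (norm (deriv f (of_real u))) * indicator {0..t} u \<partial>lborel)"
      proof (rule nn_integral_add[symmetric])
        have "continuous_on {0..t} (\<lambda>u. norm (deriv f (complex_of_real u)))"
          by (rule continuous_on_subset[OF cder]) (use t in auto)
        then have "(\<lambda>u. indicator {0..t} u *\<^sub>R norm (deriv f (complex_of_real u))) \<in> borel_measurable borel"
          by (intro borel_measurable_continuous_on_indicator) auto
        then have "(\<lambda>u. ennreal (indicator {0..t} u *\<^sub>R norm (deriv f (complex_of_real u)))) \<in> borel_measurable lborel"
          by measurable
        also have "(\<lambda>u. ennreal (indicator {0..t} u *\<^sub>R norm (deriv f (complex_of_real u)))) = (\<lambda>u. ennreal (norm (deriv f (of_real u))) * indicator {0..t} u)"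
          by (auto simp: indicator_def)
        finally show "(\<lambda>u. ennreal (norm (deriv f (of_real u))) * indicator {0..t} u) \<in> borel_measurable lborel" .
      qed simp
      also have "\<dots> \<le> (\<integral>\<^sup>+u. ennreal (\<phi> u) * (if u \<le> t then 1 else 0) * indicator {-1..<1} u \<partial>lborel)"
        by (intro nn_integral_mono) (use t in \<open>auto simp: \<phi>_def indicator_def\<close>)
      also have "\<dots> = (\<integral>\<^sup>+u. ennreal (\<phi> u) * (if u \<le> t then 1 else 0) \<partial>seg)"
        by (rule nn_integral_restrict_space[symmetric]) simp
      finally show ?thesis .
    qed
    define X where "X z = norm (deriv h z) / G" for z
    have "(\<integral>\<^sup>+z. ennreal (X z powr q) \<partial>?W) \<le>
       ennreal K4 * (\<integral>\<^sup>+u. ennreal (\<phi> u powr q * (1 - u) powr ((\<sigma> + 1) * q - 1)) \<partial>seg)"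
    proof (rule schur[OF \<phi>m \<phi>0], intro conjI)
      fix z :: complex assume z: "norm z < 1"
      show "X z \<ge> 0" using G by (simp add: X_def)
      have "ennreal (X z) = ennreal (1 / G) * ennreal (norm (deriv h z))"
        using G by (simp add: X_def ennreal_mult'[symmetric])
      also have "\<dots> \<le> ennreal (1 / G) * (\<integral>\<^sup>+t. ennreal (\<beta> * norm (f (of_real t)) * norm (1 - of_real t * z) powr - (\<beta> + 1)) \<partial>?M)"
        unfolding h_def by (intro mult_left_mono H(4)[OF _ z]) auto
      also have "\<dots> = (\<integral>\<^sup>+t. ennreal (1 / G) * ennreal (\<beta> * norm (f (of_real t)) * norm (1 - of_real t * z) powr - (\<beta> + 1)) \<partial>?M)"
      proof (rule nn_integral_cmult[symmetric])
        have "continuous_on {0..<1} (\<lambda>t. f (complex_of_real t))"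
          by (rule continuous_on_compose2[OF holomorphic_on_imp_continuous_on[OF hol]]) (auto intro!: continuous_intros)
        then have [measurable]: "(\<lambda>t. f (complex_of_real t)) \<in> borel_measurable ?M" by (rule measurable_unit_part[OF sets])
        have [measurable]: "(\<lambda>t. norm (1 - complex_of_real t * z)) \<in> borel_measurable ?M"
          by (intro measurable_unit_part[OF sets] continuous_intros)
        show "(\<lambda>t. ennreal (\<beta> * norm (f (of_real t)) * norm (1 - of_real t * z) powr - (\<beta> + 1))) \<in> borel_measurable ?M"
          by measurable
      qed
      also have "\<dots> \<le> (\<integral>\<^sup>+t. ennreal ((1 - t + norm (1 - z)) powr - (\<beta> + 1)) *
         (\<integral>\<^sup>+u. ennreal (\<phi> u) * (if u \<le> t then 1 else 0) \<partial>seg) \<partial>?M)"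
      proof (intro nn_integral_mono)
        fix t assume "t \<in> space ?M"
        then have t: "0 \<le> t" "t < 1" by (auto simp: sp)
        have "\<beta> * norm (f (of_real t)) * norm (1 - of_real t * z) powr - (\<beta> + 1)
          \<le> \<beta> * norm (f (of_real t)) * (3 powr (\<beta> + 1) * (1 - t + norm (1 - z)) powr - (\<beta> + 1))"
          using \<beta> by (intro mult_left_mono kernel_le t z) auto
        also have "\<dots> = G * ((1 - t + norm (1 - z)) powr - (\<beta> + 1) * norm (f (of_real t)))"
          by (simp add: G_def)
        finally have "1 / G * (\<beta> * norm (f (of_real t)) * norm (1 - of_real t * z) powr - (\<beta> + 1))
          \<le> (1 - t + norm (1 - z)) powr - (\<beta> + 1) * norm (f (of_real t))"
          using G by (simp add: field_simps)
        then have "ennreal (1 / G) * ennreal (\<beta> * norm (f (of_real t)) * norm (1 - of_real t * z) powr - (\<beta> + 1))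
          \<le> ennreal ((1 - t + norm (1 - z)) powr - (\<beta> + 1)) * ennreal (norm (f (of_real t)))"
          using G by (subst (1 2) ennreal_mult'[symmetric]) (auto intro: ennreal_leI)
        also have "\<dots> \<le> ennreal ((1 - t + norm (1 - z)) powr - (\<beta> + 1)) * (\<integral>\<^sup>+u. ennreal (\<phi> u) * (if u \<le> t then 1 else 0) \<partial>seg)"
          by (intro mult_left_mono fle t) simp
        finally show "ennreal (1 / G) * ennreal (\<beta> * norm (f (of_real t)) * norm (1 - of_real t * z) powr - (\<beta> + 1))
          \<le> ennreal ((1 - t + norm (1 - z)) powr - (\<beta> + 1)) * (\<integral>\<^sup>+u. ennreal (\<phi> u) * (if u \<le> t then 1 else 0) \<partial>seg)" .
      qed
      finally show "ennreal (X z) \<le> (\<integral>\<^sup>+t. ennreal ((1 - t + norm (1 - z)) powr - (\<beta> + 1)) *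
         (\<integral>\<^sup>+u. ennreal (\<phi> u) * (if u \<le> t then 1 else 0) \<partial>seg) \<partial>?M)" .
    qed
    also have "(\<integral>\<^sup>+u. ennreal (\<phi> u powr q * (1 - u) powr ((\<sigma> + 1) * q - 1)) \<partial>seg)
      \<le> ennreal ((2 powr e + K3 powr (q - p) * K2) * Nf powr q)"
    proof -
      let ?g = "\<lambda>u. ennreal (norm (deriv f (of_real u)) powr p * (1 - u) powr (\<alpha> + 1)) * indicator {0..<1} u"
      have gm: "?g \<in> borel_measurable lborel"
      proof -
        have [measurable]: "(\<lambda>u. indicator {0..<1} u *\<^sub>R norm (deriv f (complex_of_real u))) \<in> borel_measurable borel"
          by (intro borel_measurable_continuous_on_indicator[OF _ cder]) auto
        have "(\<lambda>u. ennreal ((indicator {0..<1} u *\<^sub>R norm (deriv f (complex_of_real u))) powr p * (1 - u) powr (\<alpha> + 1))) \<in> borel_measurable lborel"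
          by measurable
        also have "(\<lambda>u. ennreal ((indicator {0..<1} u *\<^sub>R norm (deriv f (complex_of_real u))) powr p * (1 - u) powr (\<alpha> + 1))) = ?g"
          by (auto simp: indicator_def)
        finally show ?thesis .
      qed
      have "(\<integral>\<^sup>+u. ennreal (\<phi> u powr q * (1 - u) powr ((\<sigma> + 1) * q - 1)) \<partial>seg)
        = (\<integral>\<^sup>+u. ennreal (\<phi> u powr q * (1 - u) powr e) * indicator {-1..<1} u \<partial>lborel)"
        unfolding e_def by (rule nn_integral_restrict_space) simp
      also have "\<dots> \<le> (\<integral>\<^sup>+u. ennreal (norm (f 0) powr q * 2 powr e) * indicator {-1..<0} u + ennreal ((K3 * N) powr (q - p)) * ?g u \<partial>lborel)"
      proof (intro nn_integral_mono)
        fix u :: real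
        consider "u \<in> {-1..<0}" | "u \<in> {0..<1}" | "u \<notin> {-1..<1}" by fastforce
        then show "ennreal (\<phi> u powr q * (1 - u) powr e) * indicator {-1..<1} u
          \<le> ennreal (norm (f 0) powr q * 2 powr e) * indicator {-1..<0} u + ennreal ((K3 * N) powr (q - p)) * ?g u"
        proof cases
          case 1
          then have "(1 - u) powr e \<le> 2 powr e" using e by (intro powr_mono2) auto
          then have "norm (f 0) powr q * (1 - u) powr e \<le> norm (f 0) powr q * 2 powr e" by (intro mult_left_mono) auto
          then show ?thesis using 1 by (simp add: \<phi>_neg[OF 1] ennreal_leI)
        next
          case 2
          define x where "x = norm (deriv f (complex_of_real u))"
          have u: "0 \<le> u" "u < 1" using 2 by auto
          have x: "x \<le> (K3 * N) * (1 - u) powr - (\<sigma> + 1)"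
            using grB[OF der, of "of_real u"] u by (simp add: x_def N_def \<sigma>_def)
          \<comment> \<open>Only the surplus power \<open>q - p\<close> is estimated pointwise. The
            exponents then add up to \<open>(\<sigma> + 1) * p - 1 = \<alpha> + 1\<close>, exactly
            the weight for which \<open>bergman_radial\<close> bounds the remaining
            \<open>p\<close>-th power; this is where \<open>p \<le> q\<close> enters.\<close>
          have "x powr q * (1 - u) powr e = x powr p * x powr (q - p) * (1 - u) powr e"
            by (simp add: powr_add[symmetric])
          also have "\<dots> \<le> x powr p * ((K3 * N) * (1 - u) powr - (\<sigma> + 1)) powr (q - p) * (1 - u) powr e"
            using x p by (intro mult_left_mono mult_right_mono powr_mono2) (auto simp: x_def)
          also have "\<dots> = (K3 * N) powr (q - p) * (x powr p * ((1 - u) powr (- (\<sigma> + 1) * (q - p)) * (1 - u) powr e))"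
            by (simp only: powr_mult powr_powr mult_ac)
          also have "(1 - u) powr (- (\<sigma> + 1) * (q - p)) * (1 - u) powr e = (1 - u) powr (\<alpha> + 1)"
          proof -
            have "- (\<sigma> + 1) * (q - p) + e = (\<sigma> + 1) * p - 1" by (simp add: e_def algebra_simps)
            then show ?thesis by (simp only: powr_add[symmetric] \<sigma>p) (simp add: add.commute)
          qed
          finally have "ennreal (x powr q * (1 - u) powr e) \<le> ennreal ((K3 * N) powr (q - p)) * ennreal (x powr p * (1 - u) powr (\<alpha> + 1))"
            by (subst ennreal_mult'[symmetric]) (auto intro: ennreal_leI)
          then show ?thesis using 2 by (simp add: \<phi>_pos[OF 2] x_def)
        qed simp
      qed
      also have "\<dots> = ennreal (norm (f 0) powr q * 2 powr e) + ennreal ((K3 * N) powr (q - p)) * (\<integral>\<^sup>+u. ?g u \<partial>lborel)"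
        using gm by (subst nn_integral_add) (auto simp: nn_integral_cmult nn_integral_cmult_indicator)
      also have "\<dots> \<le> ennreal (norm (f 0) powr q * 2 powr e) + ennreal ((K3 * N) powr (q - p)) * ennreal (K2 * N powr p)"
        unfolding N_def by (intro add_left_mono mult_left_mono rad der) simp
      also have "\<dots> = ennreal (norm (f 0) powr q * 2 powr e + (K3 * N) powr (q - p) * (K2 * N powr p))"
        using K2 by (simp add: ennreal_mult[symmetric] ennreal_plus[symmetric] del: ennreal_plus)
      also have "\<dots> \<le> ennreal ((2 powr e + K3 powr (q - p) * K2) * Nf powr q)"
      proof (rule ennreal_leI)
        have "norm (f 0) powr q * 2 powr e \<le> Nf powr q * 2 powr e" using N q by (intro mult_right_mono powr_mono2) auto
        moreover have "(K3 * N) powr (q - p) * (K2 * N powr p) = K3 powr (q - p) * K2 * N powr q"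
        proof -
          have "N powr q = N powr (q - p) * N powr p" by (simp add: powr_add[symmetric])
          then show ?thesis by (simp only: powr_mult mult_ac)
        qed
        moreover have "K3 powr (q - p) * K2 * N powr q \<le> K3 powr (q - p) * K2 * Nf powr q"
          using N q K2 by (intro mult_left_mono powr_mono2) auto
        ultimately show "norm (f 0) powr q * 2 powr e + (K3 * N) powr (q - p) * (K2 * N powr p) \<le> (2 powr e + K3 powr (q - p) * K2) * Nf powr q"
          unfolding distrib_right by (simp only: mult.commute[of "2 powr e"])
      qed
      finally show ?thesis .
    qed
    finally have Xq: "(\<integral>\<^sup>+z. ennreal (X z powr q) \<partial>?W) \<le> ennreal (K5 * Nf powr q)"
      using K4 K2 by (simp add: mult_left_mono ennreal_mult'[symmetric] K5_def mult.assoc)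
    have hd: "deriv h holomorphic_on ball 0 1" using hh by (rule holomorphic_deriv) auto
    have cd: "continuous_on (ball 0 1) (deriv h)" using hd by (rule holomorphic_on_imp_continuous_on)
    have "bergman_int q (\<beta> - 1) (deriv h) = ennreal \<beta> * (\<integral>\<^sup>+z. ennreal (norm (deriv h z) powr q) \<partial>?W)"
      using bergman_int_eq[OF cd, of q "\<beta> - 1"] by simp
    also have "(\<integral>\<^sup>+z. ennreal (norm (deriv h z) powr q) \<partial>?W) = (\<integral>\<^sup>+z. ennreal (G powr q) * ennreal (X z powr q) \<partial>?W)"
    proof (intro nn_integral_cong)
      fix z
      have "norm (deriv h z) = G * X z" using G by (simp add: X_def)
      then have "norm (deriv h z) powr q = G powr q * X z powr q" by (simp only: powr_mult)
      then show "ennreal (norm (deriv h z) powr q) = ennreal (G powr q) * ennreal (X z powr q)" by (simp add: ennreal_mult)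
    qed
    also have "\<dots> = ennreal (G powr q) * (\<integral>\<^sup>+z. ennreal (X z powr q) \<partial>?W)"
    proof (rule nn_integral_cmult)
      have [measurable]: "deriv h \<in> borel_measurable ?W" by (rule measurable_wdisc[OF cd])
      show "(\<lambda>z. ennreal (X z powr q)) \<in> borel_measurable ?W" unfolding X_def by measurable
    qed
    also have "ennreal \<beta> * (ennreal (G powr q) * (\<integral>\<^sup>+z. ennreal (X z powr q) \<partial>?W)) \<le> ennreal \<beta> * (ennreal (G powr q) * ennreal (K5 * Nf powr q))"
      by (intro mult_left_mono Xq) auto
    also have "\<dots> = ennreal (K6 * Nf powr q)"
      using \<beta> K5 by (simp add: ennreal_mult'[symmetric] K6_def mult_ac)
    finally have bi: "bergman_int q (\<beta> - 1) (deriv h) \<le> ennreal (K6 * Nf powr q)" .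
    have "bergman_int q (\<beta> - 1) (deriv h) < \<infinity>" by (rule le_less_trans[OF bi]) simp
    then have inD: "in_dirichlet q (\<beta> - 1) h" using hh hd by (simp add: in_dirichlet_def in_bergman_def)
    have "enn2real (bergman_int q (\<beta> - 1) (deriv h)) \<le> K6 * Nf powr q"
      using bi K6 by (intro enn2real_leI) auto
    then have "bergman_norm q (\<beta> - 1) (deriv h) \<le> (K6 * Nf powr q) powr (1/q)"
      unfolding bergman_norm_def using q by (intro powr_mono2) auto
    also have "\<dots> = K6 powr (1/q) * Nf" unfolding powr_mult powr_powr using q N by simp
    finally have "dirichlet_norm q (\<beta> - 1) h \<le> K1 * E * Nf + K6 powr (1/q) * Nf"
      using h0 by (simp add: dirichlet_norm_def)
    then show "H_defined \<mu> \<beta> f \<and> in_dirichlet q (\<beta> - 1) (H_op \<mu> \<beta> f) \<and>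
        dirichlet_norm q (\<beta> - 1) (H_op \<mu> \<beta> f) \<le> (K1 * E + K6 powr (1/q)) * dirichlet_norm p \<alpha> f"
      using hdef inD by (simp add: h_def Nf_def algebra_simps)
  qed
qed

text \<open>The bound \<open>13/10\<close> separates two regimes: above it \<open>(q\<^sup>2 - 1) / q > 1/2\<close>, so the
  hypothesis of (ii) already makes the Taylor series of \<open>f\<close> absolutely integrable termwise; below it
  \<open>(W)\<close> does.\<close>

lemma absolute_convergence_exponent:
  assumes q: "q > 1" and p: "0 < p" "p \<le> q" and \<beta>: "\<beta> > q" and W: "cond_W p \<alpha> \<mu>"
    and carl: "carleson ((\<alpha> + 2) / p - 1 + (\<beta> + 1) * (q - 1) / q) \<mu>"
  obtains s where "carleson s \<mu>" "(\<alpha> + 2) / p - 1 + 1/2 < s"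
proof (cases "q \<ge> 13/10")
  case True
  \<comment> \<open>The product is 1.04. What is needed is \<open>q * (q - 1/2) > 1\<close>, which
    for positive \<open>q\<close> means \<open>q > (1 + sqrt 17) / 4\<close>, about 1.281; the
    threshold is a simple rational above this root.\<close>
  have "13/10 * (13/10 - 1/2) \<le> q * (q - 1/2)" using True by (intro mult_mono) auto
  then have "q / 2 < (q + 1) * (q - 1)" by (simp add: algebra_simps)
  also have "\<dots> \<le> (\<beta> + 1) * (q - 1)" using q \<beta> by (intro mult_right_mono) auto
  finally have "1/2 < (\<beta> + 1) * (q - 1) / q" using q by (simp add: field_simps)
  then have "(\<alpha> + 2) / p - 1 + 1/2 < (\<alpha> + 2) / p - 1 + (\<beta> + 1) * (q - 1) / q"
    by (rule add_strict_left_mono)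
  with carl show ?thesis by (rule that)
next
  case False
  show ?thesis
  proof (cases "p \<le> 1")
    case True
    then have "carleson ((\<alpha> + 2) / p) \<mu>" using W by (simp add: cond_W_def)
    then show ?thesis by (rule that) simp
  next
    case False2: False
    then have c: "carleson ((\<alpha> + 2 - (p - 1)\<^sup>2) / p) \<mu>" using W False p by (simp add: cond_W_def)
    \<comment> \<open>Here \<open>1 < p \<le> q < 13/10\<close>, so the middle case of
      \<open>(W)\<close> applies. Its loss \<open>(p - 1)\<^sup>2 / p\<close> against
      \<open>(\<alpha> + 2) / p\<close> is below \<open>1/2\<close>.\<close>
    have "(p - 1)\<^sup>2 \<le> (3/10)\<^sup>2" using False False2 p by (intro power_mono) auto
    then have "(p - 1)\<^sup>2 < p / 2" using False2 by (simp add: power2_eq_square)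
    then have "(p - 1)\<^sup>2 / p < 1/2" using p by (simp add: field_simps)
    then show ?thesis by (intro that[OF c]) (simp add: diff_divide_distrib)
  qed
qed

theorem theorem4p3:
  fixes \<mu> :: "real measure" and p q \<alpha> \<beta> :: real
  assumes "sets \<mu> = sets borel"
    and "emeasure \<mu> (- {0..<1}) = 0"
    and "q > 1" and "0 < p" and "p \<le> q" and "\<alpha> > p - 1" and "\<beta> > q"
    and "cond_W p \<alpha> \<mu>"
  shows "(H_bounded_DD \<mu> \<beta> p \<alpha> q (\<beta> - 1) \<longrightarrow>
            carleson ((\<alpha> + 2) / p + (\<beta> + 1) / conj_exp q - 1) \<mu>)
       \<and> (carleson (max (\<alpha> + 2 - p) (\<beta> + 1) * (1 / p + 1 / conj_exp q)) \<mu> \<longrightarrow>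
            H_bounded_DD \<mu> \<beta> p \<alpha> q (\<beta> - 1))"
proof (intro conjI impI)
  have \<alpha>: "\<alpha> > -1" and \<beta>: "\<beta> > 0" using assms by auto
  \<comment> \<open>Whatever \<open>p\<close> is, some case of \<open>(W)\<close> applies, and a
    Carleson bound at \<open>t = 0\<close> already makes the measure on \<open>[0, 1)\<close>
    finite.\<close>
  have "\<exists>s. carleson s \<mu>" using assms(8) unfolding cond_W_def by (meson linear)
  then have fin: "finite_measure (unit_part \<mu>)" using finite_unit_part[OF assms(1)] by blast
  show "carleson ((\<alpha> + 2) / p + (\<beta> + 1) / conj_exp q - 1) \<mu>" if "H_bounded_DD \<mu> \<beta> p \<alpha> q (\<beta> - 1)"
    by (rule necessity[OF assms(1) fin assms(3,4) \<alpha> \<beta> that])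
  assume carl: "carleson (max (\<alpha> + 2 - p) (\<beta> + 1) * (1 / p + 1 / conj_exp q)) \<mu>"
  define \<sigma> where "\<sigma> = (\<alpha> + 2) / p - 1"
  have \<sigma>: "\<sigma> > 0" using assms by (simp add: \<sigma>_def field_simps)
  have cq: "1 / conj_exp q = (q - 1) / q" by (simp add: conj_exp_def)
  \<comment> \<open>Since \<open>\<sigma> = (\<alpha> + 2 - p) / p\<close>, the weaker exponent
    combines \<open>\<alpha> + 2 - p\<close> and \<open>\<beta> + 1\<close> with the positive
    weights \<open>1 / p\<close> and \<open>1 / q'\<close>. Replacing both by their maximum gives
    the exponent assumed in (ii).\<close>
  have "\<sigma> + (\<beta> + 1) * (q - 1) / q = (\<alpha> + 2 - p) * (1 / p) + (\<beta> + 1) * ((q - 1) / q)"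
    using assms(4) by (simp add: \<sigma>_def field_simps)
  also have "\<dots> \<le> max (\<alpha> + 2 - p) (\<beta> + 1) * (1 / p) + max (\<alpha> + 2 - p) (\<beta> + 1) * ((q - 1) / q)"
    using assms by (intro add_mono mult_right_mono) auto
  also have "\<dots> = max (\<alpha> + 2 - p) (\<beta> + 1) * (1 / p + 1 / conj_exp q)"
    unfolding cq by (rule distrib_left[symmetric])
  finally have carl0: "carleson (\<sigma> + (\<beta> + 1) * (q - 1) / q) \<mu>" by (rule carleson_mono[OF carl])
  obtain s where "carleson s \<mu>" "\<sigma> + 1/2 < s"
    using absolute_convergence_exponent[OF assms(3,4,5,7,8)] carl0 unfolding \<sigma>_def by blast
  then show "H_bounded_DD \<mu> \<beta> p \<alpha> q (\<beta> - 1)"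
    using sufficiency[OF assms(1,3,4,5) \<alpha> \<beta>] \<sigma> carl0 unfolding \<sigma>_def by blast
qed

end
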